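(* Let $I\subset\mathbb{R}$ be a compact interval and let $f:I\to I$ be either a continuous map or a piecewise monotonic map. Then the irregular set $I(f)$ of $f$ has full topological entropy, that is, $h_{\mathrm{top}}(I(f),f)=h_{\mathrm{top}}(f)$.
   Context: Piecewise monotonic map: $f:I\to I$ is piecewise monotonic if there is a partition of $I$ into finitely many pairwise disjoint intervals $I_1,\dots,I_k$ such that $f|_{I_j}$ is strictly monotone and continuous for $j=1,\dots,k$. Irregular set: $I(f)$ is the set of points $x$ in the interval for which there is a continuous real-valued function $\phi$ on the interval such that $\lim_{n\to\infty}\frac1n\sum_{i=0}^{n-1}\phi(f^i(x))$ does not exist. Topological entropy of a not necessarily compact set (in the sense of Pesin and Pitskel'): let $Y$ be a totally bounded metric space with (compact) completion $\hat Y$, $f:Y\to Y$ continuous and $A\subset Y$. For a finite open cover $\mathcal U$ of $\hat Y$, a string is a finite sequence $\mathbf U=(U_0,\dots,U_{m-1})$ of elements of $\mathcal U$, of length $m(\mathbf U)=m\ge 1$; put $Y(\mathbf U)=\{x\in Y: f^j(x)\in U_j,\ 0\le j<m\}$. For $\alpha\ge 0$ let $M(A,\alpha,\mathcal U,N)=\inf_{\mathcal G}\sum_{\mathbf U\in\mathcal G}e^{-\alpha m(\mathbf U)}$, the infimum over countable collections $\mathcal G$ of strings of length at least $N$ with $A\subset\bigcup_{\mathbf U\in\mathcal G}Y(\mathbf U)$. Put $h_{\mathcal U}(A)=\inf\{\alpha\ge 0:\lim_{N\to\infty}M(A,\alpha,\mathcal U,N)=0\}$ and $h_{\mathrm{top}}(A,f)=\lim_{\operatorname{diam}\mathcal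 U\to 0}h_{\mathcal U}(A)$, and $h_{\mathrm{top}}(f)=h_{\mathrm{top}}(Y,f)$. If $f:X\to X$ is discontinuous with set $Z$ of discontinuity points, entropies are computed by restricting $f$ to $Y=X\setminus\bigcup_{n\ge0}f^{-n}(Z)$: $h_{\mathrm{top}}(A,f)$ means $h_{\mathrm{top}}(A\cap Y,f|_Y)$ and $h_{\mathrm{top}}(f)=h_{\mathrm{top}}(Y,f|_Y)$. *)

theory Defs
  imports "HOL-Analysis.Analysis"
begin

text \<open>
  Topological entropy of non-compact sets in the sense of Pesin and Pitskel'. The space is a
  totally bounded subset \<open>Y\<close> of a complete metric space, so that its completion is
  \<open>closure Y\<close>. The map is a total function of which only the restriction to \<open>Y\<close> matters,
  and \<open>f ` Y \<subseteq> Y\<close> is understood.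
\<close>

definition finite_open_covers :: "'a::complete_space set \<Rightarrow> 'a set set set" where
  "finite_open_covers Y =
     {\<U>. finite \<U> \<and> (\<forall>U\<in>\<U>. openin (top_of_set (closure Y)) U) \<and> \<Union>\<U> = closure Y}"

definition strings :: "'a set set \<Rightarrow> 'a set list set" where
  "strings \<U> = {s \<in> lists \<U>. length s \<ge> 1}"

definition string_points :: "'a set \<Rightarrow> ('a \<Rightarrow> 'a) \<Rightarrow> 'a set list \<Rightarrow> 'a set" where
  "string_points Y f s = {x \<in> Y. \<forall>j<length s. (f ^^ j) x \<in> s ! j}"

definition string_coverings ::
    "'a set \<Rightarrow> ('a \<Rightarrow> 'a) \<Rightarrow> 'a set \<Rightarrow> 'a set set \<Rightarrow> nat \<Rightarrow> 'a set list set set" where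
  "string_coverings Y f A \<U> N =
     {\<G>. countable \<G> \<and> \<G> \<subseteq> strings \<U> \<and> (\<forall>s\<in>\<G>. length s \<ge> N) \<and>
          A \<subseteq> (\<Union>s\<in>\<G>. string_points Y f s)}"

definition entropy_premeasure ::
    "'a set \<Rightarrow> ('a \<Rightarrow> 'a) \<Rightarrow> 'a set \<Rightarrow> real \<Rightarrow> 'a set set \<Rightarrow> nat \<Rightarrow> ennreal" where
  "entropy_premeasure Y f A \<alpha> \<U> N =
     (INF \<G>\<in>string_coverings Y f A \<U> N.
        \<Sum>\<^sub>\<infinity>s\<in>\<G>. ennreal (exp (- \<alpha> * real (length s))))"

definition cover_entropy ::
    "'a set \<Rightarrow> ('a \<Rightarrow> 'a) \<Rightarrow> 'a set \<Rightarrow> 'a set set \<Rightarrow> ennreal" where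
  "cover_entropy Y f A \<U> =
     (INF \<alpha>\<in>{\<alpha>::real. \<alpha> \<ge> 0 \<and> entropy_premeasure Y f A \<alpha> \<U> \<longlonglongrightarrow> 0}. ennreal \<alpha>)"

text \<open>
  The filter on finite open covers that expresses \<open>diam \<U> \<rightarrow> 0\<close>, where \<open>diam \<U>\<close> is the
  largest diameter of a member of \<open>\<U>\<close>. It is proper when \<open>closure Y\<close> is compact.
\<close>

definition small_covers :: "'a::complete_space set \<Rightarrow> 'a set set filter" where
  "small_covers Y =
     (INF \<delta>\<in>{0<..}. principal {\<U> \<in> finite_open_covers Y. \<forall>U\<in>\<U>. diameter U < \<delta>})"

definition Pesin_Pitskel_entropy ::
    "'a::complete_space set \<Rightarrow> ('a \<Rightarrow> 'a) \<Rightarrow> 'a set \<Rightarrow> ennreal" where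
  "Pesin_Pitskel_entropy Y f A = Lim (small_covers Y) (cover_entropy Y f A)"

text \<open>
  For a possibly discontinuous map \<open>f\<close> of \<open>X\<close> into itself, entropies are computed on the set of
  points whose orbit never meets a discontinuity of \<open>f\<close>, where continuity is relative to \<open>X\<close>.
  This set is all of \<open>X\<close> when \<open>f\<close> is continuous on \<open>X\<close>.
\<close>

definition discontinuities :: "'a::t2_space set \<Rightarrow> ('a \<Rightarrow> 'a) \<Rightarrow> 'a set" where
  "discontinuities X f = {x \<in> X. \<not> continuous (at x within X) f}"

definition regular_domain :: "'a::t2_space set \<Rightarrow> ('a \<Rightarrow> 'a) \<Rightarrow> 'a set" where
  "regular_domain X f = X - (\<Union>n. (f ^^ n) -` discontinuities X f)"

definition htop_set :: "'a::complete_space set \<Rightarrow> ('a \<Rightarrow> 'a) \<Rightarrow> 'a set \<Rightarrow> ennreal" where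
  "htop_set X f A = Pesin_Pitskel_entropy (regular_domain X f) f (A \<inter> regular_domain X f)"

definition htop :: "'a::complete_space set \<Rightarrow> ('a \<Rightarrow> 'a) \<Rightarrow> ennreal" where
  "htop X f = Pesin_Pitskel_entropy (regular_domain X f) f (regular_domain X f)"

text \<open>Pieces may be open, half-open, closed or degenerate intervals.\<close>

definition piecewise_monotonic :: "real set \<Rightarrow> (real \<Rightarrow> real) \<Rightarrow> bool" where
  "piecewise_monotonic I f \<longleftrightarrow>
     (\<exists>P. finite P \<and> partition_on I P \<and>
          (\<forall>J\<in>P. is_interval J \<and> continuous_on J f \<and>
                 (strict_mono_on J f \<or> strict_antimono_on J f)))"

definition irregular_set :: "'a::topological_space set \<Rightarrow> ('a \<Rightarrow> 'a) \<Rightarrow> 'a set" where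
  "irregular_set X f =
     {x \<in> X. \<exists>\<phi>::'a \<Rightarrow> real. continuous_on X \<phi> \<and>
        \<not> convergent (\<lambda>n. (1 / real n) * (\<Sum>i<n. \<phi> ((f ^^ i) x)))}"

end

theory Submission
  imports Defs "HOL-Probability.Probability" "HOL-Real_Asymp.Real_Asymp"
begin

text \<open>
  Suppose \<open>h\<^sub>\<U>(Y) > \<alpha> > 0\<close>. Choose \<open>k\<close> with \<open>e\<^sup>\<alpha>\<^sup>k > 2\<close> and cut the interval into finitely
  many intervals that are adapted to \<open>f, \<dots>, f\<^sup>k\<^sup>-\<^sup>1\<close> and \<open>\<U>\<close>. The set of points of an interval
  with a given itinerary under \<open>f\<^sup>k\<close> is mapped onto an interval, which covers every piece that it
  meets except at most two. Hence the exponential growth of the number of itineraries is attained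
  by the itineraries that lead from one fixed piece over that whole piece, a horseshoe of an
  iterate of \<open>f\<close>.

  To be able to control averages along \<open>f\<close> itself, one selects finitely many points with finite
  orbits that witness the horseshoe. Their orbits form a finite invariant set \<open>P\<close>, and the
  intervals between neighbouring points of \<open>P\<close> form a Markov graph for \<open>f\<close> with at least the
  same growth. Its closed walks of one long length through one vertex are symbols that may be
  concatenated freely. Codes in which one symbol \<open>w\<close> is forced at sparse places of oscillating
  frequency, and rotations of \<open>w\<close> are avoided elsewhere, belong to irregular points, because the
  block \<open>w w w\<close> occurs with positive upper and zero lower frequency. The uniform measure on these
  codes bounds the entropy from below and does not charge the countable set \<open>X - Y\<close>.
\<close>

section \<open>Growth of languages\<close>

text \<open>All estimates leave slack, so growth rates are never computed as limits.
  \<open>light t L\<close> says that the weights \<open>t ^ length w\<close> are summable; this is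
  stable under finite unions and concatenation, and its failure returns long levels with many words.
  Each passage to a simpler object costs an arbitrarily small part of the rate.

  The detour through a finite invariant set has a reason. A horseshoe of \<open>f ^^ (k * n)\<close>
  says little about intermediate times, whereas irregularity concerns averages along
  \<open>f\<close>. Naming the position at every single time by a gap of \<open>P\<close> makes it
  possible to compare orbits at all phases of a period, and so to separate the points that follow
  \<open>w w w\<close> from shifted windows around a symbol that is no rotation of \<open>w\<close>
  by a continuous function. Separation wants compact sets, hence closed gaps; closed gaps overlap in
  \<open>P\<close>, which is why symbols must avoid \<open>P\<close>.

  Continuous maps need not have finitely many laps. The partition therefore keeps only continuity
  and small oscillation, and the intermediate value theorem takes the place of monotone
  branches.\<close>

definition light :: "real \<Rightarrow> 'a list set \<Rightarrow> bool" where
  "light t L \<longleftrightarrow> (\<exists>C. \<forall>F. finite F \<longrightarrow> F \<subseteq> L \<longrightarrow> (\<Sum>w\<in>F. t ^ length w) \<le> C)"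

lemma lightI: "(\<And>F. finite F \<Longrightarrow> F \<subseteq> L \<Longrightarrow> (\<Sum>w\<in>F. t ^ length w) \<le> C) \<Longrightarrow> light t L"
  unfolding light_def by blast

lemma light_subset: "light t L \<Longrightarrow> K \<subseteq> L \<Longrightarrow> light t K"
  unfolding light_def by (meson order_trans)

lemma light_empty [simp]: "light t {}"
  by (rule lightI[of _ _ 0]) auto

lemma light_singleton:
  assumes "0 \<le> t"
  shows "light t {w}"
proof (rule lightI[of _ _ "t ^ length w"])
  fix F :: "'a list set" assume "F \<subseteq> {w}"
  then have "F = {} \<or> F = {w}" by auto
  then show "(\<Sum>w\<in>F. t ^ length w) \<le> t ^ length w" using assms by auto
qed

lemma light_Un:
  assumes "0 \<le> t" "light t K" "light t L"
  shows "light t (K \<union> L)"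
proof -
  obtain C where C: "\<And>F. finite F \<Longrightarrow> F \<subseteq> K \<Longrightarrow> (\<Sum>w\<in>F. t ^ length w) \<le> C"
    using assms(2) unfolding light_def by blast
  obtain D where D: "\<And>F. finite F \<Longrightarrow> F \<subseteq> L \<Longrightarrow> (\<Sum>w\<in>F. t ^ length w) \<le> D"
    using assms(3) unfolding light_def by blast
  show ?thesis
  proof (rule lightI[of _ _ "C + D"])
    fix F assume F: "finite F" "F \<subseteq> K \<union> L"
    have "F = (F \<inter> K) \<union> (F - K)" by auto
    then have "(\<Sum>w\<in>F. t ^ length w) = (\<Sum>w\<in>F \<inter> K. t ^ length w) + (\<Sum>w\<in>F - K. t ^ length w)"
      by (subst sum.union_disjoint[symmetric]) (use F in auto)
    also have "\<dots> \<le> C + D"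
      using F by (intro add_mono C D) auto
    finally show "(\<Sum>w\<in>F. t ^ length w) \<le> C + D" .
  qed
qed

lemma light_UN:
  assumes "0 \<le> t" "finite J" "\<And>j. j \<in> J \<Longrightarrow> light t (L j)"
  shows "light t (\<Union>j\<in>J. L j)"
  using assms(2,3) by (induction J) (auto intro: light_Un assms(1))

lemma light_append:
  assumes t: "0 \<le> t" and "light t K" "light t L"
  shows "light t {u @ v | u v. u \<in> K \<and> v \<in> L}"
proof -
  obtain C where C: "\<And>F. finite F \<Longrightarrow> F \<subseteq> K \<Longrightarrow> (\<Sum>w\<in>F. t ^ length w) \<le> C"
    using assms(2) unfolding light_def by blast
  obtain D where D: "\<And>F. finite F \<Longrightarrow> F \<subseteq> L \<Longrightarrow> (\<Sum>w\<in>F. t ^ length w) \<le> D"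
    using assms(3) unfolding light_def by blast
  have C0: "0 \<le> C" using C[of "{}"] by simp
  show ?thesis
  proof (rule lightI[of _ _ "C * D"])
    fix F assume F: "finite F" "F \<subseteq> {u @ v | u v. u \<in> K \<and> v \<in> L}"
    have "\<forall>w\<in>F. \<exists>p. fst p \<in> K \<and> snd p \<in> L \<and> w = fst p @ snd p" using F by force
    then obtain h where h: "\<And>w. w \<in> F \<Longrightarrow> fst (h w) \<in> K \<and> snd (h w) \<in> L \<and> w = fst (h w) @ snd (h w)"
      by metis
    define A where "A = fst ` h ` F"
    define B where "B = snd ` h ` F"
    \<comment> \<open>\<open>w\<close> is the concatenation of \<open>h w\<close>; fixing one
      factorization per word keeps the count correct although a word may split in several
      ways.\<close>
    have inj: "inj_on h F" by (rule inj_onI) (metis h)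
    have "(\<Sum>w\<in>F. t ^ length w) = (\<Sum>w\<in>F. t ^ length (fst (h w)) * t ^ length (snd (h w)))"
      by (rule sum.cong) (auto simp: power_add[symmetric] dest!: h intro: arg_cong[where f = "\<lambda>w. t ^ length w"] simp flip: length_append)
    also have "\<dots> = (\<Sum>p\<in>h ` F. t ^ length (fst p) * t ^ length (snd p))"
      by (simp add: sum.reindex[OF inj])
    also have "\<dots> \<le> (\<Sum>p\<in>A \<times> B. t ^ length (fst p) * t ^ length (snd p))"
    proof (rule sum_mono2)
      show "h ` F \<subseteq> A \<times> B" unfolding A_def B_def by (intro subsetI) (simp add: mem_Times_iff)
    qed (use F t in \<open>auto simp: A_def B_def\<close>)
    also have "\<dots> = (\<Sum>w\<in>A. t ^ length w) * (\<Sum>w\<in>B. t ^ length w)"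
      by (simp add: sum_product sum.cartesian_product case_prod_unfold)
    also have "\<dots> \<le> C * D"
      by (intro mult_mono C D sum_nonneg C0) (use F h t in \<open>auto simp: A_def B_def\<close>)
    finally show "(\<Sum>w\<in>F. t ^ length w) \<le> C * D" .
  qed
qed

text \<open>Beyond \<open>n0\<close> the level sums are dominated by the geometric series with ratio
  \<open>r * t\<close>; the shorter words form a finite set.\<close>

lemma light_if_levels:
  fixes t r :: real
  assumes t: "0 \<le> t" and r: "0 \<le> r" "r * t < 1"
    and fin: "\<And>n. finite {w \<in> L. length w = n}"
    and card: "\<And>n. n \<ge> n0 \<Longrightarrow> card {w \<in> L. length w = n} \<le> r ^ n"
  shows "light t L"
proof -
  let ?S = "{w \<in> L. length w < n0}"
  have "?S = (\<Union>n<n0. {w \<in> L. length w = n})" by auto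
  then have finS: "finite ?S" using fin by simp
  have 1: "light t ?S"
    by (rule lightI[of _ _ "\<Sum>w\<in>?S. t ^ length w"]) (use finS t in \<open>auto intro: sum_mono2\<close>)
  have rt: "0 \<le> r * t" using t r by simp
  have 2: "light t {w \<in> L. length w \<ge> n0}"
  proof (rule lightI[of _ _ "\<Sum>n. (r * t) ^ n"])
    fix F assume F: "finite F" "F \<subseteq> {w \<in> L. length w \<ge> n0}"
    have "(\<Sum>w\<in>F. t ^ length w) = (\<Sum>n\<in>length ` F. \<Sum>w\<in>{w \<in> F. length w = n}. t ^ length w)"
      by (rule sum.image_gen[OF F(1)])
    also have "\<dots> = (\<Sum>n\<in>length ` F. card {w \<in> F. length w = n} * t ^ n)"
      by (rule sum.cong) auto
    also have "\<dots> \<le> (\<Sum>n\<in>length ` F. (r * t) ^ n)"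
    proof (rule sum_mono)
      fix n assume "n \<in> length ` F"
      then have n: "n \<ge> n0" using F by auto
      have "card {w \<in> F. length w = n} \<le> card {w \<in> L. length w = n}"
        by (rule card_mono) (use F fin in auto)
      then have "real (card {w \<in> F. length w = n}) \<le> r ^ n" using card[OF n] by linarith
      then show "card {w \<in> F. length w = n} * t ^ n \<le> (r * t) ^ n"
        using t by (simp add: power_mult_distrib mult_right_mono)
    qed
    also have "\<dots> \<le> (\<Sum>n. (r * t) ^ n)"
      by (rule sum_le_suminf) (use F(1) r(2) rt in \<open>auto intro!: summable_geometric simp del: power_mult_distrib\<close>)
    finally show "(\<Sum>w\<in>F. t ^ length w) \<le> (\<Sum>n. (r * t) ^ n)" .
  qed
  show ?thesis
    by (rule light_subset[OF light_Un[OF t 1 2]]) auto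
qed

lemma many_words_if_not_light:
  fixes t r :: real
  assumes "0 \<le> t" "0 \<le> r" "r * t < 1" "\<not> light t L" "\<And>n. finite {w \<in> L. length w = n}"
  obtains n where "n \<ge> n0" "card {w \<in> L. length w = n} > r ^ n"
  using light_if_levels[OF assms(1-3,5), of n0] assms(4) by (meson not_le)

text \<open>Infinitely many disjoint levels of weight at least \<open>e\<close> would exceed any
  bound. The freedom of \<open>g\<close> matters because the levels available later have lengths
  \<open>N * L + 1\<close> or start beyond a given length.\<close>

lemma light_levels_small:
  fixes t e :: real
  assumes t: "0 \<le> t" and L: "light t L" and fin: "\<And>n. finite {w \<in> L. length w = n}" and e: "0 < e"
    and g: "inj (g :: nat \<Rightarrow> nat)"
  obtains k where "card {w \<in> L. length w = g k} * t ^ g k < e"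
proof -
  obtain C where C: "\<And>F. finite F \<Longrightarrow> F \<subseteq> L \<Longrightarrow> (\<Sum>w\<in>F. t ^ length w) \<le> C"
    using L unfolding light_def by blast
  have "\<exists>k. card {w \<in> L. length w = g k} * t ^ g k < e"
  proof (rule ccontr)
    assume "\<not> ?thesis"
    then have big: "\<And>k. card {w \<in> L. length w = g k} * t ^ g k \<ge> e" by (auto simp: not_less)
    obtain k :: nat where k: "C < k * e" using reals_Archimedean3[OF e] by blast
    define F where "F = (\<Union>n\<in>g ` {..<k}. {w \<in> L. length w = n})"
    have "k * e = (\<Sum>n\<in>g ` {..<k}. e)" using g by (simp add: card_image inj_on_subset)
    also have "\<dots> \<le> (\<Sum>n\<in>g ` {..<k}. card {w \<in> L. length w = n} * t ^ n)"
      by (rule sum_mono) (use big in auto)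
    also have "\<dots> = (\<Sum>n\<in>g ` {..<k}. \<Sum>w\<in>{w \<in> L. length w = n}. t ^ length w)"
      by (rule sum.cong) auto
    also have "\<dots> = (\<Sum>w\<in>F. t ^ length w)"
      unfolding F_def by (subst sum.UNION_disjoint) (use fin in auto)
    also have "\<dots> \<le> C"
      by (rule C) (use fin in \<open>auto simp: F_def\<close>)
    finally show False using k by simp
  qed
  then show ?thesis using that by blast
qed

text \<open>The letters that an automaton reads in full erase its memory. The other letters, at most \<open>r\<close>
  from each state, contribute a growth rate of at most \<open>r\<close>, so that every growth rate above \<open>r\<close> is
  already attained by the words that lead from some letter back to itself.\<close>

locale resetting_automaton =
  fixes letters :: "'a set" and states :: "'q set"
    and ok full :: "'q \<Rightarrow> 'a \<Rightarrow> bool" and step :: "'q \<Rightarrow> 'a \<Rightarrow> 'q" and reset :: "'a \<Rightarrow> 'q"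
    and r :: nat
  assumes finite_letters: "finite letters"
    and ok_letters: "ok q A \<Longrightarrow> A \<in> letters"
    and step_states: "q \<in> states \<Longrightarrow> ok q A \<Longrightarrow> step q A \<in> states"
    and full_ok: "full q A \<Longrightarrow> ok q A"
    and full_reset: "full q A \<Longrightarrow> step q A = reset A"
    and card_partial: "q \<in> states \<Longrightarrow> card {A. ok q A \<and> \<not> full q A} \<le> r"
begin

fun accepts :: "'q \<Rightarrow> 'a list \<Rightarrow> bool" where
  "accepts q [] \<longleftrightarrow> True"
| "accepts q (A # w) \<longleftrightarrow> ok q A \<and> accepts (step q A) w"

fun run :: "'q \<Rightarrow> 'a list \<Rightarrow> 'q" where
  "run q [] = q"
| "run q (A # w) = run (step q A) w"

fun marks :: "'q \<Rightarrow> 'a list \<Rightarrow> 'a set" where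
  "marks q [] = {}"
| "marks q (A # w) = (if full q A then {A} else {}) \<union> marks (step q A) w"

definition loops :: "'a \<Rightarrow> 'a list set" where
  "loops A = {A # w |w. accepts (reset A) w \<and> full (run (reset A) w) A}"

text \<open>\<open>M\<close> is the induction parameter of \<open>light_accepted\<close>: past its
  last full reading, a letter leaves \<open>M\<close>.\<close>

definition marked :: "'a set \<Rightarrow> 'q \<Rightarrow> 'a list set" where
  "marked M q = {w. accepts q w \<and> marks q w \<subseteq> M}"

lemma accepts_letters: "accepts q w \<Longrightarrow> set w \<subseteq> letters"
  by (induction w arbitrary: q) (auto dest: ok_letters)

lemma finite_level: "finite {w. accepts q w \<and> length w = n}"
  by (rule finite_subset[OF _ finite_lists_length_eq[OF finite_letters, of n]])
    (auto dest: accepts_letters)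

lemma finite_loops_level: "finite {w \<in> loops A. length w = n}"
proof (rule finite_subset[OF _ finite_lists_length_eq[OF finite_letters, of n]])
  show "{w \<in> loops A. length w = n} \<subseteq> {xs. set xs \<subseteq> letters \<and> length xs = n}"
    unfolding loops_def by (auto dest!: accepts_letters full_ok dest: ok_letters)
qed

lemma run_states: "q \<in> states \<Longrightarrow> accepts q w \<Longrightarrow> run q w \<in> states"
  by (induction w arbitrary: q) (auto dest: step_states)

lemma finite_partial: "finite {A. ok q A \<and> \<not> full q A}"
  by (rule finite_subset[OF _ finite_letters]) (auto dest: ok_letters)

text \<open>Without a full reading, each letter is one of at most \<open>r\<close> partial ones,
  whatever the current state is.\<close>

lemma card_unmarked:
  assumes "q \<in> states"
  shows "card {w \<in> marked {} q. length w = n} \<le> r ^ n"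
  using assms
proof (induction n arbitrary: q)
  case 0
  have "{w \<in> marked {} q. length w = 0} \<subseteq> {[]}" by auto
  from card_mono[OF _ this] show ?case by simp
next
  case (Suc n)
  let ?P = "{A. ok q A \<and> \<not> full q A}"
  have fin: "finite {w \<in> marked {} q'. length w = n}" for q'
    by (rule finite_subset[OF _ finite_level[of q' n]]) (auto simp: marked_def)
  have "{w \<in> marked {} q. length w = Suc n}
      \<subseteq> (\<Union>A\<in>?P. (#) A ` {w \<in> marked {} (step q A). length w = n})"
  proof
    fix w assume "w \<in> {w \<in> marked {} q. length w = Suc n}"
    then show "w \<in> (\<Union>A\<in>?P. (#) A ` {w \<in> marked {} (step q A). length w = n})"
      by (cases w) (auto simp: marked_def split: if_splits)
  qed
  then have "card {w \<in> marked {} q. length w = Suc n}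
      \<le> card (\<Union>A\<in>?P. (#) A ` {w \<in> marked {} (step q A). length w = n})"
    by (rule card_mono[rotated]) (use fin finite_partial in auto)
  also have "\<dots> \<le> (\<Sum>A\<in>?P. card ((#) A ` {w \<in> marked {} (step q A). length w = n}))"
    by (rule card_UN_le[OF finite_partial])
  also have "\<dots> \<le> (\<Sum>A\<in>?P. r ^ n)"
  proof (rule sum_mono)
    fix A assume "A \<in> ?P"
    then have "step q A \<in> states" using Suc.prems step_states by blast
    then show "card ((#) A ` {w \<in> marked {} (step q A). length w = n}) \<le> r ^ n"
      using Suc.IH card_image_le[OF fin] le_trans by blast
  qed
  also have "\<dots> \<le> r * r ^ n" using card_partial[OF Suc.prems] by simp
  finally show ?case by simp
qed

lemma split_first_mark:
  assumes "w \<in> marked M q" "w \<notin> marked {} q"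
  obtains u B x where "w = u @ B # x" "u \<in> marked {} q" "full (run q u) B" "B \<in> M" "x \<in> marked M (reset B)"
proof -
  have "\<exists>u B x. w = u @ B # x \<and> u \<in> marked {} q \<and> full (run q u) B \<and> B \<in> M \<and> x \<in> marked M (reset B)"
    using assms
  proof (induction w arbitrary: q)
    case Nil
    then show ?case by (simp add: marked_def)
  next
    case (Cons A w)
    show ?case
    proof (cases "full q A")
      case True
      then have "A # w = [] @ A # w \<and> [] \<in> marked {} q \<and> full (run q []) A \<and> A \<in> M \<and> w \<in> marked M (reset A)"
        using Cons.prems full_reset by (auto simp: marked_def)
      then show ?thesis by blast
    next
      case False
      then have "w \<in> marked M (step q A)" "w \<notin> marked {} (step q A)" and okA: "ok q A"
        using Cons.prems by (auto simp: marked_def)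
      from Cons.IH[OF this(1,2)] obtain u B x where "w = u @ B # x" "u \<in> marked {} (step q A)"
        "full (run (step q A) u) B" "B \<in> M" "x \<in> marked M (reset B)" by blast
      then have "A # w = (A # u) @ B # x \<and> A # u \<in> marked {} q \<and> full (run q (A # u)) B \<and> B \<in> M
        \<and> x \<in> marked M (reset B)" using False okA by (auto simp: marked_def)
      then show ?thesis by blast
    qed
  qed
  then show ?thesis using that by blast
qed

lemma split_last_mark:
  assumes "w \<in> marked M q" "B \<in> marks q w"
  shows "\<exists>u y. w = u @ B # y \<and> accepts q u \<and> full (run q u) B \<and> y \<in> marked (M - {B}) (reset B)"
  using assms
proof (induction w arbitrary: q)
  case Nil
  then show ?case by simp
next
  case (Cons A w)
  show ?case
  proof (cases "B \<in> marks (step q A) w")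
    case True
    have "w \<in> marked M (step q A)" using Cons.prems by (auto simp: marked_def)
    from Cons.IH[OF this True] obtain u y where "w = u @ B # y" "accepts (step q A) u"
        "full (run (step q A) u) B" "y \<in> marked (M - {B}) (reset B)" by blast
    moreover have "ok q A" using Cons.prems by (auto simp: marked_def)
    ultimately have "A # w = (A # u) @ B # y \<and> accepts q (A # u) \<and> full (run q (A # u)) B \<and>
        y \<in> marked (M - {B}) (reset B)" by auto
    then show ?thesis by blast
  next
    case False
    then have AB: "A = B" "full q B" using Cons.prems by (auto split: if_splits)
    then have "w \<in> marked (M - {B}) (reset B)"
      using Cons.prems False full_reset by (auto simp: marked_def)
    then have "A # w = [] @ B # w \<and> accepts q [] \<and> full (run q []) B \<and> w \<in> marked (M - {B}) (reset B)"
      using AB by auto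
    then show ?thesis by blast
  qed
qed

text \<open>Cut an accepted word at the first letter \<open>B\<close> that is read in full and at
  the last full reading of the same \<open>B\<close>. Before the first cut nothing is read in full,
  so that part is light because \<open>r * t < 1\<close>; between the cuts lies a loop; the rest
  starts in \<open>reset B\<close> whatever came before, and its full letters lie in
  \<open>M - {B}\<close>, so induction on \<open>card M\<close> applies.\<close>

theorem light_accepted:
  fixes t :: real
  assumes t: "0 \<le> t" "r * t < 1" and q: "q \<in> states"
    and loops: "\<And>A. A \<in> letters \<Longrightarrow> light t (loops A)"
  shows "light t {w. accepts q w}"
proof -
  have "light t (marked M q)" if "M \<subseteq> letters" for M
  proof -
    have "finite M" using that finite_letters finite_subset by blast
    then show ?thesis using that q
    proof (induction "card M" arbitrary: M q rule: less_induct)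
      case less
      have unmarked: "light t (marked {} q)"
      proof (rule light_if_levels[of t r _ 0])
        show "finite {w \<in> marked {} q. length w = n}" for n
          by (rule finite_subset[OF _ finite_level[of q n]]) (auto simp: marked_def)
        show "real (card {w \<in> marked {} q. length w = n}) \<le> real r ^ n" for n
          using card_unmarked[OF less.prems(3), of n] by (metis of_nat_le_iff of_nat_power)
      qed (use t in auto)
      \<comment> \<open>That \<open>reset B\<close> is a state is known only if \<open>B\<close> can
        be read in full from some state.\<close>
      define M' where "M' = {B \<in> M. reset B \<in> states}"
      define tail where "tail B = {[B] @ y |y. y \<in> marked (M - {B}) (reset B)}" for B
      \<comment> \<open>The empty middle part stands for a letter \<open>B\<close> whose first full
        reading is also its last.\<close>
      define piece where "piece B = {u @ v @ y | u v y. u \<in> marked {} q \<and> v \<in> insert [] (loops B) \<and> y \<in> tail B}" for B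
      have piece: "light t (piece B)" if "B \<in> M'" for B
      proof -
        have B: "B \<in> M" "reset B \<in> states" using that by (auto simp: M'_def)
        have "card (M - {B}) < card M" using B less.prems by (meson card_Diff1_less)
        then have "light t (marked (M - {B}) (reset B))"
          by (rule less.hyps) (use less.prems B in auto)
        then have "light t {x @ y |x y. x \<in> {[B]} \<and> y \<in> marked (M - {B}) (reset B)}"
          by (intro light_append light_singleton t)
        then have 1: "light t (tail B)" by (simp add: tail_def)
        have "light t ({[]} \<union> loops B)"
          by (intro light_Un light_singleton t loops) (use B less.prems in auto)
        then have "light t (insert [] (loops B))" by simp
        from light_append[OF t(1) unmarked light_append[OF t(1) this 1]] show ?thesis
          by (rule light_subset) (auto simp: piece_def)
      qed
      have "marked M q \<subseteq> marked {} q \<union> (\<Union>B\<in>M'. piece B)"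
      proof
        fix w assume w: "w \<in> marked M q"
        show "w \<in> marked {} q \<union> (\<Union>B\<in>M'. piece B)"
        proof (cases "w \<in> marked {} q")
          case False
          from split_first_mark[OF w False] obtain u B x where ubx: "w = u @ B # x" "u \<in> marked {} q"
            "full (run q u) B" "B \<in> M" "x \<in> marked M (reset B)" .
          have "run q u \<in> states" using run_states[OF less.prems(3)] ubx(2) by (auto simp: marked_def)
          then have "reset B \<in> states" using step_states full_ok full_reset ubx(3) by metis
          then have B: "B \<in> M'" using ubx by (simp add: M'_def)
          have "\<exists>v y. B # x = v @ y \<and> v \<in> insert [] (loops B) \<and> y \<in> tail B"
          proof (cases "B \<in> marks (reset B) x")
            case True
            from split_last_mark[OF ubx(5) this] obtain u' y where u': "x = u' @ B # y"
              "accepts (reset B) u'" "full (run (reset B) u') B" "y \<in> marked (M - {B}) (reset B)" by blast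
            then have "B # x = (B # u') @ ([B] @ y)" "B # u' \<in> loops B" "[B] @ y \<in> tail B"
              by (auto simp: loops_def tail_def)
            then show ?thesis by blast
          next
            case False
            then have "x \<in> marked (M - {B}) (reset B)" using ubx(5) by (auto simp: marked_def)
            then have "B # x = [] @ ([B] @ x)" "[B] @ x \<in> tail B" by (auto simp: tail_def)
            then show ?thesis by blast
          qed
          then obtain v y where "w = u @ v @ y" "v \<in> insert [] (loops B)" "y \<in> tail B"
            using ubx by auto
          then have "w \<in> piece B" unfolding piece_def using ubx(2) by blast
          then show ?thesis using B by blast
        qed simp
      qed
      then show ?case
        by (rule light_subset[rotated])
          (intro light_Un light_UN t unmarked piece, use less.prems in \<open>auto simp: M'_def\<close>)
    qed
  qed
  moreover have "marks q w \<subseteq> letters" for q w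
    by (induction w arbitrary: q) (auto dest: full_ok ok_letters)
  then have "{w. accepts q w} = marked letters q" by (auto simp: marked_def)
  ultimately show ?thesis by simp
qed

end

section \<open>Horseshoes of piecewise continuous interval maps\<close>

lemma closed_segment_subset_image:
  fixes h :: "real \<Rightarrow> real"
  assumes "continuous_on S h" "is_interval S" "x \<in> S" "y \<in> S"
  shows "closed_segment (h x) (h y) \<subseteq> h ` S"
proof -
  have "connected (h ` S)"
    using assms by (intro connected_continuous_image) (auto simp: is_interval_connected_1)
  then have "convex (h ` S)" by (metis is_interval_connected_1 is_interval_convex_1)
  then show ?thesis using assms by (intro closed_segment_subset) auto
qed

lemma is_interval_closed_segment: "is_interval (closed_segment (x::real) y)"
  by (simp add: is_interval_convex_1)

lemma is_interval_image:
  fixes h :: "real \<Rightarrow> real"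
  assumes "continuous_on S h" "is_interval S"
  shows "is_interval (h ` S)"
  using assms by (metis connected_continuous_image is_interval_connected_1)

lemma closed_segment_subset_interval:
  fixes S :: "real set"
  assumes "is_interval S" "x \<in> S" "y \<in> S"
  shows "closed_segment x y \<subseteq> S"
  using assms by (simp add: closed_segment_subset is_interval_convex_1)

text \<open>Needed to lift itineraries backwards: a preimage whose image spilled over the target
  segment could leave the later pieces of the itinerary.\<close>

lemma segment_exact_image:
  fixes h :: "real \<Rightarrow> real"
  assumes "continuous_on (closed_segment p q) h"
  obtains p' q' where "p' \<in> closed_segment p q" "q' \<in> closed_segment p q" "h p' = h p" "h q' = h q"
    "h ` closed_segment p' q' \<subseteq> closed_segment (h p) (h q)"
proof -
  define S where "S = closed_segment p q"
  have hS: "continuous_on S h" using assms by (simp add: S_def)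
  have cl: "closed {x \<in> S. h x = c}" for c
    using continuous_closed_preimage_constant[OF hS] by (simp add: S_def closed_segment)
  have cp: "compact {x \<in> S. h x = c}" for c
  proof -
    have "compact (S \<inter> {x \<in> S. h x = c})"
      using cl by (intro compact_Int_closed) (auto simp: S_def)
    then show ?thesis by (simp add: Int_def)
  qed
  \<comment> \<open>Preimages of the two values at minimal distance do.\<close>
  define Z where "Z = {x \<in> S. h x = h p} \<times> {x \<in> S. h x = h q}"
  have "compact Z" unfolding Z_def using cp by (intro compact_Times)
  moreover have "(p, q) \<in> Z" by (auto simp: Z_def S_def)
  moreover have "continuous_on Z (\<lambda>(x, y). \<bar>x - y\<bar>)"
    by (auto simp: case_prod_unfold intro!: continuous_intros)
  ultimately obtain m where m: "m \<in> Z" "\<And>m'. m' \<in> Z \<Longrightarrow> (\<lambda>(x, y). \<bar>x - y\<bar>) m \<le> (\<lambda>(x, y). \<bar>x - y\<bar>) m'"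
    using continuous_attains_inf[of Z "\<lambda>(x, y). \<bar>x - y\<bar>"] by blast
  obtain x y where xy: "m = (x, y)" by force
  have x: "x \<in> S" "h x = h p" and y: "y \<in> S" "h y = h q" using m(1) by (auto simp: xy Z_def)
  have min: "\<bar>x - y\<bar> \<le> \<bar>x' - y'\<bar>" if "x' \<in> S" "y' \<in> S" "h x' = h p" "h y' = h q" for x' y'
    using m(2)[of "(x', y')"] that by (auto simp: xy Z_def)
  have sub: "closed_segment u v \<subseteq> S" if "u \<in> S" "v \<in> S" for u v
    using that by (simp add: S_def subset_closed_segment)
  have ivt: "closed_segment (h u) (h v) \<subseteq> h ` closed_segment u v" if "u \<in> S" "v \<in> S" for u v
    by (rule closed_segment_subset_image) (use sub[OF that] hS in
      \<open>auto intro: continuous_on_subset simp: is_interval_closed_segment\<close>)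
  have "h t \<in> closed_segment (h p) (h q)" if t: "t \<in> closed_segment x y" for t
  proof (rule ccontr)
    assume n: "h t \<notin> closed_segment (h p) (h q)"
    have tS: "t \<in> S" using sub x y t by blast
    have txy: "t \<noteq> x" "t \<noteq> y" using n x y by auto
    \<comment> \<open>A value outside the target makes one of the two end values occur again between
      \<open>t\<close> and the opposite endpoint, which gives a closer pair.\<close>
    from n have "h p \<in> closed_segment (h t) (h q) \<or> h q \<in> closed_segment (h p) (h t)"
      by (auto simp: closed_segment_eq_real_ivl split: if_splits)
    then show False
    proof
      assume "h p \<in> closed_segment (h t) (h q)"
      then obtain x' where x': "x' \<in> closed_segment t y" "h x' = h p"
        using ivt[OF tS y(1)] y by auto
      have "\<bar>x - y\<bar> \<le> \<bar>x' - y\<bar>" using min[of x' y] x' sub[OF tS y(1)] y by auto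
      then show False using x'(1) t txy
        by (auto simp: closed_segment_eq_real_ivl split: if_splits)
    next
      assume "h q \<in> closed_segment (h p) (h t)"
      then obtain y' where y': "y' \<in> closed_segment x t" "h y' = h q"
        using ivt[OF x(1) tS] x by auto
      have "\<bar>x - y\<bar> \<le> \<bar>x - y'\<bar>" using min[of x y'] y' sub[OF x(1) tS] x by auto
      then show False using y'(1) t txy
        by (auto simp: closed_segment_eq_real_ivl split: if_splits)
    qed
  qed
  then show ?thesis using that[of x y] x y by (auto simp: S_def)
qed

text \<open>\<open>g x - x\<close> is at most 0 where \<open>g\<close> takes the value
  \<open>c\<close> and at least 0 where it takes the value \<open>d\<close>.\<close>

lemma fixed_point_of_expanding_segment:
  fixes g :: "real \<Rightarrow> real"
  assumes g: "continuous_on {l..r} g" and "{l..r} \<subseteq> {c..d}" "c \<in> g ` {l..r}" "d \<in> g ` {l..r}"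
  obtains x where "x \<in> {l..r}" "g x = x"
proof -
  obtain u v where uv: "u \<in> {l..r}" "v \<in> {l..r}" "g u = c" "g v = d" using assms by blast
  have "closed_segment (g u - u) (g v - v) \<subseteq> (\<lambda>x. g x - x) ` {l..r}"
    by (rule closed_segment_subset_image) (use g uv in \<open>auto intro!: continuous_intros simp: is_interval_cc\<close>)
  moreover have "0 \<in> closed_segment (g u - u) (g v - v)"
    using uv assms by (auto simp: closed_segment_eq_real_ivl)
  ultimately have "0 \<in> (\<lambda>x. g x - x) ` {l..r}" by blast
  then obtain x where "x \<in> {l..r}" "0 = g x - x" by (rule imageE)
  then show ?thesis using that by simp
qed

text \<open>The values \<open>c\<close> and \<open>d\<close> will be the ends of a piece, whose
  orbits are uncontrolled. At the price of the two outermost branches they are replaced by fixed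
  points of \<open>g\<close>; points that \<open>g\<close> sends to these have finite
  orbits.\<close>

lemma horseshoe_fixed_endpoints:
  fixes g :: "real \<Rightarrow> real" and l r :: "'w \<Rightarrow> real"
  assumes W: "finite W" "card W \<ge> 2"
    and lr: "\<And>w. w \<in> W \<Longrightarrow> l w \<le> r w"
    and disj: "\<And>w w'. w \<in> W \<Longrightarrow> w' \<in> W \<Longrightarrow> w \<noteq> w' \<Longrightarrow> {l w..r w} \<inter> {l w'..r w'} = {}"
    and g: "\<And>w. w \<in> W \<Longrightarrow> continuous_on {l w..r w} g"
    and sub: "\<And>w. w \<in> W \<Longrightarrow> {l w..r w} \<subseteq> {c..d}"
    and onto: "\<And>w. w \<in> W \<Longrightarrow> c \<in> g ` {l w..r w} \<and> d \<in> g ` {l w..r w}"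
  obtains y z w1 w2 where "w1 \<in> W" "w2 \<in> W" "y \<in> {l w1..r w1}" "z \<in> {l w2..r w2}" "y < z" "g y = y" "g z = z"
    "\<And>w. w \<in> W - {w1, w2} \<Longrightarrow> {l w..r w} \<subseteq> {y..z} \<and> y \<in> g ` {l w..r w} \<and> z \<in> g ` {l w..r w}"
proof -
  have ne: "W \<noteq> {}" using W by auto
  obtain w1 where w1: "w1 \<in> W" "\<And>w. w \<in> W \<Longrightarrow> l w1 \<le> l w"
    using arg_min_if_finite[OF W(1) ne, of l] by (meson not_le)
  obtain w2 where w2: "w2 \<in> W" "\<And>w. w \<in> W \<Longrightarrow> l w \<le> l w2"
    using arg_min_if_finite[OF W(1) ne, of "\<lambda>w. - l w"] by (metis not_le neg_less_iff_less)
  have sep: "r w < l w'" if "w \<in> W" "w' \<in> W" "w \<noteq> w'" "l w \<le> l w'" for w w'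
  proof (rule ccontr)
    assume "\<not> r w < l w'"
    then have "l w' \<in> {l w..r w} \<inter> {l w'..r w'}" using that lr by auto
    then show False using disj that by blast
  qed
  have ne12: "w1 \<noteq> w2"
  proof
    assume eq: "w1 = w2"
    have "w = w1" if "w \<in> W" for w
    proof (rule ccontr)
      assume "w \<noteq> w1"
      then have "r w1 < l w" using sep[of w1 w] w1 that by auto
      then show False using lr[OF w1(1)] w2(2)[OF that] eq by simp
    qed
    then have "W \<subseteq> {w1}" by auto
    then have "card W \<le> 1" using card_mono[of "{w1}" W] by simp
    then show False using W by simp
  qed
  obtain y where y: "y \<in> {l w1..r w1}" "g y = y"
    by (rule fixed_point_of_expanding_segment[OF g[OF w1(1)] sub[OF w1(1)]]) (use onto[OF w1(1)] in auto)
  obtain z where z: "z \<in> {l w2..r w2}" "g z = z"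
    by (rule fixed_point_of_expanding_segment[OF g[OF w2(1)] sub[OF w2(1)]]) (use onto[OF w2(1)] in auto)
  have "r w1 < l w2" using sep w1 w2 ne12 by blast
  then have yz: "y < z" using y z by auto
  have "{l w..r w} \<subseteq> {y..z} \<and> y \<in> g ` {l w..r w} \<and> z \<in> g ` {l w..r w}" if w: "w \<in> W - {w1, w2}" for w
  proof -
    have "r w1 < l w" "r w < l w2" using sep[of w1 w] sep[of w w2] w1 w2 w by auto
    then have 1: "{l w..r w} \<subseteq> {y..z}" using y z by auto
    obtain u v where uv: "u \<in> {l w..r w}" "v \<in> {l w..r w}" "g u = c" "g v = d" using onto w by blast
    have "closed_segment c d \<subseteq> g ` {l w..r w}"
      using closed_segment_subset_image[OF g _ uv(1,2)] w uv by (auto simp: is_interval_cc)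
    moreover have "y \<in> {c..d}" "z \<in> {c..d}" using y z sub w1 w2 by blast+
    then have "y \<in> closed_segment c d" "z \<in> closed_segment c d"
      by (auto simp: closed_segment_eq_real_ivl)
    ultimately show ?thesis using 1 by blast
  qed
  then show ?thesis using that[OF w1(1) w2(1) y(1) z(1) yz y(2) z(2)] by blast
qed

section \<open>Interval itineraries and their horseshoes\<close>

locale interval_pieces =
  fixes F :: "real \<Rightarrow> real" and pieces :: "real set set"
  assumes finite_pieces: "finite pieces"
    and interval_piece: "B \<in> pieces \<Longrightarrow> is_interval B"
    and bounded_piece: "B \<in> pieces \<Longrightarrow> bounded B"
    and disjoint_pieces: "A \<in> pieces \<Longrightarrow> B \<in> pieces \<Longrightarrow> x \<in> A \<Longrightarrow> x \<in> B \<Longrightarrow> A = B"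
    and continuous_piece: "B \<in> pieces \<Longrightarrow> continuous_on B F"
begin

text \<open>A state is the interval of points that are reached by a given itinerary. A piece is read in
  full when its closure lies in that interval, which fails for at most one piece at either end.\<close>

sublocale resetting_automaton pieces "{S. is_interval S}" "\<lambda>S A. A \<in> pieces \<and> S \<inter> A \<noteq> {}"
  "\<lambda>S A. A \<in> pieces \<and> A \<noteq> {} \<and> closure A \<subseteq> S" "\<lambda>S A. F ` (S \<inter> A)" "\<lambda>A. F ` A" 2
proof
  show "F ` (q \<inter> A) \<in> {S. is_interval S}"
    if "q \<in> {S. is_interval S}" "A \<in> pieces \<and> q \<inter> A \<noteq> {}" for q A
  proof -
    have "is_interval (q \<inter> A)" using that interval_piece[of A] by (auto intro: is_interval_Int)
    moreover have "continuous_on (q \<inter> A) F"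
      by (rule continuous_on_subset[OF continuous_piece[of A]]) (use that in auto)
    ultimately show ?thesis using is_interval_image by simp
  qed
  have sub: "A \<subseteq> S" if "closure A \<subseteq> S" for A S :: "real set"
    using that closure_subset by blast
  show "A \<in> pieces \<and> q \<inter> A \<noteq> {}" if "A \<in> pieces \<and> A \<noteq> {} \<and> closure A \<subseteq> q" for q A
    using that sub by blast
  show "F ` (q \<inter> A) = F ` A" if "A \<in> pieces \<and> A \<noteq> {} \<and> closure A \<subseteq> q" for q A
    using that sub[of A q] by (simp add: Int_absorb1)
  fix S :: "real set" assume "S \<in> {S. is_interval S}"
  then have S: "is_interval S" by simp
  let ?N = "{A. (A \<in> pieces \<and> S \<inter> A \<noteq> {}) \<and> \<not> (A \<in> pieces \<and> A \<noteq> {} \<and> closure A \<subseteq> S)}"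
  \<comment> \<open>A piece counted in \<open>?N\<close> meets \<open>S\<close> while its closure
    leaves \<open>S\<close>; since \<open>S\<close> is an interval, this happens beyond its left or
    beyond its right end.\<close>
  define below where "below A \<longleftrightarrow> (\<exists>e\<in>closure A. \<forall>s\<in>S. e < s)" for A
  define above where "above A \<longleftrightarrow> (\<exists>e\<in>closure A. \<forall>s\<in>S. s < e)" for A
  have ba: "below A \<or> above A" if "A \<in> ?N" for A
  proof -
    from that obtain e where e: "e \<in> closure A" "e \<notin> S" by auto
    have "(\<forall>s\<in>S. e < s) \<or> (\<forall>s\<in>S. s < e)"
      using S e(2) unfolding is_interval_1 by (meson linorder_not_le order.order_iff_strict)
    then show ?thesis using e by (auto simp: below_def above_def)
  qed
  have "A = A'" if A: "A \<in> ?N" "A' \<in> ?N" "below A" "below A'" for A A'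
  proof -
    \<comment> \<open>\<open>A'\<close> contains a point to the left of \<open>s\<close> and the
      point \<open>s'\<close>, which is not to the left of it, hence \<open>s\<close> itself, which
      belongs to \<open>A\<close>.\<close>
    have *: "A = A'" if A: "A \<in> ?N" "A' \<in> ?N" "below A'" "s \<in> S \<inter> A" "s' \<in> S \<inter> A'" "s \<le> s'" for A A' s s'
    proof -
      obtain e where e: "e \<in> closure A'" "e < s" using A by (auto simp: below_def)
      then obtain a where a: "a \<in> A'" "dist a e < s - e"
        unfolding closure_approachable by (meson diff_gt_0_iff_gt)
      then have "a < s" by (auto simp: dist_real_def)
      then have "s \<in> A'" using mem_is_interval_1_I[of A' a s' s] interval_piece[of A'] A a by auto
      then show ?thesis using disjoint_pieces A by blast
    qed
    obtain s s' where s: "s \<in> S \<inter> A" "s' \<in> S \<inter> A'" using A by blast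
    show ?thesis using *[OF A(1,2,4) s] *[OF A(2,1,3) s(2,1)] by (cases "s \<le> s'") auto
  qed
  then have one: "\<forall>A\<in>{A \<in> ?N. below A}. \<forall>A'\<in>{A \<in> ?N. below A}. A = A'" by blast
  have fin: "finite {A \<in> ?N. below A}" by (rule finite_subset[OF _ finite_pieces]) blast
  have 1: "card {A \<in> ?N. below A} \<le> 1"
    unfolding One_nat_def card_le_Suc0_iff_eq[OF fin] by (rule one)
  have "A = A'" if A: "A \<in> ?N" "A' \<in> ?N" "above A" "above A'" for A A'
  proof -
    have *: "A = A'" if A: "A \<in> ?N" "A' \<in> ?N" "above A'" "s \<in> S \<inter> A" "s' \<in> S \<inter> A'" "s' \<le> s" for A A' s s'
    proof -
      obtain e where e: "e \<in> closure A'" "s < e" using A by (auto simp: above_def)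
      then obtain a where a: "a \<in> A'" "dist a e < e - s"
        unfolding closure_approachable by (meson diff_gt_0_iff_gt)
      then have "s < a" by (auto simp: dist_real_def)
      then have "s \<in> A'" using mem_is_interval_1_I[of A' s' a s] interval_piece[of A'] A a by auto
      then show ?thesis using disjoint_pieces A by blast
    qed
    obtain s s' where s: "s \<in> S \<inter> A" "s' \<in> S \<inter> A'" using A by blast
    show ?thesis using *[OF A(1,2,4) s] *[OF A(2,1,3) s(2,1)] by (cases "s' \<le> s") auto
  qed
  then have one: "\<forall>A\<in>{A \<in> ?N. above A}. \<forall>A'\<in>{A \<in> ?N. above A}. A = A'" by blast
  have fin: "finite {A \<in> ?N. above A}" by (rule finite_subset[OF _ finite_pieces]) blast
  have 2: "card {A \<in> ?N. above A} \<le> 1"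
    unfolding One_nat_def card_le_Suc0_iff_eq[OF fin] by (rule one)
  have "?N = {A \<in> ?N. below A} \<union> {A \<in> ?N. above A}" using ba by blast
  then have "card ?N = card ({A \<in> ?N. below A} \<union> {A \<in> ?N. above A})" by (rule arg_cong)
  also have "\<dots> \<le> card {A \<in> ?N. below A} + card {A \<in> ?N. above A}" by (rule card_Un_le)
  also have "\<dots> \<le> 2" using 1 2 by linarith
  finally show "card ?N \<le> 2" .
qed (use finite_pieces in auto)

lemma accepts_itinerary:
  assumes "x \<in> S" "\<And>i. i < length w \<Longrightarrow> w ! i \<in> pieces \<and> (F ^^ i) x \<in> w ! i"
  shows "accepts S w"
  using assms
proof (induction w arbitrary: S x)
  case (Cons A w)
  have x: "x \<in> S \<inter> A" "A \<in> pieces" using Cons.prems(1) Cons.prems(2)[of 0] by auto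
  moreover have "accepts (F ` (S \<inter> A)) w"
  proof (rule Cons.IH)
    show "F x \<in> F ` (S \<inter> A)" using x by blast
    show "w ! i \<in> pieces \<and> (F ^^ i) (F x) \<in> w ! i" if "i < length w" for i
      using Cons.prems(2)[of "Suc i"] that by (simp add: funpow_swap1)
  qed
  ultimately show ?case by auto
qed simp

text \<open>The segment found for the remaining letters lies in the image of
  \<open>S \<inter> A\<close>. It is pulled back through \<open>F\<close> without overshooting, so
  that all points of the lifted segment keep the later itinerary.\<close>

lemma segment_lift:
  assumes "is_interval S" "accepts S w" "y \<in> run S w" "z \<in> run S w"
  shows "\<exists>p q. closed_segment p q \<subseteq> {x \<in> S. \<forall>i<length w. (F ^^ i) x \<in> w ! i}
    \<and> (F ^^ length w) p = y \<and> (F ^^ length w) q = z"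
  using assms
proof (induction w arbitrary: S)
  case Nil
  then show ?case using closed_segment_subset_interval[of S y z] by auto
next
  case (Cons A w)
  have "A \<in> pieces" using Cons.prems by simp
  then have "is_interval (S \<inter> A)" "continuous_on (S \<inter> A) F"
    using is_interval_Int[OF Cons.prems(1) interval_piece[of A]]
      continuous_on_subset[OF continuous_piece[of A] Int_lower2[of S A]]
    by blast+
  note A = \<open>A \<in> pieces\<close> this
  have "is_interval (F ` (S \<inter> A))" using A is_interval_image by blast
  with Cons.IH[of "F ` (S \<inter> A)"] Cons.prems obtain p' q' where pq':
    "closed_segment p' q' \<subseteq> {x \<in> F ` (S \<inter> A). \<forall>i<length w. (F ^^ i) x \<in> w ! i}"
    "(F ^^ length w) p' = y" "(F ^^ length w) q' = z" by auto
  have "p' \<in> F ` (S \<inter> A)" "q' \<in> F ` (S \<inter> A)" using pq'(1) by auto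
  then obtain p0 q0 where pq0: "p0 \<in> S \<inter> A" "q0 \<in> S \<inter> A" "F p0 = p'" "F q0 = q'" by blast
  have sub: "closed_segment p0 q0 \<subseteq> S \<inter> A"
    using closed_segment_subset_interval[OF A(2) pq0(1,2)] .
  obtain p q where pq: "p \<in> closed_segment p0 q0" "q \<in> closed_segment p0 q0" "F p = p'" "F q = q'"
    "F ` closed_segment p q \<subseteq> closed_segment p' q'"
    using segment_exact_image[of p0 q0 F] continuous_on_subset[OF A(3) sub] pq0 by metis
  have sub': "closed_segment p q \<subseteq> S \<inter> A" using pq(1,2) sub
    by (meson order_trans subset_closed_segment)
  have "closed_segment p q \<subseteq> {x \<in> S. \<forall>i<length (A # w). (F ^^ i) x \<in> (A # w) ! i}"
  proof (intro subsetI CollectI conjI allI impI)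
    fix x i assume x: "x \<in> closed_segment p q"
    then show "x \<in> S" using sub' by blast
    assume i: "i < length (A # w)"
    show "(F ^^ i) x \<in> (A # w) ! i"
    proof (cases i)
      case 0
      then show ?thesis using sub' x by auto
    next
      case (Suc j)
      have "F x \<in> closed_segment p' q'" using pq(5) x by blast
      then have "(F ^^ j) (F x) \<in> w ! j" using pq'(1) i Suc by auto
      then show ?thesis by (simp add: Suc funpow_swap1)
    qed
  qed
  moreover have "(F ^^ length (A # w)) p = y" "(F ^^ length (A # w)) q = z"
    using pq pq' by (simp_all add: funpow_swap1)
  ultimately show ?case by blast
qed

lemma continuous_on_itinerary:
  assumes "\<And>x i. x \<in> S \<Longrightarrow> i < n \<Longrightarrow> (F ^^ i) x \<in> w i" "\<And>i. i < n \<Longrightarrow> w i \<in> pieces"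
  shows "continuous_on S (F ^^ n)"
  using assms
proof (induction n)
  case (Suc n)
  have "continuous_on S (F \<circ> (F ^^ n))"
  proof (rule continuous_on_compose)
    show "continuous_on S (F ^^ n)" using Suc by simp
    have "(F ^^ n) ` S \<subseteq> w n" using Suc.prems by auto
    then show "continuous_on ((F ^^ n) ` S) F"
      using continuous_piece Suc.prems(2) continuous_on_subset by blast
  qed
  then show ?case by simp
qed (simp add: id_def)

text \<open>A loop of length \<open>n\<close> at \<open>B\<close> lifts to a segment inside
  \<open>B\<close> whose ends \<open>F ^^ n\<close> maps to the ends of \<open>B\<close>, and
  different words have disjoint segments. Only finitely many points of this horseshoe are kept,
  since the Markov graph is built from their orbits.\<close>

lemma loops_horseshoe:
  assumes W: "finite W" "W \<subseteq> {w \<in> loops B. length w = n}" "card W \<ge> 2" and n: "n > 0"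
  shows "\<exists>W' y z p q. W' \<subseteq> W \<and> card W \<le> card W' + 2 \<and> y < z \<and> (F ^^ n) y = y \<and> (F ^^ n) z = z \<and>
    y \<in> B \<and> z \<in> B \<and>
    (\<forall>w\<in>W'. p w \<in> {y..z} \<and> q w \<in> {y..z} \<and> (F ^^ n) (p w) = y \<and> (F ^^ n) (q w) = z \<and>
      (\<forall>i<n. w ! i \<in> pieces \<and> (F ^^ i) (p w) \<in> w ! i \<and> (F ^^ i) (q w) \<in> w ! i))"
proof -
  \<comment> \<open>These ends may lie outside \<open>B\<close>; they are reached because a full
    reading asks for the closure of the piece.\<close>
  define c where "c = Inf B"
  define d where "d = Sup B"
  obtain w0 where "w0 \<in> W" using W by fastforce
  then have B: "B \<in> pieces" "B \<noteq> {}" using W by (auto simp: loops_def)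
  have bdd: "bdd_below B" "bdd_above B"
    using bounded_piece[OF B(1)] by (simp_all add: bounded_imp_bdd_below bounded_imp_bdd_above)
  have cd: "c \<in> closure B" "d \<in> closure B"
    unfolding c_def d_def using B bdd by (auto intro: closure_contains_Inf closure_contains_Sup)
  have Bcd: "B \<subseteq> {c..d}" using bdd by (auto simp: c_def d_def cInf_lower cSup_upper)
  have letters: "w ! i \<in> pieces" if "w \<in> W" "i < n" for w i
  proof -
    have "accepts B w" using W that B by (auto simp: loops_def)
    then have "set w \<subseteq> pieces" by (rule accepts_letters)
    moreover have "i < length w" using that W by auto
    ultimately show ?thesis using nth_mem by blast
  qed
  define lift where "lift w p q \<longleftrightarrow> closed_segment p q \<subseteq> {x \<in> B. \<forall>i<n. (F ^^ i) x \<in> w ! i}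
    \<and> (F ^^ n) p = c \<and> (F ^^ n) q = d" for w p q
  have "\<exists>p q. lift w p q" if w: "w \<in> W" for w
  proof -
    obtain u where u: "w = B # u" "accepts (F ` B) u" "closure B \<subseteq> run (F ` B) u" "length w = n"
      using W w by (auto simp: loops_def)
    then have "accepts B w" "closure B \<subseteq> run B w" "length w = n"
      using B by simp_all
    with segment_lift[OF interval_piece[OF B(1)], of w c d] cd show ?thesis
      unfolding lift_def by blast
  qed
  then obtain p0 q0 where "\<And>w. w \<in> W \<Longrightarrow> lift w (p0 w) (q0 w)" by metis
  then have pq0: "closed_segment (p0 w) (q0 w) \<subseteq> {x \<in> B. \<forall>i<n. (F ^^ i) x \<in> w ! i}
    \<and> (F ^^ n) (p0 w) = c \<and> (F ^^ n) (q0 w) = d" if "w \<in> W" for w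
    using that unfolding lift_def by blast
  define l where "l w = min (p0 w) (q0 w)" for w
  define r where "r w = max (p0 w) (q0 w)" for w
  have seg: "{l w..r w} = closed_segment (p0 w) (q0 w)" for w
    by (simp add: l_def r_def closed_segment_eq_real_ivl min_def max_def)
  have itin: "x \<in> B \<and> (F ^^ i) x \<in> w ! i" if "w \<in> W" "x \<in> {l w..r w}" "i < n" for w x i
    using that pq0[of w] unfolding seg by blast
  have "\<exists>y z w1 w2. w1 \<in> W \<and> w2 \<in> W \<and> y \<in> {l w1..r w1} \<and> z \<in> {l w2..r w2} \<and> y < z \<and>
    (F ^^ n) y = y \<and> (F ^^ n) z = z \<and>
    (\<forall>w\<in>W - {w1, w2}. {l w..r w} \<subseteq> {y..z} \<and> y \<in> (F ^^ n) ` {l w..r w} \<and> z \<in> (F ^^ n) ` {l w..r w})"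
  proof (rule horseshoe_fixed_endpoints[OF W(1,3), of l r "F ^^ n" c d])
    show "l w \<le> r w" for w by (auto simp: l_def r_def)
    show "{l w..r w} \<inter> {l w'..r w'} = {}" if ww: "w \<in> W" "w' \<in> W" "w \<noteq> w'" for w w'
    proof (rule ccontr)
      assume "{l w..r w} \<inter> {l w'..r w'} \<noteq> {}"
      then obtain x where x: "x \<in> {l w..r w}" "x \<in> {l w'..r w'}" by blast
      have "w = w'"
      proof (rule nth_equalityI)
        show "length w = length w'" using ww W by auto
        fix i assume "i < length w"
        then have "i < n" using ww W by auto
        then show "w ! i = w' ! i"
          using disjoint_pieces letters itin ww x by blast
      qed
      then show False using ww by blast
    qed
    show "continuous_on {l w..r w} (F ^^ n)" if "w \<in> W" for w
      by (rule continuous_on_itinerary[of _ n "(!) w"]) (use itin letters that in blast)+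
    show "{l w..r w} \<subseteq> {c..d}" if "w \<in> W" for w
      using itin[OF that] Bcd n by blast
    show "c \<in> (F ^^ n) ` {l w..r w} \<and> d \<in> (F ^^ n) ` {l w..r w}" if "w \<in> W" for w
    proof
      have "p0 w \<in> {l w..r w}" "q0 w \<in> {l w..r w}" unfolding seg by simp_all
      then show "c \<in> (F ^^ n) ` {l w..r w}" "d \<in> (F ^^ n) ` {l w..r w}"
        using pq0[OF that] by (auto intro: rev_image_eqI simp del: atLeastAtMost_iff)
    qed
  qed blast
  then obtain y z w1 w2 where yz: "w1 \<in> W" "w2 \<in> W" "y \<in> {l w1..r w1}" "z \<in> {l w2..r w2}" "y < z"
    "(F ^^ n) y = y" "(F ^^ n) z = z"
    and rest: "\<And>w. w \<in> W - {w1, w2} \<Longrightarrow>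
      {l w..r w} \<subseteq> {y..z} \<and> y \<in> (F ^^ n) ` {l w..r w} \<and> z \<in> (F ^^ n) ` {l w..r w}" by blast
  define ends where "ends w p q \<longleftrightarrow> p \<in> {l w..r w} \<and> q \<in> {l w..r w} \<and> (F ^^ n) p = y \<and> (F ^^ n) q = z"
    for w p q
  have "\<exists>p q. ends w p q" if "w \<in> W - {w1, w2}" for w
  proof -
    obtain u v where "u \<in> {l w..r w}" "(F ^^ n) u = y" "v \<in> {l w..r w}" "(F ^^ n) v = z"
      using rest[OF \<open>w \<in> W - {w1, w2}\<close>] by blast
    then show ?thesis unfolding ends_def by blast
  qed
  then obtain p q where "\<And>w. w \<in> W - {w1, w2} \<Longrightarrow> ends w (p w) (q w)" by metis
  then have pq: "p w \<in> {l w..r w} \<and> q w \<in> {l w..r w} \<and> (F ^^ n) (p w) = y \<and> (F ^^ n) (q w) = z"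
    if "w \<in> W - {w1, w2}" for w using that unfolding ends_def by blast
  show ?thesis
  proof (intro exI conjI ballI)
    show "W - {w1, w2} \<subseteq> W" by blast
    show "card W \<le> card (W - {w1, w2}) + 2"
    proof -
      have "card W - card {w1, w2} \<le> card (W - {w1, w2})" by (rule diff_card_le_card_Diff) simp
      moreover have "card {w1, w2} \<le> 2" by (simp add: card_insert_if)
      ultimately show ?thesis by linarith
    qed
    show "y \<in> B" "z \<in> B" using itin yz n by blast+
    fix w assume w: "w \<in> W - {w1, w2}"
    show "p w \<in> {y..z}" "q w \<in> {y..z}" "(F ^^ n) (p w) = y" "(F ^^ n) (q w) = z"
      using pq[OF w] rest[OF w] by blast+
    show "\<forall>i<n. w ! i \<in> pieces \<and> (F ^^ i) (p w) \<in> w ! i \<and> (F ^^ i) (q w) \<in> w ! i"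
      using pq[OF w] itin letters w by blast
  qed (use yz in auto)
qed

end

section \<open>Markov graphs of finite invariant sets\<close>

text \<open>A rate strictly between \<beta> and \<alpha> beats every constant multiple of
  \<open>exp (\<beta> * n)\<close> plus a constant. \<open>C\<close> and \<open>D\<close> are chosen
  so as to pay in advance for words that get lost later.\<close>

lemma many_words_exp:
  fixes \<alpha> \<beta> :: real
  assumes "\<not> light (exp (- \<alpha>)) L" "\<And>n. finite {w \<in> L. length w = n}" "\<beta> < \<alpha>" "0 \<le> \<beta>"
  obtains n where "n \<ge> n0" "card {w \<in> L. length w = n} \<ge> C * exp (\<beta> * n) + D" "card {w \<in> L. length w = n} \<ge> 2"
    "n > 0"
proof -
  define \<gamma> where "\<gamma> = (\<alpha> + \<beta>) / 2"
  have g: "\<beta> < \<gamma>" "\<gamma> < \<alpha>" using assms by (auto simp: \<gamma>_def)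
  have "\<forall>\<^sub>F n :: nat in sequentially. exp (\<gamma> * n) \<ge> (\<bar>C\<bar> + \<bar>D\<bar> + 2) * exp (\<beta> * n)"
  proof -
    have "filterlim (\<lambda>n. (\<gamma> - \<beta>) * real n) at_top sequentially"
      using g by (intro filterlim_tendsto_pos_mult_at_top[OF tendsto_const] filterlim_real_sequentially) auto
    then have "filterlim (\<lambda>n. exp ((\<gamma> - \<beta>) * real n)) at_top sequentially"
      by (rule filterlim_compose[OF exp_at_top])
    then have "\<forall>\<^sub>F n :: nat in sequentially. exp ((\<gamma> - \<beta>) * real n) \<ge> \<bar>C\<bar> + \<bar>D\<bar> + 2"
      by (simp add: filterlim_at_top)
    then show ?thesis
    proof eventually_elim
      case (elim n)
      have "exp (\<gamma> * n) = exp ((\<gamma> - \<beta>) * n) * exp (\<beta> * n)" by (simp add: exp_add[symmetric] algebra_simps)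
      then show ?case using elim by (simp add: mult_right_mono)
    qed
  qed
  then obtain n1 :: nat where n1: "\<And>n :: nat. n \<ge> n1 \<Longrightarrow> exp (\<gamma> * n) \<ge> (\<bar>C\<bar> + \<bar>D\<bar> + 2) * exp (\<beta> * n)"
    unfolding eventually_sequentially by blast
  have "exp \<gamma> * exp (- \<alpha>) < 1" using g by (simp add: exp_add[symmetric])
  then obtain n where n: "n \<ge> max 1 (max n0 n1)" "card {w \<in> L. length w = n} > exp \<gamma> ^ n"
    using many_words_if_not_light[of "exp (- \<alpha>)" "exp \<gamma>" L "max 1 (max n0 n1)"] assms by auto
  have "exp (\<beta> * n) \<ge> 1" using assms by simp
  then have "(\<bar>C\<bar> + \<bar>D\<bar> + 2) * exp (\<beta> * n) \<ge> \<bar>C\<bar> * exp (\<beta> * n) + \<bar>D\<bar> + 2"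
    using mult_left_mono[of 1 "exp (\<beta> * n)" "\<bar>D\<bar> + 2"] by (simp add: algebra_simps)
  moreover have "\<bar>C\<bar> * exp (\<beta> * n) \<ge> C * exp (\<beta> * n)" "\<bar>C\<bar> * exp (\<beta> * n) \<ge> 0" by (simp_all add: mult_right_mono)
  moreover have "exp (\<gamma> * n) = exp \<gamma> ^ n" by (simp add: exp_of_nat_mult[symmetric] mult.commute)
  moreover have "exp (\<gamma> * n) \<ge> (\<bar>C\<bar> + \<bar>D\<bar> + 2) * exp (\<beta> * n)" using n1[of n] n(1) by simp
  ultimately have "real (card {w \<in> L. length w = n}) \<ge> C * exp (\<beta> * n) + \<bar>D\<bar>"
    "real (card {w \<in> L. length w = n}) \<ge> 2"
    using n(2) by linarith+
  then show ?thesis using that[of n] n by auto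
qed

text \<open>A gap on whose closure \<open>f\<close> fails to be continuous is no vertex; the walks
  constructed below stay within segments on which \<open>f\<close> is continuous.\<close>

definition vertices :: "(real \<Rightarrow> real) \<Rightarrow> real set \<Rightarrow> (real \<times> real) set" where
  "vertices f P = {(c, d). c \<in> P \<and> d \<in> P \<and> c < d \<and> {c<..<d} \<inter> P = {} \<and> continuous_on {c..d} f}"

text \<open>Only the segment between the images of the two endpoints counts, which may be smaller
  than the image of the gap. Edges thus depend only on \<open>f\<close> on \<open>P\<close>, and an
  endpoint is always carried to an end of the covered range.\<close>

definition covers :: "(real \<Rightarrow> real) \<Rightarrow> real \<times> real \<Rightarrow> real \<times> real \<Rightarrow> bool" where
  "covers f A B \<longleftrightarrow> closed_segment (fst B) (snd B) \<subseteq> closed_segment (f (fst A)) (f (snd A))"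

definition may_follow :: "(real \<Rightarrow> real) \<Rightarrow> real set \<Rightarrow> (real \<times> real) option \<Rightarrow> real \<times> real \<Rightarrow> bool" where
  "may_follow f P q A \<longleftrightarrow> A \<in> vertices f P \<and> (case q of None \<Rightarrow> True | Some B \<Rightarrow> covers f B A)"

lemma may_follow_simps [simp]:
  "may_follow f P None A \<longleftrightarrow> A \<in> vertices f P"
  "may_follow f P (Some B) A \<longleftrightarrow> A \<in> vertices f P \<and> covers f B A"
  by (simp_all add: may_follow_def)

text \<open>An intermediate value theorem along a finite set: \<open>c\<close> is the last point
  between \<open>u\<close> and \<open>v\<close> with \<open>R\<close>, and \<open>d\<close> is its
  successor in \<open>P\<close>.\<close>

lemma discrete_sign_change:
  fixes P :: "real set"
  assumes "finite P" "u \<in> P" "v \<in> P" "u < v" "R u" "\<not> R v"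
  obtains c d where "c \<in> P" "d \<in> P" "c < d" "{c<..<d} \<inter> P = {}" "u \<le> c" "d \<le> v" "R c" "\<not> R d"
proof -
  define c where "c = Max {p \<in> P. u \<le> p \<and> p \<le> v \<and> R p}"
  have fin: "finite {p \<in> P. u \<le> p \<and> p \<le> v \<and> R p}" and ne: "{p \<in> P. u \<le> p \<and> p \<le> v \<and> R p} \<noteq> {}"
  proof -
    have "u \<in> {p \<in> P. u \<le> p \<and> p \<le> v \<and> R p}" using assms by auto
    then show "{p \<in> P. u \<le> p \<and> p \<le> v \<and> R p} \<noteq> {}" by blast
  qed (use assms in auto)
  have c: "c \<in> P" "u \<le> c" "c \<le> v" "R c" using Max_in[OF fin ne] by (auto simp: c_def)
  have cmax: "p \<le> c" if "p \<in> P" "u \<le> p" "p \<le> v" "R p" for p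
    unfolding c_def using that fin by (auto intro: Max_ge)
  have cv: "c < v" using c assms by (metis less_eq_real_def)
  define d where "d = Min {p \<in> P. c < p}"
  have fin': "finite {p \<in> P. c < p}" "{p \<in> P. c < p} \<noteq> {}" using assms cv by auto
  have d: "d \<in> P" "c < d" using Min_in[OF fin'] by (auto simp: d_def)
  have dmin: "d \<le> p" if "p \<in> P" "c < p" for p unfolding d_def using that fin' by (auto intro: Min_le)
  have "d \<le> v" using dmin assms cv by blast
  moreover have "\<not> R d" using cmax[of d] d c \<open>d \<le> v\<close> by force
  moreover have "{c<..<d} \<inter> P = {}" using dmin by fastforce
  ultimately show ?thesis using that c d by blast
qed

text \<open>The return to \<open>b\<close> is not listed, so that the length is the number of edges
  and concatenation gives closed walks again.\<close>

definition closed_walks :: "(real \<Rightarrow> real) \<Rightarrow> real set \<Rightarrow> real \<times> real \<Rightarrow> (real \<times> real) list set" where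
  "closed_walks f P b = {w. w \<noteq> [] \<and> hd w = b \<and> set w \<subseteq> vertices f P \<and>
     (\<forall>i. Suc i < length w \<longrightarrow> covers f (w ! i) (w ! Suc i)) \<and> covers f (last w) b}"

locale finite_invariant =
  fixes f :: "real \<Rightarrow> real" and P :: "real set"
  assumes finite_P: "finite P" and invariant_P: "f ` P \<subseteq> P"
begin

text \<open>The state is the vertex read last. There are no partial letters, so
  \<open>r = 0\<close>, and for every \<open>t \<ge> 0\<close> lightness of the loops implies
  lightness of all walks.\<close>

sublocale resetting_automaton "vertices f P" UNIV "may_follow f P" "may_follow f P"
  "\<lambda>q A. Some A" Some 0
proof
  show "finite (vertices f P)"
    by (rule finite_subset[of _ "P \<times> P"]) (use finite_P in \<open>auto simp: vertices_def\<close>)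
next
  show "card {A. may_follow f P q A \<and> \<not> may_follow f P q A} \<le> 0" for q by simp
qed (auto simp: may_follow_def)

text \<open>No point of \<open>P\<close> is mapped into the gap between \<open>c'\<close> and
  \<open>d'\<close>, so along \<open>P\<close> the values of \<open>f\<close> must jump over it
  between two neighbours.\<close>

lemma gap_covered:
  assumes uv: "u \<in> P" "v \<in> P" "continuous_on (closed_segment u v) f"
    and b: "c' \<in> P" "d' \<in> P" "c' < d'" "{c'<..<d'} \<inter> P = {}" "closed_segment c' d' \<subseteq> closed_segment (f u) (f v)"
  obtains A where "A \<in> vertices f P" "closed_segment (fst A) (snd A) \<subseteq> closed_segment u v" "covers f A (c', d')"
proof -
  have outside: "f p \<le> c' \<or> d' \<le> f p" if "p \<in> P" for p
    using b invariant_P that by (metis disjoint_iff greaterThanLessThan_iff image_subset_iff not_le)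
  define lo where "lo = min u v"
  define hi where "hi = max u v"
  have seg: "closed_segment u v = {lo..hi}"
    by (simp add: lo_def hi_def closed_segment_eq_real_ivl min_def max_def)
  have lh: "lo \<in> P" "hi \<in> P" using uv by (auto simp: lo_def hi_def min_def max_def)
  have fuv: "min (f lo) (f hi) \<le> c'" "d' \<le> max (f lo) (f hi)"
    using b(3,5) by (auto simp: lo_def hi_def closed_segment_eq_real_ivl min_def max_def split: if_splits)
  then have "lo \<noteq> hi" using b by auto
  then have "lo < hi" by (auto simp: lo_def hi_def)
  have "\<exists>c d. c \<in> P \<and> d \<in> P \<and> c < d \<and> {c<..<d} \<inter> P = {} \<and> lo \<le> c \<and> d \<le> hi \<and>
      (f c \<le> c' \<and> d' \<le> f d \<or> d' \<le> f c \<and> f d \<le> c')"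
  proof (cases "f lo \<le> c'")
    case True
    then have "\<not> f hi \<le> c'" using fuv b by auto
    then obtain c d where "c \<in> P" "d \<in> P" "c < d" "{c<..<d} \<inter> P = {}" "lo \<le> c" "d \<le> hi"
      "f c \<le> c'" "\<not> f d \<le> c'"
      by (rule discrete_sign_change[OF finite_P lh \<open>lo < hi\<close>, of "\<lambda>p. f p \<le> c'", OF True])
    then show ?thesis using outside[of d] by (intro exI[of _ c] exI[of _ d]) simp
  next
    case False
    then have "f hi \<le> c'" using fuv by (auto simp: min_def split: if_splits)
    then have "\<not> \<not> f hi \<le> c'" by simp
    then obtain c d where "c \<in> P" "d \<in> P" "c < d" "{c<..<d} \<inter> P = {}" "lo \<le> c" "d \<le> hi"
      "\<not> f c \<le> c'" "\<not> \<not> f d \<le> c'"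
      by (rule discrete_sign_change[OF finite_P lh \<open>lo < hi\<close>, of "\<lambda>p. \<not> f p \<le> c'", OF False])
    then show ?thesis using outside[of c] by (intro exI[of _ c] exI[of _ d]) simp
  qed
  then obtain c d where cd: "c \<in> P" "d \<in> P" "c < d" "{c<..<d} \<inter> P = {}" "lo \<le> c" "d \<le> hi"
      "f c \<le> c' \<and> d' \<le> f d \<or> d' \<le> f c \<and> f d \<le> c'" by blast
  have "{c..d} \<subseteq> closed_segment u v" using cd by (auto simp: seg)
  then have "continuous_on {c..d} f" using uv continuous_on_subset by blast
  then have "(c, d) \<in> vertices f P" using cd by (auto simp: vertices_def)
  moreover have "closed_segment c d \<subseteq> closed_segment u v"
    using \<open>{c..d} \<subseteq> closed_segment u v\<close> cd(3) by (simp add: closed_segment_eq_real_ivl)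
  moreover have "covers f (c, d) (c', d')"
    using cd(7) b(3) by (auto simp: covers_def closed_segment_eq_real_ivl)
  ultimately show ?thesis using that[of "(c, d)"] by simp
qed

text \<open>The walk is found backwards: the gap to be reached determines which gap must be crossed
  one step earlier. The target may be a gap on which \<open>f\<close> is discontinuous.\<close>

lemma walk_into_gap:
  assumes "\<And>j. j \<le> N \<Longrightarrow> (f ^^ j) u \<in> P \<and> (f ^^ j) v \<in> P"
    and "\<And>j. j < N \<Longrightarrow> continuous_on (closed_segment ((f ^^ j) u) ((f ^^ j) v)) f"
    and b: "c' \<in> P" "d' \<in> P" "c' < d'" "{c'<..<d'} \<inter> P = {}"
      "closed_segment c' d' \<subseteq> closed_segment ((f ^^ N) u) ((f ^^ N) v)"
  shows "\<exists>w. length w = N \<and> accepts None w \<and> (w \<noteq> [] \<longrightarrow> covers f (last w) (c', d')) \<and>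
    (\<forall>j<N. closed_segment (fst (w ! j)) (snd (w ! j)) \<subseteq> closed_segment ((f ^^ j) u) ((f ^^ j) v))"
  using assms(1,2,7)
proof (induction N arbitrary: u v)
  case 0
  then show ?case by simp
next
  case (Suc N)
  have "\<exists>w. length w = N \<and> accepts None w \<and> (w \<noteq> [] \<longrightarrow> covers f (last w) (c', d')) \<and>
    (\<forall>j<N. closed_segment (fst (w ! j)) (snd (w ! j)) \<subseteq> closed_segment ((f ^^ j) (f u)) ((f ^^ j) (f v)))"
  proof (rule Suc.IH)
    show "(f ^^ j) (f u) \<in> P \<and> (f ^^ j) (f v) \<in> P" if "j \<le> N" for j
      using Suc.prems(1)[of "Suc j"] that by (simp add: funpow_swap1)
    show "continuous_on (closed_segment ((f ^^ j) (f u)) ((f ^^ j) (f v))) f" if "j < N" for j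
      using Suc.prems(2)[of "Suc j"] that by (simp add: funpow_swap1)
    show "closed_segment c' d' \<subseteq> closed_segment ((f ^^ N) (f u)) ((f ^^ N) (f v))"
      using Suc.prems(3) by (simp add: funpow_swap1)
  qed
  then obtain w where w: "length w = N" "accepts None w" "w \<noteq> [] \<longrightarrow> covers f (last w) (c', d')"
    "\<And>j. j < N \<Longrightarrow> closed_segment (fst (w ! j)) (snd (w ! j)) \<subseteq> closed_segment ((f ^^ j) (f u)) ((f ^^ j) (f v))"
    by blast
  obtain B where B: "B = (if w = [] then (c', d') else hd w)" by simp
  have B': "fst B \<in> P \<and> snd B \<in> P \<and> fst B < snd B \<and> {fst B<..<snd B} \<inter> P = {} \<and>
    closed_segment (fst B) (snd B) \<subseteq> closed_segment (f u) (f v)"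
  proof (cases w)
    case Nil
    then show ?thesis using b(1-4) Suc.prems(3) w(1) B by simp
  next
    case (Cons A w')
    then have "B \<in> vertices f P" using w(2) B by auto
    moreover have "closed_segment (fst B) (snd B) \<subseteq> closed_segment (f u) (f v)"
      using w(4)[of 0] w(1) Cons B by auto
    ultimately show ?thesis by (auto simp: vertices_def)
  qed
  have uv: "u \<in> P" "v \<in> P" "continuous_on (closed_segment u v) f"
    using Suc.prems(1)[of 0] Suc.prems(2)[of 0] by auto
  from gap_covered[OF uv, of "fst B" "snd B"] B' obtain A where A: "A \<in> vertices f P"
    "closed_segment (fst A) (snd A) \<subseteq> closed_segment u v" "covers f A B" by auto
  have "accepts None (A # w)" using A w(2) B by (cases w) auto
  moreover have "covers f (last (A # w)) (c', d')" using A(3) w(3) B by auto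
  moreover have "closed_segment (fst ((A # w) ! j)) (snd ((A # w) ! j)) \<subseteq> closed_segment ((f ^^ j) u) ((f ^^ j) v)"
    if "j < Suc N" for j
    using A(2) w(4)[of "j - 1"] that by (cases j) (auto simp: funpow_swap1)
  ultimately show ?case using w(1) by (intro exI[of _ "A # w"]) auto
qed

lemma accepts_append_Cons:
  assumes "accepts q u" "accepts None (B # w)" "u \<noteq> []" "covers f (last u) B"
  shows "accepts q (u @ B # w)"
  using assms
proof (induction u arbitrary: q)
  case (Cons A u)
  then show ?case using Cons.IH[of "Some A"] by (cases u) auto
qed simp

text \<open>Any of the \<open>card W\<close> branches can be put in front of a walk that starts
  between \<open>y\<close> and \<open>z\<close>, since the ends of a branch are mapped to
  \<open>y\<close> and \<open>z\<close>. The longer walk starts there again, so the count multiplies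
  by \<open>card W\<close> every \<open>N\<close> steps, and the weights of these levels stay at
  least \<open>t\<close>.\<close>

lemma walks_not_light:
  fixes t :: real
  assumes N: "N > 0" and W: "finite W" "W \<noteq> {}"
    and yz: "y < z" "y \<in> P" "z \<in> P"
    and orbit: "\<And>w j. w \<in> W \<Longrightarrow> j \<le> N \<Longrightarrow> (f ^^ j) (p w) \<in> P \<and> (f ^^ j) (q w) \<in> P"
    and cont: "\<And>w j. w \<in> W \<Longrightarrow> j < N \<Longrightarrow> continuous_on (closed_segment ((f ^^ j) (p w)) ((f ^^ j) (q w))) f"
    and ends: "\<And>w. w \<in> W \<Longrightarrow> p w \<in> {y..z} \<and> q w \<in> {y..z} \<and> (f ^^ N) (p w) = y \<and> (f ^^ N) (q w) = z"
    and sep: "\<And>w w'. w \<in> W \<Longrightarrow> w' \<in> W \<Longrightarrow> w \<noteq> w' \<Longrightarrow> \<exists>j<N.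
      closed_segment ((f ^^ j) (p w)) ((f ^^ j) (q w)) \<inter> closed_segment ((f ^^ j) (p w')) ((f ^^ j) (q w')) = {}"
    and t: "0 < t" "card W * t ^ N \<ge> 1"
  shows "\<not> light t {w. accepts None w}"
proof
  assume light: "light t {w. accepts None w}"
  have gap_walk: "\<exists>u. length u = N \<and> accepts None u \<and> covers f (last u) (c', d') \<and>
    (\<forall>j<N. closed_segment (fst (u ! j)) (snd (u ! j)) \<subseteq> closed_segment ((f ^^ j) (p w)) ((f ^^ j) (q w)))"
    if "w \<in> W" "c' \<in> P" "d' \<in> P" "c' < d'" "{c'<..<d'} \<inter> P = {}" "y \<le> c'" "d' \<le> z" for w c' d'
  proof -
    have "closed_segment c' d' \<subseteq> closed_segment ((f ^^ N) (p w)) ((f ^^ N) (q w))"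
      using ends[OF that(1)] that yz by (auto simp: closed_segment_eq_real_ivl)
    from walk_into_gap[OF orbit[OF that(1)] cont[OF that(1)] that(2-5) this] obtain u where
      "length u = N" "accepts None u" "u \<noteq> [] \<longrightarrow> covers f (last u) (c', d')"
      "\<forall>j<N. closed_segment (fst (u ! j)) (snd (u ! j)) \<subseteq> closed_segment ((f ^^ j) (p w)) ((f ^^ j) (q w))"
      by auto
    then show ?thesis using N by auto
  qed
  \<comment> \<open>The summand 1 is the single vertex from which the prepending starts.\<close>
  define walks where "walks L = {u. accepts None u \<and> length u = N * L + 1 \<and> y \<le> fst (hd u) \<and> snd (hd u) \<le> z}" for L
  have fin: "finite (walks L)" for L
    by (rule finite_subset[OF _ finite_level[of None "N * L + 1"]]) (auto simp: walks_def)
  have inside: "y \<le> fst A \<and> snd A \<le> z" if "w \<in> W" "A \<in> vertices f P"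
    "closed_segment (fst A) (snd A) \<subseteq> closed_segment (p w) (q w)" for w A
  proof -
    have "closed_segment (p w) (q w) \<subseteq> {y..z}" using ends[OF that(1)]
      by (auto simp: closed_segment_eq_real_ivl split: if_splits)
    then show ?thesis using that by (auto simp: subset_iff)
  qed
  have "card (walks L) \<ge> card W ^ L" for L
  proof (induction L)
    case 0
    obtain w where w: "w \<in> W" using W by blast
    obtain c d where cd: "c \<in> P" "d \<in> P" "c < d" "{c<..<d} \<inter> P = {}" "y \<le> c" "d \<le> z"
      by (rule discrete_sign_change[OF finite_P yz(2,3,1), of "\<lambda>x. x = y"]) (use yz in auto)
    \<comment> \<open>The gap just found need not be a vertex, as \<open>f\<close> may be
      discontinuous there; the first vertex of a walk into it is one, and it lies between
      \<open>y\<close> and \<open>z\<close>.\<close>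
    from gap_walk[OF w this] obtain u where u: "length u = N" "accepts None u"
      "\<forall>j<N. closed_segment (fst (u ! j)) (snd (u ! j)) \<subseteq> closed_segment ((f ^^ j) (p w)) ((f ^^ j) (q w))"
      by blast
    then obtain A u' where A: "u = A # u'" using N by (cases u) auto
    then have "A \<in> vertices f P" "closed_segment (fst A) (snd A) \<subseteq> closed_segment (p w) (q w)"
      using u(2) u(3)[rule_format, OF N] by simp_all
    then have "[A] \<in> walks 0" using inside[OF w] by (auto simp: walks_def)
    then have "card (walks 0) \<noteq> 0" using fin by auto
    then show ?case by simp
  next
    case (Suc L)
    define good where "good w v u \<longleftrightarrow> length u = N \<and> accepts None u \<and> covers f (last u) (hd v) \<and>
      (\<forall>j<N. closed_segment (fst (u ! j)) (snd (u ! j)) \<subseteq> closed_segment ((f ^^ j) (p w)) ((f ^^ j) (q w)))"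
      for w v u
    have "\<exists>u. good w v u" if wv: "w \<in> W" "v \<in> walks L" for w v
    proof -
      obtain c' d' v' where v: "v = (c', d') # v'" using wv by (cases v) (auto simp: walks_def)
      then have "(c', d') \<in> vertices f P" "y \<le> c'" "d' \<le> z" using wv by (auto simp: walks_def)
      then show ?thesis using gap_walk[OF wv(1), of c' d'] v by (auto simp: good_def vertices_def)
    qed
    then obtain h where h: "\<And>w v. w \<in> W \<Longrightarrow> v \<in> walks L \<Longrightarrow> good w v (h w v)" by metis
    define e where "e = (\<lambda>(w, v). h w v @ v)"
    have len: "length (h w v) = N" if "w \<in> W" "v \<in> walks L" for w v using h[OF that] by (simp add: good_def)
    have "e ` (W \<times> walks L) \<subseteq> walks (Suc L)"
    proof (rule image_subsetI)
      fix x assume "x \<in> W \<times> walks L"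
      then obtain w v where x: "x = (w, v)" "w \<in> W" "v \<in> walks L" by blast
      have g: "good w v (h w v)" using h x by blast
      obtain A u' where A: "h w v = A # u'" using len[OF x(2,3)] N by (cases "h w v") auto
      obtain B v' where v: "v = B # v'" using x(3) by (cases v) (auto simp: walks_def)
      have "accepts None (h w v @ v)" unfolding v
        by (rule accepts_append_Cons) (use g x(3) A v in \<open>auto simp: good_def walks_def\<close>)
      moreover have "\<forall>j<N. closed_segment (fst (h w v ! j)) (snd (h w v ! j)) \<subseteq>
          closed_segment ((f ^^ j) (p w)) ((f ^^ j) (q w))" "accepts None (h w v)"
        using g by (simp_all add: good_def)
      from this(1)[rule_format, OF N] this(2)
      have "A \<in> vertices f P" "closed_segment (fst A) (snd A) \<subseteq> closed_segment (p w) (q w)"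
        by (simp_all add: A)
      then have "y \<le> fst A \<and> snd A \<le> z" using inside[OF x(2)] by blast
      ultimately show "e x \<in> walks (Suc L)"
        using x(3) len[OF x(2,3)] A by (auto simp: e_def x(1) walks_def)
    qed
    \<comment> \<open>\<open>v\<close> is read off from the end of the walk, and \<open>w\<close>
      from a time at which the segments of two branches are disjoint, because the vertex at that
      time lies in the segment of its own branch.\<close>
    moreover have "inj_on e (W \<times> walks L)"
    proof (rule inj_onI)
      fix x x' assume "x \<in> W \<times> walks L" "x' \<in> W \<times> walks L" and eq: "e x = e x'"
      then obtain w v w' v' where x: "x = (w, v)" "w \<in> W" "v \<in> walks L" "x' = (w', v')" "w' \<in> W" "v' \<in> walks L"
        by blast
      have hv: "h w v = h w' v'" "v = v'" using eq len x by (auto simp: e_def)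
      have "w = w'"
      proof (rule ccontr)
        assume "w \<noteq> w'"
        then obtain j where j: "j < N" "closed_segment ((f ^^ j) (p w)) ((f ^^ j) (q w)) \<inter>
          closed_segment ((f ^^ j) (p w')) ((f ^^ j) (q w')) = {}" using sep x by blast
        let ?A = "h w v ! j"
        have "fst ?A \<in> closed_segment (fst ?A) (snd ?A)" by simp
        moreover have "closed_segment (fst ?A) (snd ?A) \<subseteq> closed_segment ((f ^^ j) (p w)) ((f ^^ j) (q w))"
          using h[OF x(2,3)] j(1) by (simp add: good_def)
        moreover have "closed_segment (fst ?A) (snd ?A) \<subseteq> closed_segment ((f ^^ j) (p w')) ((f ^^ j) (q w'))"
          using h[OF x(5,6)] j(1) hv by (simp add: good_def)
        ultimately show False using j(2) by blast
      qed
      then show "x = x'" using x hv by simp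
    qed
    ultimately have "card (W \<times> walks L) \<le> card (walks (Suc L))"
      using card_inj_on_le[of e "W \<times> walks L" "walks (Suc L)"] fin by blast
    then show ?case using Suc by (simp add: card_cartesian_product) (meson le_trans mult_le_mono2)
  qed
  then have big: "card {w \<in> {w. accepts None w}. length w = N * L + 1} \<ge> card W ^ L" for L
  proof -
    have "card (walks L) \<le> card {w \<in> {w. accepts None w}. length w = N * L + 1}"
      by (rule card_mono) (use finite_level[of None "N * L + 1"] in \<open>auto simp: walks_def\<close>)
    then show ?thesis using \<open>\<And>L. card (walks L) \<ge> card W ^ L\<close>[of L] by linarith
  qed
  have "inj (\<lambda>L. N * L + 1)" using N by (auto simp: inj_def)
  then obtain L where L: "card {w \<in> {w. accepts None w}. length w = N * L + 1} * t ^ (N * L + 1) < t"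
    using light_levels_small[OF less_imp_le[OF t(1)] light _ t(1), of "\<lambda>L. N * L + 1"] finite_level by auto
  have "t \<le> (card W * t ^ N) ^ L * t"
    using t one_le_power[OF t(2), of L] by simp
  also have "\<dots> = real (card W ^ L) * t ^ (N * L + 1)"
    by (simp add: power_mult_distrib power_mult power_add)
  also have "\<dots> \<le> card {w \<in> {w. accepts None w}. length w = N * L + 1} * t ^ (N * L + 1)"
    using big[of L] t by (intro mult_right_mono) (auto simp flip: of_nat_power)
  finally show False using L by linarith
qed

lemma accepts_Some_nth:
  "accepts (Some B) w \<Longrightarrow> set w \<subseteq> vertices f P \<and> (\<forall>i<length w. covers f ((B # w) ! i) (w ! i))"
proof (induction w arbitrary: B)
  case (Cons A w)
  then have "covers f B A" "A \<in> vertices f P" "set w \<subseteq> vertices f P"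
    "\<And>i. i < length w \<Longrightarrow> covers f ((A # w) ! i) (w ! i)"
    using Cons.IH[of A] by simp_all
  then show ?case by (auto simp: less_Suc_eq_0_disj simp del: split_paired_All)
qed simp

lemma run_Some: "run (Some B) w = Some (last (B # w))"
  by (induction w arbitrary: B) auto

lemma loops_closed_walks: "loops b \<subseteq> closed_walks f P b"
proof
  fix w assume "w \<in> loops b"
  then obtain u where u: "w = b # u" "accepts (Some b) u" "may_follow f P (Some (last w)) b"
    by (auto simp: loops_def run_Some simp del: may_follow_simps)
  then show "w \<in> closed_walks f P b"
    using accepts_Some_nth[OF u(2)] by (auto simp: closed_walks_def)
qed

lemma heavy_closed_walks:
  fixes t :: real
  assumes "0 \<le> t" "\<not> light t {w. accepts None w}"
  obtains b where "b \<in> vertices f P" "\<not> light t (closed_walks f P b)"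
proof -
  have "\<exists>b\<in>vertices f P. \<not> light t (loops b)"
    using light_accepted[of t None] assms by fastforce
  then show ?thesis using that light_subset[OF _ loops_closed_walks] by blast
qed

end

text \<open>Passage from \<open>F = f ^^ k\<close> to \<open>f\<close>. The orbits of the horseshoe
  witnesses before time \<open>k * n\<close> form an invariant set, because at that time every
  witness arrives at one of the fixed points \<open>y\<close> and \<open>z\<close> of
  \<open>F ^^ n\<close>.\<close>

lemma (in interval_pieces) heavy_closed_walks:
  fixes \<alpha> \<beta> :: real
  assumes F: "F = f ^^ k" "k > 0" and X: "f ` X \<subseteq> X" "\<Union>pieces \<subseteq> X"
    and cont: "\<And>B j. B \<in> pieces \<Longrightarrow> j < k \<Longrightarrow> continuous_on ((f ^^ j) ` B) f"
    and heavy: "\<not> light (exp (- (\<alpha> * k))) (loops B)"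
    and \<beta>: "0 \<le> \<beta>" "\<beta> < \<alpha>"
  obtains P b where "finite P" "P \<subseteq> X" "f ` P \<subseteq> P" "b \<in> vertices f P" "\<not> light (exp (- \<beta>)) (closed_walks f P b)"
proof -
  \<comment> \<open>The summand 2 pays for the two branches that \<open>loops_horseshoe\<close>
    gives up.\<close>
  obtain n where n: "card {w \<in> loops B. length w = n} \<ge> 1 * exp (\<beta> * k * n) + 2"
    "card {w \<in> loops B. length w = n} \<ge> 2" "n > 0"
    by (rule many_words_exp[OF heavy, of "\<beta> * k" 0 1 2]) (use \<beta> F finite_loops_level in auto)
  define W where "W = {w \<in> loops B. length w = n}"
  have "finite W" "W \<subseteq> {w \<in> loops B. length w = n}" "card W \<ge> 2"
    using n finite_loops_level by (auto simp: W_def)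
  from loops_horseshoe[OF this n(3)] obtain W' y z p q where h: "W' \<subseteq> W" "card W \<le> card W' + 2"
    "y < z" "(F ^^ n) y = y" "(F ^^ n) z = z" "y \<in> B" "z \<in> B"
    and h': "\<forall>w\<in>W'. p w \<in> {y..z} \<and> q w \<in> {y..z} \<and> (F ^^ n) (p w) = y \<and> (F ^^ n) (q w) = z \<and>
      (\<forall>i<n. w ! i \<in> pieces \<and> (F ^^ i) (p w) \<in> w ! i \<and> (F ^^ i) (q w) \<in> w ! i)"
    by (elim exE conjE)
  have ends: "p w \<in> {y..z} \<and> q w \<in> {y..z} \<and> (F ^^ n) (p w) = y \<and> (F ^^ n) (q w) = z" if "w \<in> W'" for w
    using h' that by blast
  have itin: "w ! i \<in> pieces \<and> (F ^^ i) (p w) \<in> w ! i \<and> (F ^^ i) (q w) \<in> w ! i" if "w \<in> W'" "i < n" for w i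
    using h' that by blast
  have finW: "finite W" unfolding W_def by (rule finite_loops_level)
  have finW': "finite W'" by (rule finite_subset[OF h(1) finW])
  have cardW': "card W' \<ge> exp (\<beta> * k * n)" using n(1) h(2) by (simp add: W_def)
  then have "card W' \<noteq> 0" by (metis exp_gt_zero not_le of_nat_0)
  then have W'ne: "W' \<noteq> {}" by auto
  define N where "N = k * n"
  have N: "N > 0" using F n by (simp add: N_def)
  have pow: "F ^^ i = f ^^ (k * i)" for i by (simp add: F funpow_mult)
  define Q where "Q = {y, z} \<union> p ` W' \<union> q ` W'"
  define P where "P = (\<Union>j<N. (f ^^ j) ` Q)"
  have fN: "(f ^^ N) x \<in> {y, z}" if "x \<in> Q" for x
    using that h(4,5) ends unfolding Q_def N_def pow by auto
  have QP: "Q \<subseteq> P" using N by (force simp: P_def)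
  have fP: "f ` P \<subseteq> P"
  proof (rule image_subsetI)
    fix x assume "x \<in> P"
    then obtain j u where j: "j < N" "u \<in> Q" "x = (f ^^ j) u" by (auto simp: P_def)
    show "f x \<in> P"
    proof (cases "Suc j < N")
      case True
      have "f x = (f ^^ Suc j) u" by (simp add: j)
      then show ?thesis using True j unfolding P_def by blast
    next
      case False
      then have "Suc j = N" using j by simp
      then have "f x = (f ^^ N) u" using j by auto
      then have "f x \<in> Q" using fN[OF j(2)] by (auto simp: Q_def)
      then show ?thesis using QP by blast
    qed
  qed
  have finP: "finite P" using finW' by (auto simp: P_def Q_def)
  have Bp: "B \<in> pieces" using h W'ne n by (auto simp: W_def loops_def)
  have QX: "Q \<subseteq> X"
  proof -
    have "p w \<in> X \<and> q w \<in> X" if "w \<in> W'" for w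
      using itin[OF that, of 0] n X by auto
    then show ?thesis using h(6,7) Bp X unfolding Q_def by auto
  qed
  have "(f ^^ j) x \<in> X" if "x \<in> X" for j x
    using that X by (induction j) auto
  then have PX: "P \<subseteq> X" using QX by (auto simp: P_def)
  interpret G: finite_invariant f P by unfold_locales (use finP fP in auto)
  have orbit: "(f ^^ j) x \<in> P" if "x \<in> Q" for x j
  proof (induction j)
    case 0
    then show ?case using that QP by auto
  next
    case (Suc j)
    then show ?case using fP by auto
  qed
  \<comment> \<open>At time \<open>j\<close> both orbits lie in the image of one piece under fewer
    than \<open>k\<close> steps of \<open>f\<close>. That image is an interval on which
    \<open>f\<close> is continuous, so the gaps between the two orbits are vertices.\<close>
  have inside: "closed_segment ((f ^^ j) (p w)) ((f ^^ j) (q w)) \<subseteq> (f ^^ (j mod k)) ` (w ! (j div k))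
      \<and> w ! (j div k) \<in> pieces" if "w \<in> W'" "j < N" for w j
  proof -
    let ?A = "w ! (j div k)"
    have i: "j div k < n" using that F by (simp add: N_def less_mult_imp_div_less mult.commute)
    have A: "?A \<in> pieces" "(F ^^ (j div k)) (p w) \<in> ?A" "(F ^^ (j div k)) (q w) \<in> ?A"
      using itin[OF that(1) i] by auto
    have "continuous_on ?A (f ^^ m)" if "m \<le> k" for m
      using that
    proof (induction m)
      case (Suc m)
      then have "continuous_on ?A (f \<circ> (f ^^ m))"
        using cont[OF A(1), of m] by (intro continuous_on_compose) auto
      then show ?case by simp
    qed (simp add: id_def)
    moreover have "j mod k < k" using F by simp
    ultimately have "closed_segment ((f ^^ (j mod k)) ((F ^^ (j div k)) (p w))) ((f ^^ (j mod k)) ((F ^^ (j div k)) (q w)))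
      \<subseteq> (f ^^ (j mod k)) ` ?A"
      by (intro closed_segment_subset_image interval_piece A) auto
    moreover have "(f ^^ (j mod k)) ((F ^^ (j div k)) x) = (f ^^ j) x" for x
    proof -
      have "(f ^^ (j mod k)) ((F ^^ (j div k)) x) = (f ^^ (j mod k + k * (j div k))) x"
        by (simp only: pow funpow_add o_apply)
      then show ?thesis by simp
    qed
    ultimately show ?thesis using A by simp
  qed
  have "\<not> light (exp (- \<beta>)) {w. G.accepts None w}"
  proof (rule G.walks_not_light[of N W' y z p q])
    show "y \<in> P" "z \<in> P" using QP by (auto simp: Q_def)
    show "(f ^^ j) (p w) \<in> P \<and> (f ^^ j) (q w) \<in> P" if "w \<in> W'" for w j
      using orbit that by (auto simp: Q_def)
    show "continuous_on (closed_segment ((f ^^ j) (p w)) ((f ^^ j) (q w))) f" if "w \<in> W'" "j < N" for w j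
      using inside[OF that] cont[of "w ! (j div k)" "j mod k"] F continuous_on_subset by auto
    show "p w \<in> {y..z} \<and> q w \<in> {y..z} \<and> (f ^^ N) (p w) = y \<and> (f ^^ N) (q w) = z" if "w \<in> W'" for w
      using ends[OF that] unfolding N_def pow .
    show "\<exists>j<N. closed_segment ((f ^^ j) (p w)) ((f ^^ j) (q w)) \<inter> closed_segment ((f ^^ j) (p w')) ((f ^^ j) (q w')) = {}"
      if ww: "w \<in> W'" "w' \<in> W'" "w \<noteq> w'" for w w'
    proof -
      have "length w = n" "length w' = n" using h(1) ww by (auto simp: W_def)
      then obtain i where i: "i < n" "w ! i \<noteq> w' ! i" using ww(3) by (metis nth_equalityI)
      have ki: "k * i < N" "k * i div k = i" "k * i mod k = 0" using i F by (auto simp: N_def)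
      have "closed_segment ((f ^^ (k * i)) (p w)) ((f ^^ (k * i)) (q w)) \<subseteq> w ! i" "w ! i \<in> pieces"
        using inside[OF ww(1) ki(1)] by (simp_all add: ki id_def)
      moreover have "closed_segment ((f ^^ (k * i)) (p w')) ((f ^^ (k * i)) (q w')) \<subseteq> w' ! i" "w' ! i \<in> pieces"
        using inside[OF ww(2) ki(1)] by (simp_all add: ki id_def)
      moreover have "w ! i \<inter> w' ! i = {}" using disjoint_pieces calculation i(2) by blast
      ultimately show ?thesis using ki(1) by blast
    qed
    have "exp (\<beta> * k * n) * exp (- \<beta>) ^ N = 1"
      by (simp add: N_def exp_of_nat_mult[symmetric] exp_add[symmetric] algebra_simps)
    then show "1 \<le> card W' * exp (- \<beta>) ^ N"
      using mult_right_mono[OF cardW', of "exp (- \<beta>) ^ N"] by simp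
  qed (use N finW' W'ne h in auto)
  then obtain b where "b \<in> vertices f P" "\<not> light (exp (- \<beta>)) (closed_walks f P b)"
    by (rule G.heavy_closed_walks[OF exp_ge_zero])
  then show ?thesis using that finP PX fP by blast
qed

section \<open>Pesin-Pitskel' entropy\<close>

lemma infsum_image_le:
  fixes g :: "'b \<Rightarrow> ennreal"
  shows "infsum g (h ` A) \<le> infsum (\<lambda>x. g (h x)) A"
proof -
  obtain A' where A': "A' \<subseteq> A" "inj_on h A'" "h ` A = h ` A'"
    by (metis subset_image_inj order_refl)
  have "infsum g (h ` A) = infsum (\<lambda>x. g (h x)) A'"
    by (simp add: A'(3) infsum_reindex[OF A'(2)] o_def)
  also have "\<dots> \<le> infsum (\<lambda>x. g (h x)) A"
    by (rule infsum_mono_neutral) (use A' in \<open>auto intro: nonneg_summable_on_complete\<close>)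
  finally show ?thesis .
qed

lemma entropy_premeasure_mono:
  assumes "A \<subseteq> B"
  shows "entropy_premeasure Y f A \<alpha> \<U> N \<le> entropy_premeasure Y f B \<alpha> \<U> N"
  unfolding entropy_premeasure_def
  by (rule INF_superset_mono) (use assms in \<open>auto simp: string_coverings_def\<close>)

lemma entropy_premeasure_refine:
  assumes "\<And>U. U \<in> \<U> \<Longrightarrow> \<exists>V\<in>\<V>. U \<subseteq> V"
  shows "entropy_premeasure Y f A \<alpha> \<V> N \<le> entropy_premeasure Y f A \<alpha> \<U> N"
  unfolding entropy_premeasure_def
proof (rule INF_mono)
  fix \<G> assume G: "\<G> \<in> string_coverings Y f A \<U> N"
  obtain r where r: "\<And>U. U \<in> \<U> \<Longrightarrow> r U \<in> \<V> \<and> U \<subseteq> r U" using assms by metis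
  have "map r ` \<G> \<in> string_coverings Y f A \<V> N"
    unfolding string_coverings_def
  proof (intro CollectI conjI)
    have GU: "set s \<subseteq> \<U>" if "s \<in> \<G>" for s using G that by (auto simp: string_coverings_def strings_def)
    show "countable (map r ` \<G>)" using G by (auto simp: string_coverings_def)
    show "map r ` \<G> \<subseteq> strings \<V>" using G r by (fastforce simp: string_coverings_def strings_def lists_eq_set)
    show "\<forall>s\<in>map r ` \<G>. N \<le> length s" using G by (auto simp: string_coverings_def)
    have "string_points Y f s \<subseteq> string_points Y f (map r s)" if "s \<in> \<G>" for s
      using r GU[OF that] nth_mem by (fastforce simp: string_points_def)
    moreover have "A \<subseteq> (\<Union>s\<in>\<G>. string_points Y f s)" using G by (simp add: string_coverings_def)
    ultimately show "A \<subseteq> (\<Union>s\<in>map r ` \<G>. string_points Y f s)" by fastforce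
  qed
  moreover have "(\<Sum>\<^sub>\<infinity>s\<in>map r ` \<G>. ennreal (exp (- \<alpha> * real (length s))))
      \<le> (\<Sum>\<^sub>\<infinity>s\<in>\<G>. ennreal (exp (- \<alpha> * real (length s))))"
    using infsum_image_le[of "\<lambda>s. ennreal (exp (- \<alpha> * real (length s)))" "map r" \<G>] by simp
  ultimately show "\<exists>\<G>'\<in>string_coverings Y f A \<V> N. (\<Sum>\<^sub>\<infinity>s\<in>\<G>'. ennreal (exp (- \<alpha> * real (length s))))
      \<le> (\<Sum>\<^sub>\<infinity>s\<in>\<G>. ennreal (exp (- \<alpha> * real (length s))))" by blast
qed

lemma cover_entropy_mono:
  assumes "\<And>\<alpha> N. entropy_premeasure Y f A \<alpha> \<U> N \<le> entropy_premeasure Y f B \<alpha> \<V> N"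
  shows "cover_entropy Y f A \<U> \<le> cover_entropy Y f B \<V>"
  unfolding cover_entropy_def
proof (rule INF_superset_mono)
  show "{\<alpha>. 0 \<le> \<alpha> \<and> entropy_premeasure Y f B \<alpha> \<V> \<longlonglongrightarrow> 0}
      \<subseteq> {\<alpha>. 0 \<le> \<alpha> \<and> entropy_premeasure Y f A \<alpha> \<U> \<longlonglongrightarrow> 0}"
  proof clarify
    fix \<alpha> assume "entropy_premeasure Y f B \<alpha> \<V> \<longlonglongrightarrow> 0"
    with tendsto_const show "entropy_premeasure Y f A \<alpha> \<U> \<longlonglongrightarrow> 0"
      by (rule tendsto_sandwich[rotated 2]) (use assms in auto)
  qed
qed simp

lemma Lebesgue_number_finite_open_cover:
  assumes "compact (closure Y)" "Y \<noteq> {}" "\<U> \<in> finite_open_covers Y"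
  obtains \<delta> where "\<delta> > 0" "\<And>T. T \<subseteq> closure Y \<Longrightarrow> diameter T < \<delta> \<Longrightarrow> \<exists>U\<in>\<U>. T \<subseteq> U"
proof -
  have "\<forall>U\<in>\<U>. \<exists>O'. open O' \<and> U = closure Y \<inter> O'"
    using assms(3) by (auto simp: finite_open_covers_def openin_open)
  then obtain G where G: "\<And>U. U \<in> \<U> \<Longrightarrow> open (G U) \<and> U = closure Y \<inter> G U" by metis
  have "\<Union>\<U> = closure Y" using assms(3) by (simp add: finite_open_covers_def)
  then have cover: "closure Y \<subseteq> \<Union>(G ` \<U>)" using G by fastforce
  have "closure Y \<noteq> {}" using assms(2) by simp
  then have "G ` \<U> \<noteq> {}" using cover by auto
  then obtain \<delta> where \<delta>: "\<delta> > 0" "\<And>T. T \<subseteq> closure Y \<Longrightarrow> diameter T < \<delta> \<Longrightarrow> \<exists>B\<in>G ` \<U>. T \<subseteq> B"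
    by (rule Lebesgue_number_lemma[OF assms(1) _ cover]) (use G in auto)
  show ?thesis
  proof (rule that[OF \<delta>(1)])
    fix T assume T: "T \<subseteq> closure Y" "diameter T < \<delta>"
    then obtain U where "U \<in> \<U>" "T \<subseteq> G U" using \<delta>(2) by blast
    then show "\<exists>U\<in>\<U>. T \<subseteq> U" using G T by blast
  qed
qed

lemma eventually_small_covers:
  "eventually Q (small_covers Y) \<longleftrightarrow>
     (\<exists>\<delta>>0. \<forall>\<U>\<in>finite_open_covers Y. (\<forall>U\<in>\<U>. diameter U < \<delta>) \<longrightarrow> Q \<U>)"
proof -
  let ?S = "\<lambda>\<delta>. {\<U> \<in> finite_open_covers Y. \<forall>U\<in>\<U>. diameter U < \<delta>}"
  have "eventually Q (INF \<delta>\<in>{0<..}. principal (?S \<delta>)) \<longleftrightarrow> (\<exists>\<delta>\<in>{0<..}. eventually Q (principal (?S \<delta>)))"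
  proof (rule eventually_INF_base)
    fix a b :: real assume "a \<in> {0<..}" "b \<in> {0<..}"
    then show "\<exists>x\<in>{0<..}. principal (?S x) \<le> inf (principal (?S a)) (principal (?S b))"
      by (intro bexI[of _ "min a b"]) auto
  qed auto
  then show ?thesis unfolding small_covers_def eventually_principal by blast
qed

text \<open>\<open>Lim\<close> has the intended value only over a proper filter. Balls of radius
  \<open>\<delta> / 3\<close> leave room for the strict bound on the diameter.\<close>

lemma small_covers_neq_bot:
  assumes "compact (closure Y)"
  shows "small_covers Y \<noteq> bot"
proof -
  have "\<exists>\<U>\<in>finite_open_covers Y. \<forall>U\<in>\<U>. diameter U < \<delta>" if \<delta>: "\<delta> > 0" for \<delta> :: real
  proof -
    have "closure Y \<subseteq> (\<Union>x\<in>closure Y. ball x (\<delta> / 3))" using \<delta> by force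
    then obtain C where C: "C \<subseteq> closure Y" "finite C" "closure Y \<subseteq> (\<Union>x\<in>C. ball x (\<delta> / 3))"
      using compactE_image[OF assms, of "closure Y" "\<lambda>x. ball x (\<delta> / 3)"] by auto
    define \<U> where "\<U> = (\<lambda>x. closure Y \<inter> ball x (\<delta> / 3)) ` C"
    have "\<U> \<in> finite_open_covers Y"
      using C by (auto simp: \<U>_def finite_open_covers_def)
    moreover have "diameter U < \<delta>" if U: "U \<in> \<U>" for U
    proof -
      obtain x where x: "U \<subseteq> ball x (\<delta> / 3)" using U by (auto simp: \<U>_def)
      have "dist u v \<le> 2 * \<delta> / 3" if "u \<in> U" "v \<in> U" for u v
      proof -
        have "dist x u < \<delta> / 3" "dist x v < \<delta> / 3" using x that by auto
        then show ?thesis using dist_triangle3[of u v x] by simp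
      qed
      then have "diameter U \<le> 2 * \<delta> / 3"
        unfolding diameter_def using \<delta> by (cases "U = {}") (auto intro!: cSUP_least simp del: le_divide_eq_numeral1)
      then show ?thesis using \<delta> by simp
    qed
    ultimately show ?thesis by blast
  qed
  then show ?thesis
    using eventually_small_covers[of "\<lambda>_. False" Y] by (auto simp: trivial_limit_def)
qed

text \<open>Every cover that is finer than the Lebesgue number of a given cover refines it, and
  refinement can only raise the entropy. In the form of a supremum, a lower bound needs a single
  cover.\<close>

lemma Pesin_Pitskel_entropy_eq_SUP:
  assumes "compact (closure Y)" "Y \<noteq> {}"
  shows "Pesin_Pitskel_entropy Y f A = (SUP \<U>\<in>finite_open_covers Y. cover_entropy Y f A \<U>)"
proof -
  let ?s = "SUP \<U>\<in>finite_open_covers Y. cover_entropy Y f A \<U>"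
  have "(cover_entropy Y f A \<longlongrightarrow> ?s) (small_covers Y)"
  proof (rule order_tendstoI)
    fix a assume "a < ?s"
    then obtain \<V> where V: "\<V> \<in> finite_open_covers Y" "a < cover_entropy Y f A \<V>" by (auto simp: less_SUP_iff)
    obtain \<delta> where \<delta>: "\<delta> > 0" "\<And>T. T \<subseteq> closure Y \<Longrightarrow> diameter T < \<delta> \<Longrightarrow> \<exists>V\<in>\<V>. T \<subseteq> V"
      using Lebesgue_number_finite_open_cover[OF assms V(1)] by blast
    have "a < cover_entropy Y f A \<U>" if U: "\<U> \<in> finite_open_covers Y" "\<forall>U\<in>\<U>. diameter U < \<delta>" for \<U>
    proof -
      have "\<exists>V\<in>\<V>. U \<subseteq> V" if "U \<in> \<U>" for U
        using \<delta>(2)[of U] U that Union_upper[of U \<U>] by (simp add: finite_open_covers_def)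
      then have "cover_entropy Y f A \<V> \<le> cover_entropy Y f A \<U>"
        by (intro cover_entropy_mono entropy_premeasure_refine)
      then show ?thesis using V(2) by simp
    qed
    then show "\<forall>\<^sub>F \<U> in small_covers Y. a < cover_entropy Y f A \<U>"
      using \<delta>(1) by (auto simp: eventually_small_covers)
  next
    fix a assume a: "?s < a"
    have "cover_entropy Y f A \<U> < a" if "\<U> \<in> finite_open_covers Y" for \<U>
      using SUP_upper[OF that, of "cover_entropy Y f A"] a by (rule le_less_trans)
    then show "\<forall>\<^sub>F \<U> in small_covers Y. cover_entropy Y f A \<U> < a"
      by (auto simp: eventually_small_covers intro: exI[of _ 1])
  qed
  then show ?thesis
    unfolding Pesin_Pitskel_entropy_def using tendsto_Lim small_covers_neq_bot[OF assms(1)] by blast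
qed

lemma Pesin_Pitskel_entropy_mono:
  assumes "compact (closure Y)" "Y \<noteq> {}" "A \<subseteq> B"
  shows "Pesin_Pitskel_entropy Y f A \<le> Pesin_Pitskel_entropy Y f B"
  unfolding Pesin_Pitskel_entropy_eq_SUP[OF assms(1,2)]
  by (intro SUP_mono' cover_entropy_mono entropy_premeasure_mono assms)

text \<open>Used in contrapositive form, to obtain growth from entropy. Each accepted word of length
  \<open>M\<close> gives one string of length \<open>k * M\<close>; these strings cover
  \<open>Y\<close>, and their total weight is at most that of the level, which lightness makes
  arbitrarily small for suitable large \<open>M\<close>.\<close>

lemma (in interval_pieces) cover_entropy_le_if_light:
  fixes \<alpha> :: real
  assumes F: "F = f ^^ k" "k > 0" and Y: "f ` Y \<subseteq> Y" "Y \<subseteq> \<Union>pieces" "Y \<subseteq> S"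
    and cover: "\<And>B j. B \<in> pieces \<Longrightarrow> j < k \<Longrightarrow> \<exists>U\<in>\<U>. (f ^^ j) ` B \<inter> Y \<subseteq> U"
    and \<alpha>: "\<alpha> \<ge> 0" and light: "light (exp (- (\<alpha> * k))) {w. accepts S w}"
  shows "cover_entropy Y f Y \<U> \<le> ennreal \<alpha>"
proof -
  obtain u where u: "\<And>B j. B \<in> pieces \<Longrightarrow> j < k \<Longrightarrow> u B j \<in> \<U> \<and> (f ^^ j) ` B \<inter> Y \<subseteq> u B j"
    using cover by metis
  \<comment> \<open>Time \<open>l\<close> falls into step \<open>l div k\<close> of the itinerary,
    \<open>l mod k\<close> steps of \<open>f\<close> after its start.\<close>
  define str where "str w = map (\<lambda>l. u (w ! (l div k)) (l mod k)) [0..<k * length w]" for w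
  define level where "level M = {w. accepts S w \<and> length w = M}" for M
  have finl: "finite (level M)" for M using finite_level by (simp add: level_def)
  have orbit: "(f ^^ j) x \<in> Y" if "x \<in> Y" for j x
    using that Y(1) by (induction j) auto
  have bound: "entropy_premeasure Y f Y \<alpha> \<U> N \<le> ennreal (card (level M) * exp (- (\<alpha> * k)) ^ M)"
    if M: "M \<ge> N" "M \<ge> 1" for M N
  proof -
    have kM: "k * M \<ge> M" using F by simp
    have "str ` level M \<in> string_coverings Y f Y \<U> N"
      unfolding string_coverings_def
    proof (intro CollectI conjI)
      show "countable (str ` level M)" using finl by (simp add: countable_finite)
      show "str ` level M \<subseteq> strings \<U>"
      proof (rule image_subsetI)
        fix w assume "w \<in> level M"
        then have w: "set w \<subseteq> pieces" "length w = M" using accepts_letters by (auto simp: level_def)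
        have "u (w ! (l div k)) (l mod k) \<in> \<U>" if "l < k * length w" for l
        proof -
          have "l div k < length w" using that by (simp add: less_mult_imp_div_less mult.commute)
          then have "w ! (l div k) \<in> pieces" using w(1) nth_mem by blast
          then show ?thesis using u F by simp
        qed
        then show "str w \<in> strings \<U>" using w M kM by (auto simp: strings_def str_def)
      qed
      show "\<forall>s\<in>str ` level M. N \<le> length s" using M(1) kM order_trans[OF M(1) kM] by (auto simp: str_def level_def)
      show "Y \<subseteq> (\<Union>s\<in>str ` level M. string_points Y f s)"
      proof
        fix x assume x: "x \<in> Y"
        have "\<exists>B\<in>pieces. (F ^^ i) x \<in> B" for i
          using orbit[OF x, of "k * i"] Y(2) by (auto simp: F funpow_mult)
        then obtain b where b: "\<And>i. b i \<in> pieces \<and> (F ^^ i) x \<in> b i" by metis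
        define w where "w = map b [0..<M]"
        have "accepts S w" by (rule accepts_itinerary[of x]) (use x Y b in \<open>auto simp: w_def\<close>)
        then have w: "w \<in> level M" by (simp add: level_def w_def)
        have "(f ^^ l) x \<in> str w ! l" if l: "l < k * M" for l
        proof -
          have i: "l div k < M" using l by (simp add: less_mult_imp_div_less mult.commute)
          have "(f ^^ l) x = (f ^^ (l mod k + k * (l div k))) x" by simp
          also have "\<dots> = (f ^^ (l mod k)) ((F ^^ (l div k)) x)"
            by (simp only: F funpow_mult funpow_add o_apply)
          finally have "(f ^^ l) x \<in> (f ^^ (l mod k)) ` b (l div k)" using b by auto
          then have "(f ^^ l) x \<in> u (b (l div k)) (l mod k)"
            using u[of "b (l div k)" "l mod k"] b F orbit[OF x] by auto
          then show ?thesis using l i by (simp add: str_def w_def)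
        qed
        then have "x \<in> string_points Y f (str w)" using x by (simp add: string_points_def str_def w_def)
        then show "x \<in> (\<Union>s\<in>str ` level M. string_points Y f s)" using w by blast
      qed
    qed
    then have "entropy_premeasure Y f Y \<alpha> \<U> N
        \<le> (\<Sum>\<^sub>\<infinity>s\<in>str ` level M. ennreal (exp (- \<alpha> * real (length s))))"
      unfolding entropy_premeasure_def by (rule INF_lower)
    also have "\<dots> \<le> (\<Sum>\<^sub>\<infinity>w\<in>level M. ennreal (exp (- \<alpha> * real (length (str w)))))"
      by (rule infsum_image_le)
    also have "\<dots> = (\<Sum>w\<in>level M. ennreal (exp (- (\<alpha> * k)) ^ M))"
      unfolding infsum_finite[OF finl]
      by (rule sum.cong) (auto simp: str_def level_def exp_of_nat_mult[symmetric] algebra_simps)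
    also have "\<dots> = ennreal (card (level M) * exp (- (\<alpha> * k)) ^ M)"
      by (simp add: ennreal_mult ennreal_of_nat_eq_real_of_nat)
    finally show ?thesis .
  qed
  have "entropy_premeasure Y f Y \<alpha> \<U> N = 0" for N
  proof -
    have "entropy_premeasure Y f Y \<alpha> \<U> N \<le> ennreal e" if e: "e > 0" for e
    proof -
      have "inj (\<lambda>i. i + N + 1)" by (auto simp: inj_def)
      then obtain i where "card {w \<in> {w. accepts S w}. length w = i + N + 1} * exp (- (\<alpha> * k)) ^ (i + N + 1) < e"
        by (rule light_levels_small[OF exp_ge_zero light _ e, rotated]) (use finite_level in auto)
      then have "card (level (i + N + 1)) * exp (- (\<alpha> * k)) ^ (i + N + 1) < e"
        by (simp add: level_def)
      then show ?thesis using bound[of N "i + N + 1"] by (meson ennreal_leI le_add1 le_add2 less_imp_le order_trans trans_le_add1)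
    qed
    then show ?thesis
      by (metis ennreal_0 ennreal_le_epsilon le_zero_eq add_0 ennreal_zero_less_top)
  qed
  then have "entropy_premeasure Y f Y \<alpha> \<U> = (\<lambda>_. 0)" by blast
  then have "entropy_premeasure Y f Y \<alpha> \<U> \<longlonglongrightarrow> 0" by simp
  then show ?thesis unfolding cover_entropy_def using \<alpha> by (intro INF_lower) auto
qed


section \<open>Adapted partitions\<close>

definition interval_partition :: "real set \<Rightarrow> real set set \<Rightarrow> bool" where
  "interval_partition X \<B> \<longleftrightarrow> finite \<B> \<and> \<Union>\<B> = X \<and>
     (\<forall>B\<in>\<B>. is_interval B) \<and> (\<forall>A\<in>\<B>. \<forall>B\<in>\<B>. \<forall>x. x \<in> A \<longrightarrow> x \<in> B \<longrightarrow> A = B)"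

lemma interval_partitionD:
  assumes "interval_partition X \<B>"
  shows "finite \<B>" "\<Union>\<B> = X" "\<And>B. B \<in> \<B> \<Longrightarrow> is_interval B"
    "\<And>A B x. A \<in> \<B> \<Longrightarrow> B \<in> \<B> \<Longrightarrow> x \<in> A \<Longrightarrow> x \<in> B \<Longrightarrow> A = B"
proof -
  show "finite \<B>" "\<Union>\<B> = X" "\<And>B. B \<in> \<B> \<Longrightarrow> is_interval B"
    using assms by (simp_all add: interval_partition_def)
  show "A = B" if "A \<in> \<B>" "B \<in> \<B>" "x \<in> A" "x \<in> B" for A B x
    using assms that unfolding interval_partition_def by blast
qed

text \<open>The common ground of the two classes of maps. Monotonicity is left out, since a
  continuous map may fail to have finitely many laps.\<close>

definition adapted_pieces ::
    "(real \<Rightarrow> real) \<Rightarrow> real set \<Rightarrow> nat \<Rightarrow> real \<Rightarrow> real set set \<Rightarrow> bool" where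
  "adapted_pieces f X k \<delta> \<B> \<longleftrightarrow> interval_partition X \<B> \<and>
     (\<forall>B\<in>\<B>. \<forall>j<k. continuous_on ((f ^^ j) ` B) f \<and>
        (\<forall>x\<in>B. \<forall>y\<in>B. \<bar>(f ^^ j) x - (f ^^ j) y\<bar> < \<delta>))"

lemma adapted_piecesD:
  assumes "adapted_pieces f X k \<delta> \<B>"
  shows "interval_partition X \<B>"
    "\<And>B j. B \<in> \<B> \<Longrightarrow> j < k \<Longrightarrow> continuous_on ((f ^^ j) ` B) f"
    "\<And>B j x y. B \<in> \<B> \<Longrightarrow> j < k \<Longrightarrow> x \<in> B \<Longrightarrow> y \<in> B \<Longrightarrow> \<bar>(f ^^ j) x - (f ^^ j) y\<bar> < \<delta>"
  using assms by (simp_all add: adapted_pieces_def)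

lemma interval_grid:
  fixes a b \<eta> :: real
  assumes "\<eta> > 0"
  shows "\<exists>\<G>. interval_partition {a..b} \<G> \<and> (\<forall>G\<in>\<G>. \<forall>x\<in>G. \<forall>y\<in>G. \<bar>x - y\<bar> < \<eta>)"
proof -
  define cell where "cell i = {x \<in> {a..b}. \<lfloor>x / \<eta>\<rfloor> = i}" for i
  have mono: "\<lfloor>x / \<eta>\<rfloor> \<le> \<lfloor>y / \<eta>\<rfloor>" if "x \<le> y" for x y
    using that assms by (intro floor_mono divide_right_mono) auto
  show ?thesis
    unfolding interval_partition_def
  proof (intro exI[of _ "cell ` {\<lfloor>a / \<eta>\<rfloor>..\<lfloor>b / \<eta>\<rfloor>}"] conjI ballI)
    show "\<Union>(cell ` {\<lfloor>a / \<eta>\<rfloor>..\<lfloor>b / \<eta>\<rfloor>}) = {a..b}" using mono by (auto simp: cell_def)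
    show "is_interval G" if G: "G \<in> cell ` {\<lfloor>a / \<eta>\<rfloor>..\<lfloor>b / \<eta>\<rfloor>}" for G
    proof -
      obtain i where G: "G = cell i" using G by blast
      have "z \<in> G" if "x \<in> G" "y \<in> G" "x \<le> z" "z \<le> y" for x y z
        using that mono[OF that(3)] mono[OF that(4)] by (auto simp: G cell_def)
      then show ?thesis unfolding is_interval_1 by blast
    qed
    show "\<bar>x - y\<bar> < \<eta>" if G: "G \<in> cell ` {\<lfloor>a / \<eta>\<rfloor>..\<lfloor>b / \<eta>\<rfloor>}" "x \<in> G" "y \<in> G" for G x y
    proof -
      have eq: "\<lfloor>x / \<eta>\<rfloor> = \<lfloor>y / \<eta>\<rfloor>" using G by (auto simp: cell_def)
      have "\<bar>x / \<eta> - y / \<eta>\<bar> < 1" using eq by linarith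
      then have "\<bar>(x - y) / \<eta>\<bar> < 1" by (simp add: diff_divide_distrib)
      then show ?thesis using assms by (simp add: abs_divide)
    qed
  qed (auto simp: cell_def)
qed

text \<open>The iterates below \<open>k\<close> are uniformly continuous, so one sufficiently fine
  grid serves them all.\<close>

lemma adapted_pieces_continuous:
  fixes f :: "real \<Rightarrow> real"
  assumes f: "continuous_on {a..b} f" "f ` {a..b} \<subseteq> {a..b}" and \<delta>: "\<delta> > 0"
  shows "\<exists>\<B>. adapted_pieces f {a..b} k \<delta> \<B>"
proof -
  have orbit: "(f ^^ j) x \<in> {a..b}" if "x \<in> {a..b}" for j x
    using that f(2) by (induction j) (simp, force simp del: atLeastAtMost_iff)
  have cont: "continuous_on {a..b} (f ^^ j)" for j
  proof (induction j)
    case (Suc j)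
    have "(f ^^ j) ` {a..b} \<subseteq> {a..b}" using orbit by blast
    then have "continuous_on {a..b} (f \<circ> (f ^^ j))"
      using Suc f(1) continuous_on_subset by (intro continuous_on_compose) blast+
    then show ?case by simp
  qed (simp add: id_def)
  have "\<exists>\<eta>>0. \<forall>j<k. \<forall>x\<in>{a..b}. \<forall>y\<in>{a..b}. \<bar>x - y\<bar> < \<eta> \<longrightarrow> \<bar>(f ^^ j) x - (f ^^ j) y\<bar> < \<delta>"
  proof (induction k)
    case 0
    then show ?case by (intro exI[of _ 1]) auto
  next
    case (Suc k)
    then obtain \<eta> where \<eta>: "\<eta> > 0"
      "\<And>j x y. j < k \<Longrightarrow> x \<in> {a..b} \<Longrightarrow> y \<in> {a..b} \<Longrightarrow> \<bar>x - y\<bar> < \<eta> \<Longrightarrow> \<bar>(f ^^ j) x - (f ^^ j) y\<bar> < \<delta>"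
      by blast
    obtain \<eta>' where \<eta>': "\<eta>' > 0"
      "\<And>x y. x \<in> {a..b} \<Longrightarrow> y \<in> {a..b} \<Longrightarrow> \<bar>y - x\<bar> < \<eta>' \<Longrightarrow> \<bar>(f ^^ k) y - (f ^^ k) x\<bar> < \<delta>"
      using compact_uniformly_continuous[OF cont[of k]] \<delta>
      unfolding uniformly_continuous_on_def dist_real_def by (metis compact_Icc)
    show ?case
    proof (intro exI[of _ "min \<eta> \<eta>'"] conjI allI impI ballI)
      fix j x y assume *: "j < Suc k" "x \<in> {a..b}" "y \<in> {a..b}" "\<bar>x - y\<bar> < min \<eta> \<eta>'"
      show "\<bar>(f ^^ j) x - (f ^^ j) y\<bar> < \<delta>"
        using \<eta>(2)[of j x y] \<eta>'(2)[of y x] * by (cases "j = k") auto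
    qed (use \<eta> \<eta>' in auto)
  qed
  then obtain \<eta> where \<eta>: "\<eta> > 0"
    "\<And>j x y. j < k \<Longrightarrow> x \<in> {a..b} \<Longrightarrow> y \<in> {a..b} \<Longrightarrow> \<bar>x - y\<bar> < \<eta> \<Longrightarrow> \<bar>(f ^^ j) x - (f ^^ j) y\<bar> < \<delta>" by blast
  obtain \<G> where G: "interval_partition {a..b} \<G>" "\<forall>G\<in>\<G>. \<forall>x\<in>G. \<forall>y\<in>G. \<bar>x - y\<bar> < \<eta>"
    using interval_grid[OF \<eta>(1), of a b] by blast
  have "adapted_pieces f {a..b} k \<delta> \<G>"
    unfolding adapted_pieces_def
  proof (intro conjI ballI allI impI G(1))
    fix G j assume Gj: "G \<in> \<G>" "j < k"
    then have sub: "G \<subseteq> {a..b}" using interval_partitionD(2)[OF G(1)] by blast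
    show "continuous_on ((f ^^ j) ` G) f"
      by (rule continuous_on_subset[OF f(1)]) (use sub orbit in blast)
    fix x y assume "x \<in> G" "y \<in> G"
    then show "\<bar>(f ^^ j) x - (f ^^ j) y\<bar> < \<delta>" using \<eta>(2)[OF Gj(2), of x y] G(2) Gj(1) sub by blast
  qed
  then show ?thesis by blast
qed

text \<open>A cell is cut out by a lap of \<open>f\<close>, a cell of a grid of mesh \<delta>, and
  the preimage of a piece for \<open>k\<close>. The first two settle time 0, the last one all later
  times; the cell is an interval because \<open>f\<close> is monotone on the lap.\<close>

lemma adapted_pieces_monotonic:
  fixes f :: "real \<Rightarrow> real"
  assumes "piecewise_monotonic {a..b} f" "f ` {a..b} \<subseteq> {a..b}" and \<delta>: "\<delta> > 0"
  shows "\<exists>\<B>. adapted_pieces f {a..b} k \<delta> \<B>"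
proof (induction k)
  case 0
  show ?case
    by (rule exI[of _ "{{a..b}}"]) (simp add: adapted_pieces_def interval_partition_def is_interval_cc)
next
  case (Suc k)
  then obtain \<B> where "adapted_pieces f {a..b} k \<delta> \<B>" by blast
  note adapted_piecesD[OF this]
  note B = interval_partitionD[OF this(1)] this(2,3)
  obtain P where P0: "finite P" "partition_on {a..b} P" "\<forall>J\<in>P. is_interval J \<and> continuous_on J f \<and>
      (strict_mono_on J f \<or> strict_antimono_on J f)"
    using assms(1) unfolding piecewise_monotonic_def by blast
  then have P: "finite P" "partition_on {a..b} P" "\<And>J. J \<in> P \<Longrightarrow> is_interval J"
    "\<And>J. J \<in> P \<Longrightarrow> continuous_on J f" "\<And>J. J \<in> P \<Longrightarrow> strict_mono_on J f \<or> strict_antimono_on J f"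
    by simp_all
  have P': "\<Union>P = {a..b}" "\<And>A B x. A \<in> P \<Longrightarrow> B \<in> P \<Longrightarrow> x \<in> A \<Longrightarrow> x \<in> B \<Longrightarrow> A = B"
    using P(2) by (auto simp: partition_on_def disjoint_def)
  obtain \<G> where G0: "interval_partition {a..b} \<G>" "\<forall>G\<in>\<G>. \<forall>x\<in>G. \<forall>y\<in>G. \<bar>x - y\<bar> < \<delta>"
    using interval_grid[OF \<delta>, of a b] by blast
  have small: "\<bar>x - y\<bar> < \<delta>" if "G \<in> \<G>" "x \<in> G" "y \<in> G" for G x y using G0(2) that by blast
  note G = interval_partitionD[OF G0(1)] small
  define cell where "cell A H B = A \<inter> H \<inter> f -` B" for A H B :: "real set"
  define \<C> where "\<C> = (\<lambda>(A, H, B). cell A H B) ` (P \<times> \<G> \<times> \<B>)"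
  have CE: "\<exists>A H B. A \<in> P \<and> H \<in> \<G> \<and> B \<in> \<B> \<and> C = cell A H B" if "C \<in> \<C>" for C
    using that by (auto simp: \<C>_def)
  have "adapted_pieces f {a..b} (Suc k) \<delta> \<C>"
    unfolding adapted_pieces_def interval_partition_def
  proof (intro conjI ballI allI impI)
    show "finite \<C>" using P G B by (simp add: \<C>_def)
    show "\<Union>\<C> = {a..b}"
    proof
      show "\<Union>\<C> \<subseteq> {a..b}" using G(2) CE by (fastforce simp: cell_def)
      show "{a..b} \<subseteq> \<Union>\<C>"
      proof
        fix x assume x: "x \<in> {a..b}"
        then have "f x \<in> {a..b}" using assms(2) by blast
        then obtain A H B where "A \<in> P" "H \<in> \<G>" "B \<in> \<B>" "x \<in> A" "x \<in> H" "f x \<in> B"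
          using x P' G B by (metis UnionE)
        then show "x \<in> \<Union>\<C>" by (force simp: \<C>_def cell_def)
      qed
    qed
  next
    fix C assume "C \<in> \<C>"
    then obtain A H B where C: "A \<in> P" "H \<in> \<G>" "B \<in> \<B>" "C = cell A H B" using CE by blast
    show "is_interval C"
    proof -
      have "z \<in> C" if xyz: "x \<in> C" "y \<in> C" "x \<le> z" "z \<le> y" for x y z
      proof -
        have AH: "z \<in> A" "z \<in> H"
          using mem_is_interval_1_I[of A x y z] mem_is_interval_1_I[of H x y z] P(3) G(3) C xyz
          by (auto simp: cell_def)
        have xyA: "x \<in> A" "y \<in> A" "f x \<in> B" "f y \<in> B" using xyz C by (auto simp: cell_def)
        have "f x \<le> f z \<and> f z \<le> f y \<or> f y \<le> f z \<and> f z \<le> f x"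
          using P(5)[OF C(1)]
        proof
          assume "strict_mono_on A f"
          then have "mono_on A f" by (rule strict_mono_on_imp_mono_on)
          then show ?thesis using xyA AH xyz by (auto simp: mono_on_def)
        next
          assume m: "strict_antimono_on A f"
          have "f v \<le> f u" if "u \<in> A" "v \<in> A" "u \<le> v" for u v
            using m that by (cases "u = v") (auto simp: monotone_on_def less_le)
          then show ?thesis using xyA AH xyz by blast
        qed
        then have "f z \<in> B" using mem_is_interval_1_I[OF B(3)[OF C(3)]] xyA by blast
        then show ?thesis using AH C by (simp add: cell_def)
      qed
      then show ?thesis unfolding is_interval_1 by blast
    qed
    fix j assume j: "j < Suc k"
    show "continuous_on ((f ^^ j) ` C) f"
    proof (cases j)
      case 0
      have "C \<subseteq> A" by (auto simp: C cell_def)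
      then show ?thesis using 0 continuous_on_subset[OF P(4)[OF C(1)]] by simp
    next
      case (Suc i)
      have "(f ^^ j) ` C \<subseteq> (f ^^ i) ` B" by (auto simp: Suc C cell_def funpow_swap1)
      then show ?thesis using Suc j continuous_on_subset[OF B(5)[OF C(3)]] by auto
    qed
    fix x y assume xy: "x \<in> C" "y \<in> C"
    show "\<bar>(f ^^ j) x - (f ^^ j) y\<bar> < \<delta>"
    proof (cases j)
      case 0
      then show ?thesis using G(5)[OF C(2), of x y] xy by (auto simp: C cell_def)
    next
      case (Suc i)
      then show ?thesis using B(6)[OF C(3), of i "f x" "f y"] j xy by (auto simp: C cell_def funpow_swap1)
    qed
  next
    fix C D x assume "C \<in> \<C>" "D \<in> \<C>" and x: "x \<in> C" "x \<in> D"
    then obtain A H B A' H' B' where CD: "A \<in> P" "H \<in> \<G>" "B \<in> \<B>" "C = cell A H B"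
      "A' \<in> P" "H' \<in> \<G>" "B' \<in> \<B>" "D = cell A' H' B'" using CE by meson
    have "A = A'" using P'(2)[OF CD(1,5), of x] x CD by (auto simp: cell_def)
    moreover have "H = H'" using G(4)[OF CD(2,6), of x] x CD by (auto simp: cell_def)
    moreover have "B = B'" using B(4)[OF CD(3,7), of "f x"] x CD by (auto simp: cell_def)
    ultimately show "C = D" using CD by simp
  qed
  then show ?case by blast
qed

lemma interval_pieces_adapted:
  assumes "adapted_pieces f {a..b} k \<delta> \<B>"
  shows "interval_pieces (f ^^ k) \<B>"
proof
  note part = adapted_piecesD(1)[OF assms]
  show "finite \<B>" using interval_partitionD[OF part] by blast
  show "is_interval B" if "B \<in> \<B>" for B using interval_partitionD[OF part] that by blast
  show "A = B" if "A \<in> \<B>" "B \<in> \<B>" "x \<in> A" "x \<in> B" for A B x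
    using interval_partitionD(4)[OF part] that by blast
  show "bounded B" if "B \<in> \<B>" for B
    using interval_partitionD(2)[OF part] that by (metis Union_upper bounded_closed_interval bounded_subset)
  fix B assume B: "B \<in> \<B>"
  have "continuous_on B (f ^^ m)" if "m \<le> k" for m
    using that
  proof (induction m)
    case (Suc m)
    then have "continuous_on ((f ^^ m) ` B) f" using assms B by (simp add: adapted_pieces_def)
    then have "continuous_on B (f \<circ> (f ^^ m))" using Suc by (intro continuous_on_compose) auto
    then show ?case by simp
  qed (simp add: id_def)
  then show "continuous_on B (f ^^ k)" by blast
qed

section \<open>Symbols\<close>

text \<open>Closed gaps make these sets compact; in exchange, different walks can share points whose
  orbits hit \<open>P\<close>.\<close>

definition walk_set :: "(real \<Rightarrow> real) \<Rightarrow> (real \<times> real) list \<Rightarrow> real set" where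
  "walk_set f bs = {x. \<forall>j<length bs. (f ^^ j) x \<in> {fst (bs ! j)..snd (bs ! j)}}"

lemma walk_set_append:
  "x \<in> walk_set f (u @ v) \<longleftrightarrow> x \<in> walk_set f u \<and> (f ^^ length u) x \<in> walk_set f v"
proof
  assume x: "x \<in> walk_set f (u @ v)"
  have "(f ^^ j) x \<in> {fst (u ! j)..snd (u ! j)}" if "j < length u" for j
    using x that by (auto simp: walk_set_def nth_append dest!: spec[of _ j])
  moreover have "(f ^^ j) ((f ^^ length u) x) \<in> {fst (v ! j)..snd (v ! j)}" if j: "j < length v" for j
  proof -
    have "(f ^^ (length u + j)) x \<in> {fst ((u @ v) ! (length u + j))..snd ((u @ v) ! (length u + j))}"
      by (rule x[unfolded walk_set_def mem_Collect_eq, rule_format]) (use j in simp)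
    then show ?thesis by (simp add: funpow_add nth_append add.commute[of "length u" j])
  qed
  ultimately show "x \<in> walk_set f u \<and> (f ^^ length u) x \<in> walk_set f v" by (simp add: walk_set_def)
next
  assume x: "x \<in> walk_set f u \<and> (f ^^ length u) x \<in> walk_set f v"
  have "(f ^^ j) x \<in> {fst ((u @ v) ! j)..snd ((u @ v) ! j)}" if j: "j < length u + length v" for j
  proof (cases "j < length u")
    case True
    then show ?thesis using x by (simp add: walk_set_def nth_append)
  next
    case False
    then have l: "j - length u < length v" using j by simp
    have "(f ^^ (j - length u)) ((f ^^ length u) x) \<in> {fst (v ! (j - length u))..snd (v ! (j - length u))}"
      by (rule x[THEN conjunct2, unfolded walk_set_def mem_Collect_eq, rule_format, OF l])
    moreover have "(f ^^ (j - length u)) ((f ^^ length u) x) = (f ^^ j) x"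
      using funpow_add[of "j - length u" "length u" f] False by simp
    ultimately show ?thesis using False by (simp add: nth_append)
  qed
  then show "x \<in> walk_set f (u @ v)" by (simp add: walk_set_def)
qed

lemma walk_set_singleton [simp]: "walk_set f [A] = {fst A..snd A}"
  by (auto simp: walk_set_def)

context finite_invariant
begin

lemma vertex_continuous: "A \<in> vertices f P \<Longrightarrow> continuous_on {fst A..snd A} f"
  by (auto simp: vertices_def)

lemma funpow_P: "x \<in> P \<Longrightarrow> (f ^^ j) x \<in> P"
  using invariant_P by (induction j) auto

lemma vertex_unique:
  assumes "A \<in> vertices f P" "B \<in> vertices f P" "x \<in> {fst A..snd A}" "x \<in> {fst B..snd B}" "x \<notin> P"
  shows "A = B"
proof -
  obtain c d c' d' where AB: "A = (c, d)" "B = (c', d')" by (metis surj_pair)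
  have h: "c \<in> P" "d \<in> P" "c' \<in> P" "d' \<in> P" "{c<..<d} \<inter> P = {}" "{c'<..<d'} \<inter> P = {}"
    using assms(1,2) by (auto simp: AB vertices_def)
  have "c < x" "x < d" "c' < x" "x < d'" using assms(3-5) h(1-4) by (auto simp: AB less_le)
  then have "c' < d" "c < d'" by simp_all
  then have "\<not> c < c'" "\<not> c' < c" "\<not> d < d'" "\<not> d' < d" using h by (auto simp: disjoint_iff)
  then show ?thesis by (simp add: AB)
qed

lemma continuous_on_walk_set:
  assumes "set bs \<subseteq> vertices f P" "j \<le> length bs"
  shows "continuous_on (walk_set f bs) (f ^^ j)"
  using assms(2)
proof (induction j)
  case (Suc j)
  have "bs ! j \<in> vertices f P" using Suc.prems assms(1) by auto
  then have "continuous_on {fst (bs ! j)..snd (bs ! j)} f" by (rule vertex_continuous)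
  moreover have "(f ^^ j) ` walk_set f bs \<subseteq> {fst (bs ! j)..snd (bs ! j)}"
    using Suc.prems by (auto simp: walk_set_def)
  ultimately have "continuous_on (walk_set f bs) (f \<circ> (f ^^ j))"
    using Suc by (intro continuous_on_compose) (auto intro: continuous_on_subset)
  then show ?case by simp
qed (simp add: id_def)

lemma compact_walk_set:
  assumes "set bs \<subseteq> vertices f P" "bs \<noteq> []"
  shows "compact (walk_set f bs)"
  using assms(2,1)
proof (induction bs rule: rev_nonempty_induct)
  case (single A)
  show ?case by simp
next
  case (snoc A bs)
  then have c: "compact (walk_set f bs)" by auto
  have "continuous_on (walk_set f bs) (f ^^ length bs)"
    using continuous_on_walk_set[of bs "length bs"] snoc.prems by simp
  then have "closed (walk_set f bs \<inter> (f ^^ length bs) -` {fst A..snd A})"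
    by (rule continuous_closed_preimage) (use c compact_imp_closed in auto)
  moreover have "walk_set f (bs @ [A]) = walk_set f bs \<inter> (walk_set f bs \<inter> (f ^^ length bs) -` {fst A..snd A})"
    by (auto simp: walk_set_append)
  ultimately show ?case using compact_Int_closed[OF c] by metis
qed

text \<open>By the intermediate value theorem, the points that follow a finite prefix are mapped
  onto its last gap, so the nested compact sets of such points are nonempty.\<close>

lemma infinite_walk_realized:
  assumes V: "\<And>i. \<beta> i \<in> vertices f P" and E: "\<And>i. covers f (\<beta> i) (\<beta> (Suc i))"
  obtains x where "\<And>i. (f ^^ i) x \<in> {fst (\<beta> i)..snd (\<beta> i)}"
proof -
  define W where "W n = walk_set f (map \<beta> [0..<Suc n])" for n
  have ord: "fst (\<beta> i) < snd (\<beta> i)" for i using V[of i] by (auto simp: vertices_def)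
  have step: "{fst (\<beta> (Suc i))..snd (\<beta> (Suc i))} \<subseteq> f ` {fst (\<beta> i)..snd (\<beta> i)}" for i
  proof -
    have "{fst (\<beta> (Suc i))..snd (\<beta> (Suc i))} = closed_segment (fst (\<beta> (Suc i))) (snd (\<beta> (Suc i)))"
      using ord[of "Suc i"] by (simp add: closed_segment_eq_real_ivl)
    also have "\<dots> \<subseteq> closed_segment (f (fst (\<beta> i))) (f (snd (\<beta> i)))" using E[of i] by (simp add: covers_def)
    also have "\<dots> \<subseteq> f ` {fst (\<beta> i)..snd (\<beta> i)}"
      by (rule closed_segment_subset_image) (use vertex_continuous[OF V] ord[of i] in \<open>auto simp: is_interval_cc\<close>)
    finally show ?thesis .
  qed
  have Wmem: "x \<in> W n \<longleftrightarrow> (\<forall>j\<le>n. (f ^^ j) x \<in> {fst (\<beta> j)..snd (\<beta> j)})" for x n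
    by (auto simp: W_def walk_set_def less_Suc_eq_le simp del: upt_Suc)
  have onto: "{fst (\<beta> n)..snd (\<beta> n)} \<subseteq> (f ^^ n) ` W n" for n
  proof (induction n)
    case 0
    then show ?case by (auto simp: Wmem)
  next
    case (Suc n)
    show ?case
    proof
      fix y assume y: "y \<in> {fst (\<beta> (Suc n))..snd (\<beta> (Suc n))}"
      then obtain y' where y': "y' \<in> {fst (\<beta> n)..snd (\<beta> n)}" "y = f y'" using step by blast
      then obtain x where x: "x \<in> W n" "y' = (f ^^ n) x" using Suc by blast
      then have "x \<in> W (Suc n)" using y y' unfolding Wmem by (auto simp: le_Suc_eq)
      then show "y \<in> (f ^^ Suc n) ` W (Suc n)" using x y' by auto
    qed
  qed
  have "(\<Inter>n. W n) \<noteq> {}"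
  proof (rule compact_nest)
    show "compact (W n)" for n
      unfolding W_def by (rule compact_walk_set) (use V in auto)
    show "W n \<noteq> {}" for n
      using onto[of n] ord[of n] by force
    show "W n \<subseteq> W m" if "m \<le> n" for m n
      using that unfolding subset_iff Wmem by auto
  qed
  then obtain x where "\<And>n. x \<in> W n" by blast
  then show ?thesis using that[of x] unfolding Wmem by blast
qed

text \<open>An edge leads from an endpoint of a vertex to an endpoint of the covered segment, which lies in
  only one vertex inside that segment.\<close>

lemma endpoint_step_unique:
  assumes V: "A \<in> vertices f P" "B \<in> vertices f P" "B' \<in> vertices f P" and E: "covers f A B" "covers f A B'"
    and e: "e \<in> P" "e \<in> {fst A..snd A}" "f e \<in> {fst B..snd B}" "f e \<in> {fst B'..snd B'}"
  shows "B = B'"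
proof -
  obtain c d where A: "A = (c, d)" by force
  obtain r s r' s' where B: "B = (r, s)" "B' = (r', s')" by (metis surj_pair)
  have VB: "r \<in> P" "s \<in> P" "r < s" "{r<..<s} \<inter> P = {}" "r' \<in> P" "s' \<in> P" "r' < s'" "{r'<..<s'} \<inter> P = {}"
    using V by (auto simp: B vertices_def)
  have "e \<notin> {c<..<d}" using e(1) V(1) by (auto simp: A vertices_def)
  then have "e = c \<or> e = d" using e(2) by (auto simp: A)
  moreover have "r \<in> closed_segment (f c) (f d)" "s \<in> closed_segment (f c) (f d)"
    "r' \<in> closed_segment (f c) (f d)" "s' \<in> closed_segment (f c) (f d)"
    using E by (auto simp: A B covers_def)
  then have "min (f c) (f d) \<le> r" "s \<le> max (f c) (f d)" "min (f c) (f d) \<le> r'" "s' \<le> max (f c) (f d)"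
    by (simp_all add: closed_segment_eq_real_ivl min_def max_def split: if_splits)
  ultimately have "f e \<le> r \<and> f e \<le> r' \<or> s \<le> f e \<and> s' \<le> f e" by (auto simp: min_def max_def split: if_splits)
  then show ?thesis
  proof
    assume "f e \<le> r \<and> f e \<le> r'"
    then have "r = f e" "r' = f e" using e by (auto simp: B)
    then have "r' = r" by simp
    then have "\<not> s < s'" "\<not> s' < s" using VB(1-8) by (auto simp: disjoint_iff)
    then show ?thesis using \<open>r' = r\<close> by (simp add: B)
  next
    assume "s \<le> f e \<and> s' \<le> f e"
    then have "s = f e" "s' = f e" using e by (auto simp: B)
    then have "s' = s" by simp
    then have "\<not> r < r'" "\<not> r' < r" using VB(1-8) by (auto simp: disjoint_iff)
    then show ?thesis using \<open>s' = s\<close> by (simp add: B)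
  qed
qed

lemma closed_walksD:
  assumes "w \<in> closed_walks f P b"
  shows "w \<noteq> []" "hd w = b" "set w \<subseteq> vertices f P" "covers f (last w) b"
    "\<And>i. Suc i < length w \<Longrightarrow> covers f (w ! i) (w ! Suc i)"
  using assms by (simp_all add: closed_walks_def)

lemma closed_walks_vertex: "w \<in> closed_walks f P b \<Longrightarrow> i < length w \<Longrightarrow> w ! i \<in> vertices f P"
  by (rule subsetD[OF closed_walksD(3) nth_mem])

text \<open>An orbit that starts in \<open>P\<close> stays at endpoints of gaps, and there
  \<open>endpoint_step_unique\<close> dictates the next vertex; both walks begin at
  \<open>b\<close>.\<close>

lemma closed_walks_endpoint_unique:
  assumes w: "w \<in> closed_walks f P b" "w' \<in> closed_walks f P b" "length w = length w'"
    and e: "e \<in> P" "e \<in> walk_set f w" "e \<in> walk_set f w'"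
  shows "w = w'"
proof (rule nth_equalityI[OF w(3)])
  fix i assume "i < length w"
  then show "w ! i = w' ! i"
  proof (induction i)
    case 0
    then show ?case
      using closed_walksD(1,2)[OF w(1)] closed_walksD(1,2)[OF w(2)] by (simp add: hd_conv_nth[symmetric])
  next
    case (Suc i)
    let ?A = "w ! i"
    have A: "?A = w' ! i" using Suc by simp
    have i: "Suc i < length w" "Suc i < length w'" using Suc w(3) by auto
    show ?case
    proof (rule endpoint_step_unique[of ?A _ _ "(f ^^ i) e"])
      show "?A \<in> vertices f P" "w ! Suc i \<in> vertices f P" "w' ! Suc i \<in> vertices f P"
        using closed_walks_vertex[OF w(1)] closed_walks_vertex[OF w(2)] i by simp_all
      show "covers f ?A (w ! Suc i)" using closed_walksD(5)[OF w(1) i(1)] .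
      show "covers f ?A (w' ! Suc i)" using closed_walksD(5)[OF w(2) i(2)] unfolding A .
      show "(f ^^ i) e \<in> P" using e(1) by (rule funpow_P)
      show "(f ^^ i) e \<in> {fst ?A..snd ?A}" using e(2) i by (simp add: walk_set_def)
      have "(f ^^ Suc i) e \<in> {fst (w ! Suc i)..snd (w ! Suc i)}" using e(2) i by (simp only: walk_set_def mem_Collect_eq)
      then show "f ((f ^^ i) e) \<in> {fst (w ! Suc i)..snd (w ! Suc i)}" by simp
      have "(f ^^ Suc i) e \<in> {fst (w' ! Suc i)..snd (w' ! Suc i)}" using e(3) i by (simp only: walk_set_def mem_Collect_eq)
      then show "f ((f ^^ i) e) \<in> {fst (w' ! Suc i)..snd (w' ! Suc i)}" by simp
    qed
  qed
qed

lemma closed_walks_append: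
  assumes u: "u \<in> closed_walks f P b" and v: "v \<in> closed_walks f P b"
  shows "u @ v \<in> closed_walks f P b"
proof -
  have ne: "u \<noteq> []" "v \<noteq> []" "hd u = b" "hd v = b" "covers f (last u) b" "covers f (last v) b"
    "set u \<subseteq> vertices f P" "set v \<subseteq> vertices f P"
    using closed_walksD(1-4)[OF u] closed_walksD(1-4)[OF v] by simp_all
  have "covers f ((u @ v) ! i) ((u @ v) ! Suc i)" if i: "Suc i < length (u @ v)" for i
  proof -
    consider "Suc i < length u" | "Suc i = length u" | "Suc i > length u" by linarith
    then show ?thesis
    proof cases
      case 1
      then show ?thesis using closed_walksD(5)[OF u 1] by (simp add: nth_append)
    next
      case 2
      then have "i = length u - 1" "i < length u" by simp_all
      then have "(u @ v) ! i = last u" "(u @ v) ! Suc i = hd v"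
        using ne(1,2) 2 by (simp_all add: nth_append last_conv_nth hd_conv_nth)
      then show ?thesis using ne(4,5) by simp
    next
      case 3
      then have "covers f (v ! (i - length u)) (v ! Suc (i - length u))"
        using i by (intro closed_walksD(5)[OF v]) auto
      then show ?thesis using 3 by (simp add: nth_append Suc_diff_le)
    qed
  qed
  then show ?thesis unfolding closed_walks_def using ne by simp
qed

lemma finite_closed_walks_level: "finite {w \<in> closed_walks f P b. length w = n}"
  by (rule finite_subset[OF _ finite_lists_length_eq[OF finite_letters, of n]])
    (auto simp: closed_walks_def)

text \<open>A point of \<open>P\<close> that follows a closed walk at \<open>b\<close> is one of the
  two endpoints of \<open>b\<close>, and each of these follows at most one such walk of a given
  length. Among three walks, one is free of both.\<close>

lemma clean_closed_walk:
  assumes "card {w \<in> closed_walks f P b. length w = n} \<ge> 3" "b \<in> vertices f P"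
  obtains v where "v \<in> closed_walks f P b" "walk_set f v \<inter> P = {}"
proof -
  let ?W = "{w \<in> closed_walks f P b. length w = n}"
  define bad where "bad e = {w \<in> ?W. e \<in> walk_set f w}" for e
  have bad: "card (bad e) \<le> 1" if "e \<in> P" for e
  proof -
    have fin: "finite (bad e)"
      by (rule finite_subset[OF _ finite_closed_walks_level[of b n]]) (auto simp: bad_def)
    have "\<forall>w\<in>bad e. \<forall>w'\<in>bad e. w = w'"
      using closed_walks_endpoint_unique[of _ b _ e] that by (simp add: bad_def)
    then show ?thesis unfolding One_nat_def card_le_Suc0_iff_eq[OF fin] .
  qed
  have b: "fst b \<in> P" "snd b \<in> P" "{fst b<..<snd b} \<inter> P = {}" using assms(2) by (auto simp: vertices_def)
  have "card (bad (fst b) \<union> bad (snd b)) \<le> 2"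
    using card_Un_le[of "bad (fst b)" "bad (snd b)"] bad[OF b(1)] bad[OF b(2)] by linarith
  moreover have "finite (bad (fst b) \<union> bad (snd b))"
    by (rule finite_subset[OF _ finite_closed_walks_level[of b n]]) (auto simp: bad_def)
  ultimately have "\<not> ?W \<subseteq> bad (fst b) \<union> bad (snd b)"
    using assms(1) card_mono[of "bad (fst b) \<union> bad (snd b)" ?W] by linarith
  then obtain v where v: "v \<in> closed_walks f P b" "fst b \<notin> walk_set f v" "snd b \<notin> walk_set f v"
    by (auto simp: bad_def)
  have "walk_set f v \<inter> P = {}"
  proof (rule ccontr)
    assume "walk_set f v \<inter> P \<noteq> {}"
    then obtain x where x: "x \<in> walk_set f v" "x \<in> P" by blast
    have "v \<noteq> []" "v ! 0 = b" using closed_walksD(1,2)[OF v(1)] by (simp_all add: hd_conv_nth[symmetric])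
    then have "x \<in> {fst b..snd b}" using x(1) unfolding walk_set_def by force
    then have "x = fst b \<or> x = snd b" using x(2) b(3) by (auto simp: disjoint_iff less_le)
    then show False using x v by blast
  qed
  then show ?thesis using that v by blast
qed

text \<open>Distinct closed walks may share points of \<open>P\<close> and their preimages. Ending all symbols with
  one fixed walk that avoids \<open>P\<close> makes the coded sets disjoint.\<close>

lemma disjoint_symbols:
  fixes \<alpha> \<beta> :: real
  assumes heavy: "\<not> light (exp (- \<alpha>)) (closed_walks f P b)" and b: "b \<in> vertices f P"
    and \<beta>: "0 \<le> \<beta>" "\<beta> < \<alpha>"
  obtains L S where "L > 0" "finite S" "S \<subseteq> {w \<in> closed_walks f P b. length w = L}"
    "\<And>s x. s \<in> S \<Longrightarrow> x \<in> walk_set f s \<Longrightarrow> x \<notin> P"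
    "\<And>s s' x. s \<in> S \<Longrightarrow> s' \<in> S \<Longrightarrow> x \<in> walk_set f s \<Longrightarrow> x \<in> walk_set f s' \<Longrightarrow> s = s'"
    "card S \<ge> exp (\<beta> * L) + L + 2"
proof -
  obtain n0 where n0: "card {w \<in> closed_walks f P b. length w = n0} \<ge> 0 * exp (\<beta> * n0) + 3"
    by (rule many_words_exp[OF heavy finite_closed_walks_level \<beta>(2,1), of 0 0 3])
  then have "card {w \<in> closed_walks f P b. length w = n0} \<ge> 3" by simp
  then obtain v where v: "v \<in> closed_walks f P b" "walk_set f v \<inter> P = {}"
    by (rule clean_closed_walk[OF _ b])
  define m where "m = length v"
  define \<gamma> where "\<gamma> = (\<alpha> + \<beta>) / 2"
  have g: "\<beta> < \<gamma>" "\<gamma> < \<alpha>" "0 \<le> \<gamma>" using \<beta> by (auto simp: \<gamma>_def)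
  \<comment> \<open>Multiplied by \<open>exp (\<gamma> * n)\<close>, the three summands pay for
    \<open>exp (\<beta> * (n + m))\<close>, for \<open>m + 2\<close> and for \<open>n\<close>; the
    last one uses \<open>exp (\<gamma> * n) \<ge> (\<gamma> - \<beta>) * n\<close>.\<close>
  define C where "C = exp (\<beta> * m) + (m + 2) + 1 / (\<gamma> - \<beta>)"
  obtain n where n: "card {w \<in> closed_walks f P b. length w = n} \<ge> C * exp (\<gamma> * n) + 0" "n > 0"
    by (rule many_words_exp[OF heavy finite_closed_walks_level g(2,3), of 0 C 0])
  define W where "W = {w \<in> closed_walks f P b. length w = n}"
  define S where "S = (\<lambda>w. w @ v) ` W"
  have cardS: "card S = card W" unfolding S_def by (rule card_image) (auto simp: inj_on_def)
  have "C * exp (\<gamma> * n) \<ge> exp (\<beta> * (n + m)) + (n + m) + 2"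
  proof -
    have e1: "exp (\<gamma> * n) \<ge> exp (\<beta> * n)" using g by (simp add: mult_right_mono)
    have e2: "exp (\<gamma> * n) \<ge> 1" using g by simp
    have "exp (\<gamma> * n) \<ge> 1 + \<gamma> * n" by (rule exp_ge_add_one_self)
    moreover have "0 \<le> \<beta> * n" using \<beta> by simp
    moreover have "(\<gamma> - \<beta>) * n = \<gamma> * n - \<beta> * n" by (simp add: left_diff_distrib)
    ultimately have e3: "exp (\<gamma> * n) \<ge> (\<gamma> - \<beta>) * n" by linarith
    have "exp (\<beta> * m) * exp (\<gamma> * n) \<ge> exp (\<beta> * (n + m))"
      using mult_left_mono[OF e1, of "exp (\<beta> * m)"] by (simp add: exp_add[symmetric] algebra_simps)
    moreover have "(m + 2) * exp (\<gamma> * n) \<ge> m + 2" using mult_left_mono[OF e2, of "m + 2"] by simp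
    moreover have "1 / (\<gamma> - \<beta>) * exp (\<gamma> * n) \<ge> n" using e3 g by (simp add: field_simps)
    ultimately show ?thesis by (simp add: C_def distrib_right)
  qed
  then have big: "card S \<ge> exp (\<beta> * (n + m)) + (n + m) + 2" using n(1) cardS by (simp add: W_def)
  \<comment> \<open>At time \<open>n\<close> the orbit enters \<open>v\<close> off \<open>P\<close>.
    As \<open>P\<close> is invariant, it was off \<open>P\<close> at all earlier times, where the
    gap containing it is unique.\<close>
  have points: "x \<in> walk_set f w \<and> (f ^^ n) x \<notin> P" if "w \<in> W" "x \<in> walk_set f (w @ v)" for w x
  proof -
    have "length w = n" using that(1) by (simp add: W_def)
    then show ?thesis using that(2) v(2) by (auto simp: walk_set_append)
  qed
  have offP: "(f ^^ j) x \<notin> P" if "(f ^^ n) x \<notin> P" "j \<le> n" for x j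
  proof
    assume "(f ^^ j) x \<in> P"
    then have "(f ^^ (n - j)) ((f ^^ j) x) \<in> P" by (rule funpow_P)
    then have "(f ^^ (n - j + j)) x \<in> P" by (simp only: funpow_add o_apply)
    then show False using that by simp
  qed
  show ?thesis
  proof (rule that[of "n + m" S])
    show "finite S" using finite_closed_walks_level by (simp add: S_def W_def)
    show "S \<subseteq> {w \<in> closed_walks f P b. length w = n + m}"
      using closed_walks_append[OF _ v(1)] by (auto simp: S_def W_def m_def)
    show "x \<notin> P" if sx: "s \<in> S" "x \<in> walk_set f s" for s x
    proof -
      obtain w where "w \<in> W" "s = w @ v" using sx(1) by (auto simp: S_def)
      then show ?thesis using points[of w x] offP[of x 0] sx(2) by simp
    qed
    show "s = s'" if s: "s \<in> S" "s' \<in> S" "x \<in> walk_set f s" "x \<in> walk_set f s'" for s s' x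
    proof -
      obtain w w' where w: "w \<in> W" "s = w @ v" "w' \<in> W" "s' = w' @ v" using s by (auto simp: S_def)
      have x: "x \<in> walk_set f w" "x \<in> walk_set f w'" "(f ^^ n) x \<notin> P"
        using points[OF w(1), of x] points[OF w(3), of x] s(3,4) unfolding w(2,4) by simp_all
      have len: "length w = n" "length w' = n" using w by (auto simp: W_def)
      have "w ! i = w' ! i" if i: "i < n" for i
      proof (rule vertex_unique)
        show "w ! i \<in> vertices f P" "w' ! i \<in> vertices f P"
          using closed_walks_vertex[of w b i] closed_walks_vertex[of w' b i] w i len by (simp_all add: W_def)
        show "(f ^^ i) x \<in> {fst (w ! i)..snd (w ! i)}" "(f ^^ i) x \<in> {fst (w' ! i)..snd (w' ! i)}"
          using x i len by (auto simp: walk_set_def)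
        show "(f ^^ i) x \<notin> P" using offP[OF x(3)] i by simp
      qed
      then have "w = w'" using len by (simp add: list_eq_iff_nth_eq)
      then show ?thesis using w by simp
    qed
  qed (use n big in auto)
qed

end

section \<open>Irregular codes\<close>

text \<open>The forced positions have density at most \<open>3 / R\<close>, so they cost little entropy, but they stop
  for stretches so long that averages over them diverge.\<close>

definition forced :: "nat \<Rightarrow> nat \<Rightarrow> bool" where
  "forced R j \<longleftrightarrow> j mod R < 3 \<and> (\<exists>k. fact (2 * k) \<le> j \<and> j < fact (2 * k + 1))"

section \<open>Counting forced positions\<close>

lemma card_mod_less:
  assumes "0 < R"
  shows "card {j. j < q \<and> j mod R < 3} \<le> 3 * (q div R + 1)"
proof -
  have "{j. j < q \<and> j mod R < 3} \<subseteq> (\<lambda>(i, r). R * i + r) ` ({..q div R} \<times> {..<3})"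
  proof
    fix j assume j: "j \<in> {j. j < q \<and> j mod R < 3}"
    then have "j div R \<le> q div R" by (simp add: div_le_mono)
    then show "j \<in> (\<lambda>(i, r). R * i + r) ` ({..q div R} \<times> {..<3})"
      using j by (intro image_eqI[of _ _ "(j div R, j mod R)"]) auto
  qed
  then have "card {j. j < q \<and> j mod R < 3} \<le> card ({..q div R} \<times> {..<3 :: nat})"
    by (meson card_image_le card_mono finite_SigmaI finite_atMost finite_imageI finite_lessThan le_trans)
  then show ?thesis by (simp add: mult.commute)
qed

lemma card_forced_le:
  assumes "0 < R"
  shows "card {j. j < q \<and> forced R j} \<le> 3 * (q div R + 1)"
proof -
  have "card {j. j < q \<and> forced R j} \<le> card {j. j < q \<and> j mod R < 3}"
    by (rule card_mono) (auto simp: forced_def)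
  then show ?thesis using card_mod_less[OF assms, of q] by linarith
qed

lemma not_forced:
  assumes "fact (2 * k + 1) \<le> j" "j < fact (2 * k + 2)"
  shows "\<not> forced R j"
proof
  assume "forced R j"
  then obtain i where i: "fact (2 * i) \<le> j" "j < fact (2 * i + 1)" by (auto simp: forced_def)
  show False
  proof (cases "i \<le> k")
    case True
    then have "fact (2 * i + 1) \<le> (fact (2 * k + 1) :: nat)" by (intro fact_mono_nat) simp
    then show False using i assms by linarith
  next
    case False
    then have "fact (2 * k + 2) \<le> (fact (2 * i) :: nat)" by (intro fact_mono_nat) simp
    then show False using i assms by linarith
  qed
qed

text \<open>The stretch from \<open>fact (2 * k + 1)\<close> to \<open>fact (2 * k + 2)\<close> is
  free, and what precedes it is only the fraction \<open>1 / (2 * k + 2)\<close> of the whole. The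
  extra 1 is the last \<open>l\<close>, whose successor already belongs to the next stretch.\<close>

lemma card_forced_sparse:
  "card {l. l < fact (2 * k + 2) \<and> forced R (Suc l)} \<le> fact (2 * k + 1) + 1"
proof -
  have "{l. l < fact (2 * k + 2) \<and> forced R (Suc l)} \<subseteq> {..<fact (2 * k + 1)} \<union> {fact (2 * k + 2) - 1}"
  proof
    fix l assume "l \<in> {l. l < fact (2 * k + 2) \<and> forced R (Suc l)}"
    then have "Suc l < fact (2 * k + 1) \<or> Suc l = fact (2 * k + 2)"
      using not_forced[of k "Suc l" R] by force
    then show "l \<in> {..<fact (2 * k + 1)} \<union> {fact (2 * k + 2) - 1}" by auto
  qed
  from card_mono[OF _ this] have "card {l. l < fact (2 * k + 2) \<and> forced R (Suc l)}
      \<le> card ({..<fact (2 * k + 1)} \<union> {fact (2 * k + 2) - 1 :: nat})" by blast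
  also have "\<dots> \<le> fact (2 * k + 1) + 1"
    using card_Un_le[of "{..<fact (2 * k + 1)}" "{fact (2 * k + 2) - 1 :: nat}"] by simp
  finally show ?thesis .
qed

text \<open>\<open>R\<close> divides \<open>fact (2 * k)\<close>, so the forced stretch consists of
  \<open>q\<close> whole periods, each opening with three forced positions in a row. The stretch
  fills at least half of the first \<open>fact (2 * k + 1)\<close> positions, whence the factor
  2.\<close>

lemma card_forced_dense:
  assumes R: "3 \<le> R" "R \<le> 2 * k"
  shows "fact (2 * k + 1) \<le> 2 * R * card {l. l < fact (2 * k + 1) \<and> forced R l \<and> forced R (Suc l) \<and> forced R (Suc (Suc l))}"
proof -
  let ?A = "{l. l < fact (2 * k + 1) \<and> forced R l \<and> forced R (Suc l) \<and> forced R (Suc (Suc l))}"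
  have dv: "R dvd fact (2 * k)" using R by (intro dvd_fact) auto
  then obtain c where c: "fact (2 * k) = R * c" by (auto elim: dvdE)
  have fact: "fact (2 * k + 1) = R * (c * (2 * k + 1))" using c by (simp add: algebra_simps)
  define q where "q = c * (2 * k)"
  have "(\<lambda>m. R * (c + m)) ` {..<q} \<subseteq> ?A"
  proof (rule image_subsetI)
    fix m assume "m \<in> {..<q}"
    then have "m + 1 \<le> q" by simp
    then have "R * (c + (m + 1)) \<le> R * (c + q)" by (intro mult_le_mono) auto
    also have "\<dots> = fact (2 * k + 1)" unfolding fact q_def by (simp add: algebra_simps)
    finally have up: "R * (c + m) + R \<le> fact (2 * k + 1)" by (simp add: algebra_simps)
    have low: "fact (2 * k) \<le> R * (c + m)" unfolding c by simp
    have "forced R (R * (c + m) + i)" if "i < 3" for i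
      unfolding forced_def
    proof (intro conjI exI[of _ k])
      show "(R * (c + m) + i) mod R < 3" using that R by simp
    qed (use low up that R in auto)
    from this[of 0] this[of 1] this[of 2] show "R * (c + m) \<in> ?A" using up R by (simp add: numeral_2_eq_2)
  qed
  moreover have "inj_on (\<lambda>m. R * (c + m)) {..<q}" using R by (auto simp: inj_on_def)
  ultimately have "card {..<q} \<le> card ?A" by (intro card_inj_on_le) auto
  then have "q \<le> card ?A" by simp
  then have "2 * R * q \<le> 2 * R * card ?A" by simp
  moreover have "fact (2 * k + 1) \<le> 2 * R * q"
  proof -
    have "2 * k + 1 \<le> 2 * (2 * k)" using R by simp
    then have "R * (c * (2 * k + 1)) \<le> R * (c * (2 * (2 * k)))" by (intro mult_le_mono le_refl)
    also have "\<dots> = 2 * R * q" unfolding q_def by (simp add: algebra_simps)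
    finally show ?thesis using fact by simp
  qed
  ultimately show ?thesis by linarith
qed

lemma sum_blocks:
  fixes g :: "nat \<Rightarrow> real"
  shows "(\<Sum>i<L * M. g i) = (\<Sum>l<M. \<Sum>r<L. g (L * l + r))"
proof -
  have "(\<Sum>r<L. g (L * l + r)) = sum g {l * L..<l * L + L}" for l
    by (rule sum.reindex_bij_witness[of _ "\<lambda>i. i - L * l" "\<lambda>r. L * l + r"]) (auto simp: mult.commute)
  then show ?thesis by (simp add: sum.nat_group mult.commute)
qed

text \<open>At the times \<open>L * fact (2 * k + 2)\<close> the averages tend to 0, while at the
  times \<open>L * fact (2 * k + 1)\<close> they are at least \<open>1 / (2 * R * L)\<close> once
  \<open>R \<le> 2 * k\<close>: factorials make each stretch outweigh all earlier ones.\<close>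

lemma divergent_averages:
  fixes g :: "nat \<Rightarrow> real"
  assumes L: "0 < L" and R: "3 \<le> R" and g: "\<And>i. 0 \<le> g i" "\<And>i. g i \<le> 1"
    and free: "\<And>l r. r < L \<Longrightarrow> \<not> forced R (Suc l) \<Longrightarrow> g (L * l + r) = 0"
    and forced: "\<And>l. forced R l \<Longrightarrow> forced R (Suc l) \<Longrightarrow> forced R (Suc (Suc l)) \<Longrightarrow> g (L * l) = 1"
  shows "\<not> convergent (\<lambda>n. (1 / real n) * (\<Sum>i<n. g i))"
proof
  define A where "A = (\<lambda>n. (1 / real n) * (\<Sum>i<n. g i))"
  assume "convergent (\<lambda>n. (1 / real n) * (\<Sum>i<n. g i))"
  then have "convergent A" unfolding A_def .
  then obtain c where c: "A \<longlonglongrightarrow> c" unfolding convergent_def by blast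
  have upper: "A (L * fact (2 * k + 2)) \<le> 2 / (2 * k + 2)" for k
  proof -
    let ?M = "fact (2 * k + 2) :: nat"
    have "(\<Sum>r<L. g (L * l + r)) \<le> (if forced R (Suc l) then real L else 0)" for l
      using sum_bounded_above[of "{..<L}" "\<lambda>r. g (L * l + r)" 1] g free by auto
    then have "(\<Sum>i<L * ?M. g i) \<le> (\<Sum>l<?M. if forced R (Suc l) then real L else 0)"
      unfolding sum_blocks by (rule sum_mono)
    also have "\<dots> = real L * real (card {l. l < ?M \<and> forced R (Suc l)})"
      by (simp add: sum.If_cases Int_def)
    also have "\<dots> \<le> real L * real (fact (2 * k + 1) + 1)"
    proof (rule mult_left_mono)
      show "real (card {l. l < ?M \<and> forced R (Suc l)}) \<le> real (fact (2 * k + 1) + 1)"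
        using card_forced_sparse[of k R] by (simp only: of_nat_le_iff)
    qed simp
    also have "\<dots> \<le> real L * (2 * fact (2 * k + 1))"
    proof (rule mult_left_mono)
      show "real (fact (2 * k + 1) + 1) \<le> 2 * fact (2 * k + 1)"
        using fact_ge_1[of "2 * k + 1", where 'a = real] by (simp del: fact_Suc)
    qed simp
    finally have sum: "(\<Sum>i<L * ?M. g i) \<le> real L * (2 * fact (2 * k + 1))" .
    have "A (L * ?M) \<le> 1 / real (L * ?M) * (real L * (2 * fact (2 * k + 1)))"
      unfolding A_def by (rule mult_left_mono[OF sum]) simp
    also have "\<dots> = 2 * fact (2 * k + 1) / real ?M" using L by (simp del: fact_Suc of_nat_fact)
    also have "\<dots> = 2 * fact (2 * k + 1) / ((2 * real k + 2) * fact (2 * k + 1))"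
      by (simp add: algebra_simps)
    also have "\<dots> = 2 / (2 * real k + 2)" by (simp del: fact_Suc)
    finally show ?thesis by simp
  qed
  have lower: "A (L * fact (2 * k + 1)) \<ge> 1 / (2 * R * L)" if "R \<le> 2 * k" for k
  proof -
    let ?M = "fact (2 * k + 1) :: nat"
    let ?F = "\<lambda>l. forced R l \<and> forced R (Suc l) \<and> forced R (Suc (Suc l))"
    have "(if ?F l then 1 else 0) \<le> (\<Sum>r<L. g (L * l + r))" for l
    proof (cases "?F l")
      case True
      then have "g (L * l + 0) = 1" using forced by simp
      moreover have "g (L * l + 0) \<le> (\<Sum>r<L. g (L * l + r))"
        by (rule member_le_sum[of 0 "{..<L}" "\<lambda>r. g (L * l + r)"]) (use L g in auto)
      ultimately show ?thesis using True by simp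
    qed (auto intro: sum_nonneg g)
    then have "(\<Sum>l<?M. if ?F l then 1 else 0) \<le> (\<Sum>i<L * ?M. g i)"
      unfolding sum_blocks by (rule sum_mono)
    moreover have "(\<Sum>l<?M. if ?F l then 1 else 0 :: real) = card {l. l < ?M \<and> ?F l}"
      by (simp add: sum.If_cases Int_def)
    ultimately have "card {l. l < ?M \<and> ?F l} \<le> (\<Sum>i<L * ?M. g i)" by simp
    then have "real (2 * R) * card {l. l < ?M \<and> ?F l} \<le> real (2 * R) * (\<Sum>i<L * ?M. g i)"
      by (rule mult_left_mono) simp
    moreover have "real ?M \<le> real (2 * R * card {l. l < ?M \<and> ?F l})"
      using card_forced_dense[OF R that] by (simp only: of_nat_le_iff)
    ultimately have "real ?M \<le> real (2 * R) * (\<Sum>i<L * ?M. g i)"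
      by (simp only: of_nat_mult)
    then have "real ?M / (real ?M * real (2 * R * L)) \<le> real (2 * R) * (\<Sum>i<L * ?M. g i) / (real ?M * real (2 * R * L))"
      by (rule divide_right_mono) simp
    moreover have "real ?M / (real ?M * real (2 * R * L)) = 1 / (2 * R * L)" by (simp del: fact_Suc of_nat_fact)
    moreover have "real (2 * R) * (\<Sum>i<L * ?M. g i) / (real ?M * real (2 * R * L)) = A (L * ?M)"
      using R by (simp add: A_def del: fact_Suc of_nat_fact)
    ultimately show ?thesis by simp
  qed
  have sub1: "strict_mono (\<lambda>k. L * fact (2 * k + 2))"
  proof (rule strict_monoI)
    fix i j :: nat assume "i < j"
    then have "fact (2 * i + 2) < (fact (2 * j + 2) :: nat)" by (intro fact_less_mono_nat) auto
    then show "L * fact (2 * i + 2) < L * fact (2 * j + 2)" using L by (rule mult_less_mono2)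
  qed
  have sub2: "strict_mono (\<lambda>k. L * fact (2 * k + 1))"
  proof (rule strict_monoI)
    fix i j :: nat assume "i < j"
    then have "fact (2 * i + 1) < (fact (2 * j + 1) :: nat)" by (intro fact_less_mono_nat) auto
    then show "L * fact (2 * i + 1) < L * fact (2 * j + 1)" using L by (rule mult_less_mono2)
  qed
  have "(\<lambda>k. A (L * fact (2 * k + 2))) \<longlonglongrightarrow> c"
    using LIMSEQ_subseq_LIMSEQ[OF c sub1] unfolding o_def .
  moreover have "(\<lambda>k. 2 / (2 * real k + 2)) \<longlonglongrightarrow> 0" by real_asymp
  ultimately have "c \<le> 0"
  proof (rule LIMSEQ_le)
    show "\<exists>N. \<forall>k\<ge>N. A (L * fact (2 * k + 2)) \<le> 2 / (2 * real k + 2)" using upper by blast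
  qed
  moreover have "(\<lambda>k. A (L * fact (2 * k + 1))) \<longlonglongrightarrow> c"
    using LIMSEQ_subseq_LIMSEQ[OF c sub2] unfolding o_def .
  then have "1 / (2 * R * L) \<le> c"
  proof (rule LIMSEQ_le_const)
    show "\<exists>N. \<forall>k\<ge>N. 1 / (2 * R * L) \<le> A (L * fact (2 * k + 1))"
      using lower by (intro exI[of _ R] allI impI) simp
  qed
  moreover have "0 < 1 / real (2 * R * L)" using L R by simp
  ultimately show False by linarith
qed

section \<open>Irregular points from codes\<close>

locale symbol_coding = finite_invariant +
  fixes b :: "real \<times> real" and L :: nat and S :: "(real \<times> real) list set"
  assumes L_pos: "L > 0" and finite_S: "finite S"
    and symbols: "S \<subseteq> {w \<in> closed_walks f P b. length w = L}"
    and symbol_avoids: "s \<in> S \<Longrightarrow> x \<in> walk_set f s \<Longrightarrow> x \<notin> P"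
    and symbol_unique: "s \<in> S \<Longrightarrow> s' \<in> S \<Longrightarrow> x \<in> walk_set f s \<Longrightarrow> x \<in> walk_set f s' \<Longrightarrow> s = s'"
begin

lemma symbolD:
  assumes "s \<in> S"
  shows "s \<in> closed_walks f P b" "length s = L" "set s \<subseteq> vertices f P" "s \<noteq> []"
proof -
  show s: "s \<in> closed_walks f P b" "length s = L" using symbols assms by auto
  show "set s \<subseteq> vertices f P" "s \<noteq> []" using closed_walksD[OF s(1)] by simp_all
qed

text \<open>Symbols can follow each other in any order, because the last vertex of each covers
  \<open>b\<close>, with which every symbol begins.\<close>

lemma code_realized:
  assumes \<omega>: "\<And>l. \<omega> l \<in> S"
  obtains x where "\<And>l. (f ^^ (L * l)) x \<in> walk_set f (\<omega> l)"
proof -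
  define \<beta> where "\<beta> i = \<omega> (i div L) ! (i mod L)" for i
  have V: "\<beta> i \<in> vertices f P" for i
    unfolding \<beta>_def by (rule closed_walks_vertex[OF symbolD(1)[OF \<omega>]]) (simp add: symbolD(2)[OF \<omega>] L_pos)
  have E: "covers f (\<beta> i) (\<beta> (Suc i))" for i
  proof (cases "Suc (i mod L) < L")
    case True
    then have "Suc i div L = i div L" "Suc i mod L = Suc (i mod L)"
      using L_pos by (auto simp: div_Suc mod_Suc)
    then show ?thesis using closed_walksD(5)[OF symbolD(1)[OF \<omega>]] True symbolD(2)[OF \<omega>] by (simp add: \<beta>_def)
  next
    case False
    then have i: "i mod L = L - 1" using L_pos mod_less_divisor[OF L_pos, of i] by linarith
    then have "Suc i div L = Suc (i div L)" "Suc i mod L = 0"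
      using L_pos by (auto simp: div_Suc mod_Suc)
    moreover have "\<omega> (i div L) ! (L - 1) = last (\<omega> (i div L))"
      using symbolD(2,4)[OF \<omega>] by (simp add: last_conv_nth)
    moreover have "\<omega> (Suc (i div L)) ! 0 = b"
      using closed_walksD(1,2)[OF symbolD(1)[OF \<omega>[of "Suc (i div L)"]]] by (simp add: hd_conv_nth[symmetric])
    ultimately show ?thesis
      using closed_walksD(4)[OF symbolD(1)[OF \<omega>[of "i div L"]]] i by (simp add: \<beta>_def)
  qed
  obtain x where x: "\<And>i. (f ^^ i) x \<in> {fst (\<beta> i)..snd (\<beta> i)}"
    using infinite_walk_realized[of \<beta>, OF V E] by blast
  have "(f ^^ (L * l)) x \<in> walk_set f (\<omega> l)" for l
    unfolding walk_set_def
  proof (intro CollectI allI impI)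
    fix j assume "j < length (\<omega> l)"
    then have "j < L" using symbolD(2)[OF \<omega>] by simp
    then have "\<beta> (j + L * l) = \<omega> l ! j" by (simp add: \<beta>_def)
    then show "(f ^^ j) ((f ^^ (L * l)) x) \<in> {fst (\<omega> l ! j)..snd (\<omega> l ! j)}"
      using x[of "j + L * l"] by (simp add: funpow_add)
  qed
  then show ?thesis using that by blast
qed

lemma not_P_before: "(f ^^ n) x \<notin> P \<Longrightarrow> j \<le> n \<Longrightarrow> (f ^^ j) x \<notin> P"
proof
  assume "(f ^^ n) x \<notin> P" "j \<le> n" "(f ^^ j) x \<in> P"
  then have "(f ^^ (n - j)) ((f ^^ j) x) \<in> P" using funpow_P by blast
  then have "(f ^^ (n - j + j)) x \<in> P" by (simp only: funpow_add o_apply)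
  then show False using \<open>(f ^^ n) x \<notin> P\<close> \<open>j \<le> n\<close> by simp
qed

text \<open>The range includes \<open>L\<close> because \<open>period_window\<close> rotates by
  \<open>L - r\<close> with \<open>r < L\<close>.\<close>

definition rotations :: "(real \<times> real) list \<Rightarrow> (real \<times> real) list set" where
  "rotations w = (\<lambda>r. rotate r w) ` {..L}"

text \<open>A window of period \<open>L\<close> and length \<open>2 * L\<close> inside a concatenation of symbols contains a
  complete symbol, which is then a rotation of the period.\<close>

lemma period_window:
  assumes S: "w \<in> S" "s \<in> S" "s' \<in> S" "s'' \<in> S" and r: "r < L"
    and z: "z \<in> walk_set f (s @ s' @ s'')" and y: "(f ^^ r) z \<in> walk_set f (w @ w @ w)"
  shows "s' \<in> rotations w"
proof -
  let ?y = "(f ^^ r) z"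
  note len = symbolD(2)[OF S(1)] symbolD(2)[OF S(2)] symbolD(2)[OF S(3)] symbolD(2)[OF S(4)]
  \<comment> \<open>The third copy of \<open>w\<close> keeps the orbit off \<open>P\<close> during
    the first two, so that the gaps visited there are determined by the orbit alone.\<close>
  have "(f ^^ (L + L)) ?y \<in> walk_set f w"
    using y by (simp add: walk_set_append len funpow_add)
  then have "(f ^^ (L + L)) ?y \<notin> P" using symbol_avoids S(1) by blast
  then have off: "(f ^^ j) ?y \<notin> P" if "j \<le> L + L" for j using not_P_before that by blast
  have "s' = rotate (L - r) w"
  proof (rule nth_equalityI)
    show "length s' = length (rotate (L - r) w)" by (simp add: len)
    fix i assume "i < length s'"
    then have i: "i < L" by (simp add: len)
    define j where "j = L - r + i"
    have j: "j < L + L" "j + r = L + i" using i r by (auto simp: j_def)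
    let ?u = "(s @ s' @ s'') ! (L + i)" and ?v = "(w @ w @ w) ! j"
    have u: "?u = s' ! i" using i by (simp add: nth_append len)
    have v: "?v = w ! (j mod L)"
    proof (cases "j < L")
      case True
      then show ?thesis by (simp add: nth_append len)
    next
      case False
      then have "j mod L = j - L" using j by (simp add: mod_if)
      then show ?thesis using False j by (simp add: nth_append len)
    qed
    have "?u = ?v"
    proof (rule vertex_unique)
      show "?u \<in> vertices f P" unfolding u using closed_walks_vertex[OF symbolD(1)[OF S(3)]] i by (simp add: len)
      show "?v \<in> vertices f P" unfolding v using closed_walks_vertex[OF symbolD(1)[OF S(1)]] L_pos by (simp add: len)
      have "(f ^^ (L + i)) z \<in> {fst ?u..snd ?u}"
        using z i len unfolding walk_set_def mem_Collect_eq by (elim allE[of _ "L + i"]) simp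
      moreover have "(f ^^ j) ?y = (f ^^ (j + r)) z" by (simp add: funpow_add)
      ultimately show "(f ^^ j) ?y \<in> {fst ?u..snd ?u}" using j by simp
      show "(f ^^ j) ?y \<in> {fst ?v..snd ?v}"
        using y j len unfolding walk_set_def mem_Collect_eq by (elim allE[of _ j]) simp
      show "(f ^^ j) ?y \<notin> P" using off j by simp
    qed
    then have "s' ! i = w ! (j mod L)" using u v by simp
    also have "\<dots> = rotate (L - r) w ! i" using i by (simp add: nth_rotate len j_def)
    finally show "s' ! i = rotate (L - r) w ! i" .
  qed
  then show ?thesis unfolding rotations_def by auto
qed

text \<open>\<open>D\<close> collects the points that follow \<open>w w w\<close>, and
  \<open>Q\<close> the points reached at a phase \<open>r < L\<close> of three symbols whose middle
  one is no rotation of \<open>w\<close>. Both are compact, and disjoint by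
  \<open>period_window\<close>. A Urysohn function is then 1 where a forced triple begins and 0
  throughout any symbol that is followed by a free one.\<close>

lemma irregular_code:
  assumes w: "w \<in> S" and R: "3 \<le> R" and X: "P \<subseteq> {lo..hi}" "f ` {lo..hi} \<subseteq> {lo..hi}"
    and \<omega>: "\<And>l. \<omega> l \<in> S" "\<And>l. forced R l \<Longrightarrow> \<omega> l = w" "\<And>l. \<not> forced R l \<Longrightarrow> \<omega> l \<notin> rotations w"
    and x: "\<And>l. (f ^^ (L * l)) x \<in> walk_set f (\<omega> l)"
  shows "x \<in> irregular_set {lo..hi} f"
proof -
  define D where "D = walk_set f (w @ w @ w)"
  define Q where "Q = (\<Union>r\<in>{..<L}. \<Union>(s, s', s'')\<in>S \<times> (S - rotations w) \<times> S. (f ^^ r) ` walk_set f (s @ s' @ s''))"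
  have "compact D" unfolding D_def using symbolD[OF w] by (intro compact_walk_set) auto
  then have D: "closed D" by (rule compact_imp_closed)
  have "compact ((f ^^ r) ` walk_set f (s @ s' @ s''))" if "r < L" "s \<in> S" "s' \<in> S" "s'' \<in> S" for r s s' s''
  proof (rule compact_continuous_image)
    have V: "set (s @ s' @ s'') \<subseteq> vertices f P" using symbolD(3) that by simp
    show "compact (walk_set f (s @ s' @ s''))" using symbolD that by (intro compact_walk_set V) auto
    show "continuous_on (walk_set f (s @ s' @ s'')) (f ^^ r)"
      by (rule continuous_on_walk_set[OF V]) (use symbolD(2) that in simp)
  qed
  then have "compact Q"
    unfolding Q_def using finite_S by (intro compact_UN) auto
  then have Q: "closed Q" by (rule compact_imp_closed)
  have "D \<inter> Q = {}" using period_window[OF w] by (fastforce simp: D_def Q_def)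
  then obtain \<phi> :: "real \<Rightarrow> real" where \<phi>: "continuous_on UNIV \<phi>" "\<And>y. \<phi> y \<in> closed_segment 1 0"
    "\<And>y. y \<in> D \<Longrightarrow> \<phi> y = 1" "\<And>y. y \<in> Q \<Longrightarrow> \<phi> y = 0"
    using Urysohn[OF D Q, of "1 :: real" 0] by blast
  have shift: "(f ^^ L) ((f ^^ (L * l)) x) = (f ^^ (L * Suc l)) x" for l
    by (simp add: funpow_add)
  have triple: "(f ^^ (L * l)) x \<in> walk_set f (\<omega> l @ \<omega> (Suc l) @ \<omega> (Suc (Suc l)))" for l
    unfolding walk_set_append symbolD(2)[OF \<omega>(1)] shift using x by blast
  have "\<not> convergent (\<lambda>n. (1 / real n) * (\<Sum>i<n. \<phi> ((f ^^ i) x)))"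
  proof (rule divergent_averages[OF L_pos R])
    show "0 \<le> \<phi> ((f ^^ i) x)" "\<phi> ((f ^^ i) x) \<le> 1" for i
      using \<phi>(2)[of "(f ^^ i) x"] by (auto simp: closed_segment_eq_real_ivl)
    show "\<phi> ((f ^^ (L * l + r)) x) = 0" if "r < L" "\<not> forced R (Suc l)" for l r
    proof (rule \<phi>(4))
      have "(f ^^ (L * l + r)) x = (f ^^ r) ((f ^^ (L * l)) x)"
        by (simp add: add.commute[of "L * l"] funpow_add)
      then show "(f ^^ (L * l + r)) x \<in> Q"
        unfolding Q_def using triple[of l] \<omega>(1) \<omega>(3)[OF that(2)] that(1)
        by (intro UN_I[of r] UN_I[of "(\<omega> l, \<omega> (Suc l), \<omega> (Suc (Suc l)))"]) auto
    qed
    show "\<phi> ((f ^^ (L * l)) x) = 1" if "forced R l" "forced R (Suc l)" "forced R (Suc (Suc l))" for l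
      using \<phi>(3) triple[of l] \<omega>(2) that by (simp add: D_def)
  qed
  moreover have "x \<in> {lo..hi}"
  proof -
    have "\<omega> 0 ! 0 \<in> vertices f P" using closed_walks_vertex[OF symbolD(1)[OF \<omega>(1)]] symbolD(2)[OF \<omega>(1)] L_pos by simp
    moreover have "x \<in> {fst (\<omega> 0 ! 0)..snd (\<omega> 0 ! 0)}"
      using x[of 0] symbolD(2)[OF \<omega>(1)[of 0]] L_pos unfolding walk_set_def by (auto dest: spec[of _ 0])
    ultimately show ?thesis using X(1) unfolding vertices_def by fastforce
  qed
  ultimately show ?thesis
    unfolding irregular_set_def using continuous_on_subset[OF \<phi>(1)] by blast
qed

end

section \<open>Mass distribution\<close>

text \<open>Countable subadditivity for an unordered sum: finite unions along an enumeration
  increase to the whole, and each is bounded by a finite partial sum.\<close>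

lemma emeasure_UN_le_infsum:
  fixes g :: "'b \<Rightarrow> ennreal"
  assumes G: "countable G" and C: "\<And>s. s \<in> G \<Longrightarrow> C s \<in> sets M"
    and g: "\<And>s. s \<in> G \<Longrightarrow> emeasure M (C s) \<le> K * g s"
  shows "emeasure M (\<Union>s\<in>G. C s) \<le> K * (\<Sum>\<^sub>\<infinity>s\<in>G. g s)"
proof (cases "G = {}")
  case False
  define U where "U n = (\<Union>i<n. C (from_nat_into G i))" for n
  have inG: "from_nat_into G i \<in> G" for i using False by (rule from_nat_into)
  have "(\<Union>s\<in>G. C s) = (\<Union>n. U n)"
  proof
    show "(\<Union>s\<in>G. C s) \<subseteq> (\<Union>n. U n)"
    proof
      fix x assume "x \<in> (\<Union>s\<in>G. C s)"
      then obtain s where "s \<in> G" "x \<in> C s" by blast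
      then have "x \<in> U (Suc (to_nat_on G s))" using G by (auto simp: U_def intro!: bexI[of _ "to_nat_on G s"])
      then show "x \<in> (\<Union>n. U n)" by blast
    qed
  qed (use inG in \<open>auto simp: U_def\<close>)
  also have "emeasure M (\<Union>n. U n) = (SUP n. emeasure M (U n))"
  proof (rule SUP_emeasure_incseq[symmetric])
    show "range U \<subseteq> sets M" using C inG by (auto simp: U_def)
    show "incseq U" unfolding incseq_def U_def by (intro allI impI UN_mono) auto
  qed
  also have "\<dots> \<le> K * (\<Sum>\<^sub>\<infinity>s\<in>G. g s)"
  proof (rule SUP_least)
    fix n
    have "U n = (\<Union>s\<in>from_nat_into G ` {..<n}. C s)" by (auto simp: U_def)
    then have "emeasure M (U n) \<le> (\<Sum>s\<in>from_nat_into G ` {..<n}. emeasure M (C s))"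
      using C inG by (simp only:) (rule emeasure_subadditive_finite, auto)
    also have "\<dots> \<le> (\<Sum>s\<in>from_nat_into G ` {..<n}. K * g s)"
      by (rule sum_mono) (use g inG in auto)
    also have "\<dots> = K * (\<Sum>s\<in>from_nat_into G ` {..<n}. g s)" by (rule sum_distrib_left[symmetric])
    also have "\<dots> \<le> K * (\<Sum>\<^sub>\<infinity>s\<in>G. g s)"
    proof (rule mult_left_mono)
      have "(\<Sum>s\<in>from_nat_into G ` {..<n}. g s) = (\<Sum>\<^sub>\<infinity>s\<in>from_nat_into G ` {..<n}. g s)" by simp
      also have "\<dots> \<le> (\<Sum>\<^sub>\<infinity>s\<in>G. g s)"
        by (rule infsum_mono_neutral) (use inG in \<open>auto intro: nonneg_summable_on_complete\<close>)
      finally show "(\<Sum>s\<in>from_nat_into G ` {..<n}. g s) \<le> (\<Sum>\<^sub>\<infinity>s\<in>G. g s)" .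
    qed simp
    finally show "emeasure M (U n) \<le> K * (\<Sum>\<^sub>\<infinity>s\<in>G. g s)" .
  qed
  finally show ?thesis .
qed simp

lemma card_not_forced_ge:
  fixes R q :: nat
  assumes "0 < R"
  shows "(1 - 3 / R) * q - 3 \<le> real (card {l. l < q \<and> \<not> forced R l})"
proof -
  have "{l. l < q \<and> forced R l} \<union> {l. l < q \<and> \<not> forced R l} = {..<q}" by auto
  then have "card {l. l < q \<and> forced R l} + card {l. l < q \<and> \<not> forced R l} = q"
    by (subst card_Un_disjoint[symmetric]) auto
  then have "q \<le> 3 * (q div R + 1) + card {l. l < q \<and> \<not> forced R l}"
    using card_forced_le[OF assms, of q] by linarith
  then have "real q \<le> real (3 * (q div R + 1) + card {l. l < q \<and> \<not> forced R l})"
    by (simp only: of_nat_le_iff)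
  then have 1: "real q \<le> 3 * real (q div R) + 3 + real (card {l. l < q \<and> \<not> forced R l})" by simp
  have 2: "real (q div R) \<le> real q / real R" by (rule of_nat_div_le_of_nat)
  have 3: "(1 - 3 / R) * q - 3 = real q - 3 * (real q / real R) - 3" by (simp add: algebra_simps)
  show ?thesis unfolding 3 using 1 2 by linarith
qed

context symbol_coding
begin

text \<open>Finitely many disjoint compact sets have positive mutual distances; nearness at the
  times \<open>L * l\<close> therefore determines the code.\<close>

lemma symbol_gap:
  obtains \<delta> where "\<delta> > 0"
    "\<And>s s' x y. s \<in> S \<Longrightarrow> s' \<in> S \<Longrightarrow> x \<in> walk_set f s \<Longrightarrow> y \<in> walk_set f s' \<Longrightarrow> dist x y < \<delta> \<Longrightarrow> s = s'"
proof -
  have "\<exists>d>0. \<forall>x\<in>walk_set f s. \<forall>y\<in>walk_set f s'. s \<noteq> s' \<longrightarrow> d \<le> dist x y" if s: "s \<in> S" "s' \<in> S" for s s'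
  proof (cases "s = s'")
    case True
    then show ?thesis by (intro exI[of _ 1]) auto
  next
    case False
    have "compact (walk_set f s)" "closed (walk_set f s')"
      using compact_walk_set[OF symbolD(3,4)[OF s(1)]]
        compact_imp_closed[OF compact_walk_set[OF symbolD(3,4)[OF s(2)]]] .
    moreover have "walk_set f s \<inter> walk_set f s' = {}" using symbol_unique s False by blast
    ultimately show ?thesis by (meson separate_compact_closed)
  qed
  then obtain d where d: "\<And>s s'. s \<in> S \<Longrightarrow> s' \<in> S \<Longrightarrow>
      d s s' > 0 \<and> (\<forall>x\<in>walk_set f s. \<forall>y\<in>walk_set f s'. s \<noteq> s' \<longrightarrow> d s s' \<le> dist x y)" by metis
  define \<delta> where "\<delta> = Min (insert 1 ((\<lambda>(s, s'). d s s') ` (S \<times> S)))"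
  have fin: "finite (insert 1 ((\<lambda>(s, s'). d s s') ` (S \<times> S)))" using finite_S by simp
  have "\<delta> > 0" unfolding \<delta>_def using fin d by (subst Min_gr_iff) auto
  moreover have "\<delta> \<le> d s s'" if "s \<in> S" "s' \<in> S" for s s'
    unfolding \<delta>_def using fin that by (intro Min_le) auto
  ultimately have pos: "\<delta> > 0" and le: "\<And>s s'. s \<in> S \<Longrightarrow> s' \<in> S \<Longrightarrow> \<delta> \<le> d s s'" by blast+
  show ?thesis
  proof (rule that[OF pos], rule ccontr)
    fix s s' x y assume *: "s \<in> S" "s' \<in> S" "x \<in> walk_set f s" "y \<in> walk_set f s'" "dist x y < \<delta>" "s \<noteq> s'"
    then have "d s s' \<le> dist x y" using d by blast
    then show False using le[OF *(1,2)] *(5) by linarith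
  qed
qed

text \<open>Mass distribution principle for the uniform measure on the codes that are forced at the
  positions \<open>forced R\<close>.\<close>

lemma cover_entropy_irregular_ge:
  fixes R :: nat
  assumes w: "w \<in> S" and R: "4 \<le> R" and T: "2 \<le> card (S - rotations w)"
    and X: "P \<subseteq> {lo..hi}" "f ` {lo..hi} \<subseteq> {lo..hi}"
    and Y: "countable ({lo..hi} - Y)" "Y \<subseteq> {lo..hi}"
  obtains \<delta> where "\<delta> > 0"
    "\<And>\<U>. \<U> \<in> finite_open_covers Y \<Longrightarrow> (\<And>U. U \<in> \<U> \<Longrightarrow> diameter U < \<delta>) \<Longrightarrow>
      ennreal ((1 - 3 / R) * ln (card (S - rotations w)) / L)
        \<le> cover_entropy Y f (irregular_set {lo..hi} f \<inter> Y) \<U>"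
proof -
  obtain \<delta> where \<delta>: "\<delta> > 0"
    "\<And>s s' x y. s \<in> S \<Longrightarrow> s' \<in> S \<Longrightarrow> x \<in> walk_set f s \<Longrightarrow> y \<in> walk_set f s' \<Longrightarrow> dist x y < \<delta> \<Longrightarrow> s = s'"
    using symbol_gap by blast
  define t where "t = card (S - rotations w)"
  \<comment> \<open>Up to a bounded error, at least the fraction \<open>1 - 3 / R\<close> of the
    positions is free, and each free choice among \<open>t\<close> symbols takes \<open>L\<close>
    steps.\<close>
  define \<beta> where "\<beta> = (1 - 3 / R) * ln t / L"
  have t: "2 \<le> t" using T by (simp add: t_def)
  have \<beta>: "0 < \<beta>" using R t L_pos by (simp add: \<beta>_def)
  define A where "A l = (if forced R l then {w} else S - rotations w)" for l
  have A: "finite (A l)" "A l \<noteq> {}" "A l \<subseteq> S" for l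
  proof -
    have "S - rotations w \<noteq> {}" using T by (metis card.empty not_numeral_le_zero)
    then show "finite (A l)" "A l \<noteq> {}" "A l \<subseteq> S" using finite_S w by (auto simp: A_def)
  qed
  define M where "M = PiM UNIV (\<lambda>l. uniform_count_measure (A l))"
  interpret Pr: product_prob_space "\<lambda>l. uniform_count_measure (A l)" "UNIV :: nat set"
    by (intro product_prob_spaceI prob_space_uniform_count_measure A)
  have space: "\<omega> \<in> space M \<longleftrightarrow> (\<forall>l. \<omega> l \<in> A l)" for \<omega>
    by (auto simp: M_def space_PiM PiE_iff space_uniform_count_measure)
  define cyl where "cyl \<omega> q = {\<eta> \<in> space M. \<forall>l\<in>{..<q}. \<eta> l \<in> {\<omega> l}}" for \<omega> q
  have cyl_sets: "cyl \<omega> q \<in> sets M" if "\<omega> \<in> space M" for \<omega> q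
  proof -
    have "{\<eta> \<in> space M. \<eta> l \<in> {\<omega> l}} \<in> sets M" for l
      unfolding M_def using that
      by (intro sets_Collect_single) (auto simp: sets_uniform_count_measure space)
    then show ?thesis unfolding cyl_def by (intro sets.sets_Collect_finite_All) auto
  qed
  \<comment> \<open>The factor \<open>real t ^ 3\<close> absorbs the additive error 3 of
    \<open>card_not_forced_ge\<close>.\<close>
  have cyl_measure: "emeasure M (cyl \<omega> q) \<le> ennreal (real t ^ 3 * exp (- (\<beta> * (L * q))))" if "\<omega> \<in> space M" for \<omega> q
  proof -
    have "emeasure M (cyl \<omega> q) = (\<Prod>l<q. emeasure (uniform_count_measure (A l)) {\<omega> l})"
      unfolding cyl_def M_def using that
      by (intro Pr.emeasure_PiM_Collect) (auto simp: sets_uniform_count_measure space)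
    also have "\<dots> = (\<Prod>l<q. ennreal (if forced R l then 1 else 1 / t))"
      using that A(1) by (intro prod.cong) (auto simp: emeasure_uniform_count_measure space A_def t_def)
    also have "\<dots> = ennreal (\<Prod>l<q. if forced R l then 1 else 1 / t)"
      by (rule prod_ennreal) auto
    finally have eq: "emeasure M (cyl \<omega> q) = ennreal (\<Prod>l<q. if forced R l then 1 else 1 / real t)" .
    let ?n = "card {l. l < q \<and> \<not> forced R l}"
    have "(\<Prod>l<q. if forced R l then 1 else 1 / real t) = (1 / t) ^ ?n"
      by (simp add: prod.If_cases Int_def)
    also have "\<dots> = exp (- ln t) ^ ?n" using t by (simp add: exp_minus inverse_eq_divide)
    also have "\<dots> = exp (?n * (- ln t))" by (rule exp_of_nat_mult[symmetric])
    also have "\<dots> \<le> exp (3 * ln t + - (\<beta> * (L * q)))"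
    proof -
      have "\<beta> * (L * q) = (1 - 3 / R) * ln t * q" using L_pos by (simp add: \<beta>_def)
      then have 1: "ln t * ((1 - 3 / R) * q - 3) = \<beta> * (L * q) - 3 * ln t"
        by (simp add: algebra_simps)
      have "(1 - 3 / R) * q - 3 \<le> real ?n"
        using R by (intro card_not_forced_ge) simp
      then have "ln t * ((1 - 3 / R) * q - 3) \<le> ln t * ?n"
        using t by (intro mult_left_mono) auto
      then have "\<beta> * (L * q) - 3 * ln t \<le> ln t * ?n" unfolding 1 .
      then show ?thesis by (simp add: mult.commute)
    qed
    also have "\<dots> = exp (ln t) ^ 3 * exp (- (\<beta> * (L * q)))"
      unfolding exp_add using exp_of_nat_mult[of 3 "ln (real t)"] by simp
    also have "\<dots> = real t ^ 3 * exp (- (\<beta> * (L * q)))" using t by simp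
    finally show ?thesis unfolding eq by (rule ennreal_leI)
  qed
  have "\<exists>x. \<forall>l. (f ^^ (L * l)) x \<in> walk_set f (\<omega> l)" if "\<omega> \<in> space M" for \<omega>
  proof -
    have "\<omega> l \<in> S" for l using that A(3) by (auto simp: space)
    from code_realized[of \<omega>, OF this] show ?thesis by blast
  qed
  then obtain pt where pt: "\<And>\<omega> l. \<omega> \<in> space M \<Longrightarrow> (f ^^ (L * l)) (pt \<omega>) \<in> walk_set f (\<omega> l)" by metis
  have irr: "pt \<omega> \<in> irregular_set {lo..hi} f" if \<omega>: "\<omega> \<in> space M" for \<omega>
  proof (rule irregular_code[OF w _ X, of R \<omega>])
    have \<omega>A: "\<omega> l \<in> A l" for l using \<omega> by (simp add: space)
    show "\<omega> l \<in> S" for l using \<omega>A[of l] A(3)[of l] by blast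
    show "forced R l \<Longrightarrow> \<omega> l = w" for l using \<omega>A[of l] by (simp add: A_def)
    show "\<not> forced R l \<Longrightarrow> \<omega> l \<notin> rotations w" for l using \<omega>A[of l] by (simp add: A_def)
    show "3 \<le> R" using R by simp
  qed (rule pt[OF \<omega>])
  have code_unique: "\<omega> l = \<eta> l"
    if "\<omega> \<in> space M" "\<eta> \<in> space M" "dist ((f ^^ (L * l)) (pt \<omega>)) ((f ^^ (L * l)) (pt \<eta>)) < \<delta>" for \<omega> \<eta> l
    using \<delta>(2)[OF _ _ pt[OF that(1)] pt[OF that(2)] that(3)] that A(3) by (auto simp: space)
  \<comment> \<open>By \<open>code_unique\<close> at distance 0, a fibre of \<open>pt\<close>
    contains at most one code, so a nonempty fibre is an intersection of cylinders whose measures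
    tend to 0. This disposes of the codes whose point lies outside \<open>Y\<close>.\<close>
  have null: "{\<eta> \<in> space M. pt \<eta> \<in> E} \<in> null_sets M" if E: "countable E" for E
  proof -
    have "{\<eta> \<in> space M. pt \<eta> = e} \<in> null_sets M" for e
    proof (cases "\<exists>\<omega>\<in>space M. pt \<omega> = e")
      case True
      then obtain \<omega> where \<omega>: "\<omega> \<in> space M" "pt \<omega> = e" by blast
      have eq: "{\<eta> \<in> space M. pt \<eta> = e} = (\<Inter>q. cyl \<omega> q)"
      proof
        show "{\<eta> \<in> space M. pt \<eta> = e} \<subseteq> (\<Inter>q. cyl \<omega> q)"
          using code_unique[OF _ \<omega>(1)] \<omega>(2) \<delta>(1) by (auto simp: cyl_def)
        show "(\<Inter>q. cyl \<omega> q) \<subseteq> {\<eta> \<in> space M. pt \<eta> = e}"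
        proof
          fix \<eta> assume "\<eta> \<in> (\<Inter>q. cyl \<omega> q)"
          then have "\<eta> \<in> space M" "\<And>q l. l < q \<Longrightarrow> \<eta> l = \<omega> l" by (auto simp: cyl_def)
          then have "\<eta> = \<omega>" by blast
          then show "\<eta> \<in> {\<eta> \<in> space M. pt \<eta> = e}" using \<omega> by simp
        qed
      qed
      have sets: "(\<Inter>q. cyl \<omega> q) \<in> sets M" using cyl_sets[OF \<omega>(1)] by (intro sets.countable_INT) auto
      have "emeasure M (\<Inter>q. cyl \<omega> q) \<le> ennreal (real t ^ 3 * exp (- (\<beta> * (L * q))))" for q
        by (rule order_trans[OF emeasure_mono cyl_measure[OF \<omega>(1)]]) (use cyl_sets[OF \<omega>(1)] in auto)
      moreover have "(\<lambda>q. ennreal (real t ^ 3 * exp (- (\<beta> * (L * q))))) \<longlonglongrightarrow> ennreal 0"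
      proof (rule tendsto_ennrealI)
        have "0 < \<beta> * L" using \<beta> L_pos by simp
        moreover have "(\<lambda>q. K * exp (- c * real q)) \<longlonglongrightarrow> 0" if "0 < c" for c K :: real
          using that by real_asymp
        ultimately have "(\<lambda>q. real t ^ 3 * exp (- (\<beta> * L) * real q)) \<longlonglongrightarrow> 0" by blast
        then show "(\<lambda>q. real t ^ 3 * exp (- (\<beta> * (L * q)))) \<longlonglongrightarrow> 0" by (simp add: mult.assoc)
      qed
      ultimately have "emeasure M (\<Inter>q. cyl \<omega> q) \<le> ennreal 0"
        by (intro LIMSEQ_le_const) auto
      then show ?thesis using sets unfolding eq by auto
    next
      case False
      then have empty: "{\<eta> \<in> space M. pt \<eta> = e} = {}" by blast
      show ?thesis unfolding empty by (auto simp: null_sets_def)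
    qed
    then have "(\<Union>e\<in>E. {\<eta> \<in> space M. pt \<eta> = e}) \<in> null_sets M" using E by (intro null_sets_UN') auto
    moreover have "(\<Union>e\<in>E. {\<eta> \<in> space M. pt \<eta> = e}) = {\<eta> \<in> space M. pt \<eta> \<in> E}" by blast
    ultimately show ?thesis by simp
  qed
  show ?thesis
  proof (rule that[OF \<delta>(1)])
    fix \<U> assume U: "\<U> \<in> finite_open_covers Y" "\<And>U. U \<in> \<U> \<Longrightarrow> diameter U < \<delta>"
    let ?I = "irregular_set {lo..hi} f \<inter> Y"
    have bdd: "bounded U" if "U \<in> \<U>" for U
    proof -
      have "U \<subseteq> closure Y" using U(1) that by (auto simp: finite_open_covers_def)
      moreover have "closure Y \<subseteq> {lo..hi}" using Y(2) by (intro closure_minimal) auto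
      ultimately show ?thesis using bounded_closed_interval bounded_subset by blast
    qed
    have mass: "ennreal (1 / real t ^ 3) \<le> entropy_premeasure Y f ?I \<alpha> \<U> N" if \<alpha>: "0 \<le> \<alpha>" "\<alpha> \<le> \<beta>" for \<alpha> N
      unfolding entropy_premeasure_def
    proof (rule INF_greatest)
      fix \<G> assume G: "\<G> \<in> string_coverings Y f ?I \<U> N"
      let ?g = "\<lambda>s :: real set list. ennreal (exp (- \<alpha> * real (length s)))"
      let ?K = "ennreal (real t ^ 3)"
      have str: "s \<in> strings \<U>" if "s \<in> \<G>" for s using G that by (auto simp: string_coverings_def)
      \<comment> \<open>This is \<open>length s / L\<close> rounded up, the number of times
        \<open>L * l\<close> below \<open>length s\<close>: the string determines that many symbols
        of the code, and \<open>L * q s\<close> is no less than its length.\<close>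
      define q where "q s = Suc ((length s - 1) div L)" for s :: "real set list"
      have q1: "L * l < length s" if "s \<in> \<G>" "l < q s" for s l
      proof -
        have "l \<le> (length s - 1) div L" using that by (simp add: q_def)
        then have "L * l \<le> length s - 1" using L_pos by (simp add: less_eq_div_iff_mult_less_eq mult.commute)
        moreover have "1 \<le> length s" using str[OF that(1)] by (simp add: strings_def)
        ultimately show ?thesis by linarith
      qed
      have q2: "length s \<le> L * q s" if "s \<in> \<G>" for s
        using dividend_less_times_div[OF L_pos, of "length s - 1"] by (simp add: q_def)
      define B where "B s = {\<eta> \<in> space M. pt \<eta> \<in> string_points Y f s}" for s
      have "\<exists>C. C \<in> sets M \<and> B s \<subseteq> C \<and> emeasure M C \<le> ?K * ?g s" if s: "s \<in> \<G>" for s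
      proof (cases "B s = {}")
        case True
        then show ?thesis by (intro exI[of _ "{}"]) auto
      next
        case False
        then obtain \<omega> where \<omega>: "\<omega> \<in> space M" "pt \<omega> \<in> string_points Y f s" by (auto simp: B_def)
        have "B s \<subseteq> cyl \<omega> (q s)"
        proof
          fix \<eta> assume "\<eta> \<in> B s"
          then have \<eta>: "\<eta> \<in> space M" "pt \<eta> \<in> string_points Y f s" by (auto simp: B_def)
          have "\<eta> l = \<omega> l" if l: "l < q s" for l
          proof (rule code_unique[OF \<eta>(1) \<omega>(1)])
            let ?U = "s ! (L * l)"
            have len: "L * l < length s" using q1[OF s l] .
            then have "?U \<in> \<U>" using str[OF s] by (auto simp: strings_def)
            moreover have "(f ^^ (L * l)) (pt \<eta>) \<in> ?U" "(f ^^ (L * l)) (pt \<omega>) \<in> ?U"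
              using \<eta>(2) \<omega>(2) len by (auto simp: string_points_def)
            ultimately show "dist ((f ^^ (L * l)) (pt \<eta>)) ((f ^^ (L * l)) (pt \<omega>)) < \<delta>"
              using diameter_bounded_bound[OF bdd] U(2) by (meson le_less_trans)
          qed
          then show "\<eta> \<in> cyl \<omega> (q s)" using \<eta>(1) by (simp add: cyl_def)
        qed
        moreover have "emeasure M (cyl \<omega> (q s)) \<le> ?K * ?g s"
        proof -
          have "\<alpha> * real (length s) \<le> \<beta> * (L * q s)"
            using \<alpha> \<beta> q2[OF s] by (intro mult_mono) (auto simp flip: of_nat_mult)
          then have "real t ^ 3 * exp (- (\<beta> * (L * q s))) \<le> real t ^ 3 * exp (- \<alpha> * real (length s))"
            by (intro mult_left_mono) auto
          then have "ennreal (real t ^ 3 * exp (- (\<beta> * (L * q s)))) \<le> ennreal (real t ^ 3 * exp (- \<alpha> * real (length s)))"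
            by (rule ennreal_leI)
          also have "\<dots> = ?K * ?g s" by (rule ennreal_mult) auto
          finally show ?thesis using cyl_measure[OF \<omega>(1), of "q s"] by (rule order_trans[rotated])
        qed
        ultimately show ?thesis using cyl_sets[OF \<omega>(1)] by blast
      qed
      then obtain C where C: "\<And>s. s \<in> \<G> \<Longrightarrow> C s \<in> sets M \<and> B s \<subseteq> C s \<and> emeasure M (C s) \<le> ?K * ?g s"
        by metis
      let ?N = "{\<eta> \<in> space M. pt \<eta> \<in> {lo..hi} - Y}"
      have cG: "countable \<G>" using G by (simp add: string_coverings_def)
      have "space M \<subseteq> (\<Union>s\<in>\<G>. C s) \<union> ?N"
      proof
        fix \<eta> assume \<eta>: "\<eta> \<in> space M"
        show "\<eta> \<in> (\<Union>s\<in>\<G>. C s) \<union> ?N"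
        proof (cases "pt \<eta> \<in> Y")
          case True
          then have "pt \<eta> \<in> ?I" using irr[OF \<eta>] by blast
          then obtain s where s: "s \<in> \<G>" "pt \<eta> \<in> string_points Y f s"
            using G unfolding string_coverings_def by blast
          then have "\<eta> \<in> C s" using \<eta> C[OF s(1)] by (auto simp: B_def)
          then show ?thesis using s by blast
        next
          case False
          moreover have "pt \<eta> \<in> {lo..hi}" using irr[OF \<eta>] by (simp add: irregular_set_def)
          ultimately show ?thesis using \<eta> by blast
        qed
      qed
      then have "emeasure M (space M) \<le> emeasure M ((\<Union>s\<in>\<G>. C s) \<union> ?N)"
        by (rule emeasure_mono) (use C cG null[OF Y(1)] in \<open>auto intro!: sets.Un sets.countable_UN' simp: null_setsD2\<close>)
      also have "\<dots> = emeasure M (\<Union>s\<in>\<G>. C s)"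
        by (rule emeasure_Un_null_set) (use C cG null[OF Y(1)] in \<open>auto intro!: sets.countable_UN'\<close>)
      also have "\<dots> \<le> ?K * (\<Sum>\<^sub>\<infinity>s\<in>\<G>. ?g s)"
        by (rule emeasure_UN_le_infsum[OF cG]) (use C in auto)
      finally have one: "1 \<le> ?K * (\<Sum>\<^sub>\<infinity>s\<in>\<G>. ?g s)"
        using Pr.P.emeasure_space_1 by (simp add: M_def)
      have "ennreal (1 / real t ^ 3) * 1 \<le> ennreal (1 / real t ^ 3) * (?K * (\<Sum>\<^sub>\<infinity>s\<in>\<G>. ?g s))"
        by (rule mult_left_mono[OF one]) simp
      also have "\<dots> = (ennreal (1 / real t ^ 3) * ?K) * (\<Sum>\<^sub>\<infinity>s\<in>\<G>. ?g s)" by (simp only: mult.assoc)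
      also have "ennreal (1 / real t ^ 3) * ?K = 1"
        using t by (subst ennreal_mult[symmetric]) auto
      finally show "ennreal (1 / real t ^ 3) \<le> (\<Sum>\<^sub>\<infinity>s\<in>\<G>. ?g s)" by simp
    qed
    show "ennreal ((1 - 3 / R) * ln (card (S - rotations w)) / L) \<le> cover_entropy Y f ?I \<U>"
      unfolding cover_entropy_def t_def[symmetric] \<beta>_def[symmetric]
    proof (rule INF_greatest)
      fix \<alpha> assume "\<alpha> \<in> {\<alpha>. 0 \<le> \<alpha> \<and> entropy_premeasure Y f ?I \<alpha> \<U> \<longlonglongrightarrow> 0}"
      then have \<alpha>: "0 \<le> \<alpha>" "entropy_premeasure Y f ?I \<alpha> \<U> \<longlonglongrightarrow> 0" by auto
      \<comment> \<open>Otherwise the premeasures stay above the positive constant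
        \<open>1 / real t ^ 3\<close> for all \<open>N\<close>.\<close>
      have "\<not> \<alpha> \<le> \<beta>"
      proof
        assume "\<alpha> \<le> \<beta>"
        then have "ennreal (1 / real t ^ 3) \<le> 0"
          using mass[OF \<alpha>(1)] by (intro LIMSEQ_le_const[OF \<alpha>(2)]) auto
        then show False using t by simp
      qed
      then show "ennreal \<beta> \<le> ennreal \<alpha>" by (intro ennreal_leI) simp
    qed
  qed
qed

end

section \<open>Entropy of the irregular set\<close>

lemma regular_domain_invariant:
  assumes "f ` X \<subseteq> X"
  shows "f ` regular_domain X f \<subseteq> regular_domain X f"
proof (rule image_subsetI)
  fix x assume x: "x \<in> regular_domain X f"
  have "(f ^^ n) (f x) \<notin> discontinuities X f" for n
  proof -
    have "(f ^^ Suc n) x \<notin> discontinuities X f" using x unfolding regular_domain_def by blast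
    then show ?thesis by (simp add: funpow_swap1)
  qed
  then show "f x \<in> regular_domain X f" using x assms by (auto simp: regular_domain_def)
qed

lemma regular_domain_continuous:
  assumes "continuous_on X f"
  shows "regular_domain X f = X"
  using assms by (auto simp: regular_domain_def discontinuities_def continuous_on_eq_continuous_within)

lemma countable_discontinuities:
  assumes "piecewise_monotonic {a..b} f"
  shows "countable (discontinuities {a..b} f)"
proof -
  obtain P where P: "finite P" "partition_on {a..b} P" "\<forall>J\<in>P. is_interval J \<and> continuous_on J f"
    using assms unfolding piecewise_monotonic_def by blast
  have "discontinuities {a..b} f \<subseteq> (\<Union>J\<in>P. {Inf J, Sup J})"
  proof
    fix x assume x: "x \<in> discontinuities {a..b} f"
    then have "x \<in> \<Union>P" using P(2) by (auto simp: discontinuities_def partition_on_def)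
    then obtain J where J: "J \<in> P" "x \<in> J" by blast
    have "x \<notin> interior J"
    proof
      assume "x \<in> interior J"
      then have "continuous (at x) f" using P(3) J(1) by (meson continuous_on_interior)
      then have "continuous (at x within {a..b}) f" by (rule continuous_at_imp_continuous_at_within)
      then show False using x by (simp add: discontinuities_def)
    qed
    have "\<not> (\<exists>u\<in>J. \<exists>v\<in>J. u < x \<and> x < v)"
    proof
      assume "\<exists>u\<in>J. \<exists>v\<in>J. u < x \<and> x < v"
      then obtain u v where uv: "u \<in> J" "v \<in> J" "u < x" "x < v" by blast
      have "{u<..<v} \<subseteq> J" using mem_is_interval_1_I[of J u v] P(3) J(1) uv by auto
      then have "x \<in> interior J" using uv by (intro interiorI[of "{u<..<v}"]) auto
      then show False using \<open>x \<notin> interior J\<close> by blast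
    qed
    then have "(\<forall>u\<in>J. x \<le> u) \<or> (\<forall>u\<in>J. u \<le> x)" by (meson not_le)
    then have "x = Inf J \<or> x = Sup J"
      using J(2) by (auto intro: cInf_eq_minimum[symmetric] cSup_eq_maximum[symmetric])
    then show "x \<in> (\<Union>J\<in>P. {Inf J, Sup J})" using J(1) by blast
  qed
  moreover have "countable (\<Union>J\<in>P. {Inf J, Sup J})" using P(1) by (intro countable_finite) auto
  ultimately show ?thesis by (rule countable_subset)
qed

lemma countable_preimage_piecewise_monotonic:
  assumes "piecewise_monotonic X f" "countable D"
  shows "countable (X \<inter> f -` D)"
proof -
  obtain P where P: "finite P" "partition_on X P" "\<forall>J\<in>P. strict_mono_on J f \<or> strict_antimono_on J f"
    using assms(1) unfolding piecewise_monotonic_def by blast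
  have "countable (J \<inter> f -` D)" if "J \<in> P" for J
  proof (rule countable_image_inj_on)
    show "countable (f ` (J \<inter> f -` D))" by (rule countable_subset[OF _ assms(2)]) auto
    show "inj_on f (J \<inter> f -` D)"
    proof (rule inj_onI)
      fix x y assume xy: "x \<in> J \<inter> f -` D" "y \<in> J \<inter> f -` D" "f x = f y"
      have "x < y \<Longrightarrow> f x \<noteq> f y" "y < x \<Longrightarrow> f x \<noteq> f y"
        using P(3) that xy(1,2) by (fastforce simp: monotone_on_def)+
      then show "x = y" using xy(3) by fastforce
    qed
  qed
  then have "countable (\<Union>J\<in>P. J \<inter> f -` D)" by (intro countable_UN) (use P(1) countable_finite in auto)
  moreover have "X \<inter> f -` D \<subseteq> (\<Union>J\<in>P. J \<inter> f -` D)" using P(2) by (auto simp: partition_on_def)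
  ultimately show ?thesis by (rule countable_subset[rotated])
qed

text \<open>Injectivity on each lap keeps preimages of countable sets countable, and the codes of
  countably many points form a null set.\<close>

lemma countable_irregular_domain:
  assumes f: "piecewise_monotonic {a..b} f" "f ` {a..b} \<subseteq> {a..b}"
  shows "countable ({a..b} - regular_domain {a..b} f)"
proof -
  let ?D = "discontinuities {a..b} f"
  have "countable ({a..b} \<inter> (f ^^ n) -` ?D)" for n
  proof (induction n)
    case 0
    then show ?case using countable_discontinuities[OF f(1)] by (auto intro: countable_subset)
  next
    case (Suc n)
    have eq: "{a..b} \<inter> (f ^^ Suc n) -` ?D = {a..b} \<inter> f -` ({a..b} \<inter> (f ^^ n) -` ?D)"
      using f(2) by (auto simp: funpow_swap1 simp del: atLeastAtMost_iff)
    show ?case unfolding eq by (rule countable_preimage_piecewise_monotonic[OF f(1) Suc])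
  qed
  then have "countable (\<Union>n. {a..b} \<inter> (f ^^ n) -` ?D)" by (intro countable_UN) auto
  moreover have "{a..b} - regular_domain {a..b} f = (\<Union>n. {a..b} \<inter> (f ^^ n) -` ?D)"
    by (auto simp: regular_domain_def)
  ultimately show ?thesis by simp
qed

lemma (in finite_invariant) symbol_coding_exists:
  fixes \<alpha> \<beta> :: real
  assumes "\<not> light (exp (- \<alpha>)) (closed_walks f P b)" "b \<in> vertices f P" "0 \<le> \<beta>" "\<beta> < \<alpha>"
  obtains L S where "symbol_coding f P b L S" "card S \<ge> exp (\<beta> * L) + L + 2"
proof (rule disjoint_symbols[OF assms])
  fix L S assume "L > 0" "finite S" "S \<subseteq> {w \<in> closed_walks f P b. length w = L}"
    and avoid: "\<And>s x. s \<in> S \<Longrightarrow> x \<in> walk_set f s \<Longrightarrow> x \<notin> P"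
    and unique: "\<And>s s' x. s \<in> S \<Longrightarrow> s' \<in> S \<Longrightarrow> x \<in> walk_set f s \<Longrightarrow> x \<in> walk_set f s' \<Longrightarrow> s = s'"
    and "card S \<ge> exp (\<beta> * L) + L + 2"
  moreover have "symbol_coding f P b L S"
  proof
    show "x \<notin> P" if "s \<in> S" "x \<in> walk_set f s" for s x using avoid that .
    show "s = s'" if "s \<in> S" "s' \<in> S" "x \<in> walk_set f s" "x \<in> walk_set f s'" for s s' x
      using unique that .
  qed fact+
  ultimately show thesis by (intro that[of L S])
qed

text \<open>The rate falls from \<alpha> to \<beta> in three steps: \<open>\<beta>1\<close> for the
  closed walks of the Markov graph, \<open>\<beta>2\<close> for the disjoint symbols, and \<beta>
  once the forced positions are charged.\<close>

lemma entropy_irregular_ge: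
  fixes f :: "real \<Rightarrow> real" and \<alpha> \<beta> :: real
  assumes f: "f ` {lo..hi} \<subseteq> {lo..hi}"
    and adapted: "\<And>k \<delta>. \<delta> > 0 \<Longrightarrow> \<exists>\<B>. adapted_pieces f {lo..hi} k \<delta> \<B>"
    and Y: "Y \<subseteq> {lo..hi}" "f ` Y \<subseteq> Y" "countable ({lo..hi} - Y)" "Y \<noteq> {}"
    and U: "\<U> \<in> finite_open_covers Y" "ennreal \<alpha> < cover_entropy Y f Y \<U>"
    and \<beta>: "0 \<le> \<beta>" "\<beta> < \<alpha>"
  shows "ennreal \<beta> \<le> Pesin_Pitskel_entropy Y f (irregular_set {lo..hi} f \<inter> Y)"
proof -
  have "closure Y \<subseteq> {lo..hi}" using Y(1) by (intro closure_minimal) auto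
  then have cpt: "compact (closure Y)" using compact_Icc closed_closure by (metis closed_subset compact_closure bounded_closed_interval bounded_subset closure_closure)
  obtain \<delta> where \<delta>: "\<delta> > 0" "\<And>T. T \<subseteq> closure Y \<Longrightarrow> diameter T < \<delta> \<Longrightarrow> \<exists>U\<in>\<U>. T \<subseteq> U"
    using Lebesgue_number_finite_open_cover[OF cpt Y(4) U(1)] by blast
  have \<alpha>: "0 < \<alpha>" using \<beta> by simp
  \<comment> \<open>At most two letters are partial from any state, so \<open>light_accepted\<close>
    asks for \<open>2 * exp (- (\<alpha> * k)) < 1\<close>.\<close>
  obtain k where k: "ln 2 < real k * \<alpha>" using reals_Archimedean3[OF \<alpha>] by blast
  then have k0: "k > 0" using ln_gt_zero[of "2 :: real"] by (cases "k = 0") auto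
  have "exp (- (\<alpha> * k)) < exp (- ln 2)" using k by (simp add: mult.commute)
  then have half: "exp (- (\<alpha> * k)) < 1 / 2" by (simp add: exp_minus)
  obtain \<B> where ad: "adapted_pieces f {lo..hi} k (\<delta> / 2) \<B>" using adapted[of "\<delta> / 2" k] \<delta>(1) by auto
  interpret B: interval_pieces "f ^^ k" \<B> by (rule interval_pieces_adapted[OF ad])
  have BX: "\<Union>\<B> = {lo..hi}" using interval_partitionD(2)[OF adapted_piecesD(1)[OF ad]] .
  have "\<exists>B. \<not> light (exp (- (\<alpha> * k))) (B.loops B)"
  proof (rule ccontr)
    assume "\<not> ?thesis"
    then have light: "light (exp (- (\<alpha> * k))) {w. B.accepts {lo..hi} w}"
      using half by (intro B.light_accepted) (auto simp: is_interval_cc)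
    have "cover_entropy Y f Y \<U> \<le> ennreal \<alpha>"
    proof (rule B.cover_entropy_le_if_light[OF refl k0 Y(2) _ Y(1) _ _ light])
      show "\<exists>U\<in>\<U>. (f ^^ j) ` B \<inter> Y \<subseteq> U" if B: "B \<in> \<B>" "j < k" for B j
      proof (rule \<delta>(2))
        show "(f ^^ j) ` B \<inter> Y \<subseteq> closure Y" using closure_subset by blast
        have "diameter ((f ^^ j) ` B \<inter> Y) \<le> \<delta> / 2"
        proof (rule diameter_le)
          fix x y assume "x \<in> (f ^^ j) ` B \<inter> Y" "y \<in> (f ^^ j) ` B \<inter> Y"
          then show "norm (x - y) \<le> \<delta> / 2" using adapted_piecesD(3)[OF ad B] by force
        qed (use \<delta> in simp)
        then show "diameter ((f ^^ j) ` B \<inter> Y) < \<delta>" using \<delta>(1) by simp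
      qed
    qed (use BX Y \<alpha> in auto)
    then show False using U(2) by simp
  qed
  then obtain B where B: "\<not> light (exp (- (\<alpha> * k))) (B.loops B)" by blast
  define \<beta>1 where "\<beta>1 = (\<alpha> + \<beta>) / 2"
  define \<beta>2 where "\<beta>2 = (\<beta>1 + \<beta>) / 2"
  have \<beta>12: "\<beta> < \<beta>1" "\<beta>1 < \<alpha>" using \<beta> by (simp_all add: \<beta>1_def)
  then have "\<beta> < \<beta>2" "\<beta>2 < \<beta>1" by (simp_all add: \<beta>2_def)
  then have \<beta>s: "\<beta> < \<beta>2" "\<beta>2 < \<beta>1" "\<beta>1 < \<alpha>" "0 \<le> \<beta>1" "0 < \<beta>2" using \<beta> \<beta>12 by linarith+
  have "\<Union>\<B> \<subseteq> {lo..hi}" using BX by simp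
  then obtain P b where P: "finite P" "P \<subseteq> {lo..hi}" "f ` P \<subseteq> P" "b \<in> vertices f P"
    "\<not> light (exp (- \<beta>1)) (closed_walks f P b)"
    by (rule B.heavy_closed_walks[OF refl k0 f _ adapted_piecesD(2)[OF ad] B \<beta>s(4,3)])
  interpret P: finite_invariant f P by unfold_locales (use P in auto)
  obtain L S where LS: "symbol_coding f P b L S" "card S \<ge> exp (\<beta>2 * L) + L + 2"
    by (rule P.symbol_coding_exists[OF P(5,4) less_imp_le[OF \<beta>s(5)] \<beta>s(2)])
  interpret C: symbol_coding f P b L S by (rule LS(1))
  have "card S \<noteq> 0" using LS(2) exp_gt_zero[of "\<beta>2 * L"] by linarith
  then obtain w where w: "w \<in> S" by fastforce
  define t where "t = card (S - C.rotations w)"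
  \<comment> \<open>Discarding the rotations of \<open>w\<close> costs at most \<open>L + 1\<close>
    symbols; of the \<open>L + 2\<close> symbols provided on top of the exponential, one is left,
    which ensures that there are two free symbols.\<close>
  have "card (C.rotations w) \<le> L + 1"
    unfolding C.rotations_def using card_image_le[of "{..L}" "\<lambda>r. rotate r w"] by simp
  moreover have "finite (C.rotations w)" by (simp add: C.rotations_def)
  then have "card S - card (C.rotations w) \<le> t" unfolding t_def by (rule diff_card_le_card_Diff)
  ultimately have "card S \<le> t + (L + 1)" by linarith
  then have "real (card S) \<le> real (t + (L + 1))" by (simp only: of_nat_le_iff)
  then have t: "exp (\<beta>2 * L) + 1 \<le> t" using LS(2) by simp
  moreover have "1 \<le> exp (\<beta>2 * L)" using \<beta>s by simp
  ultimately have t2: "2 \<le> t" by linarith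
  have "\<beta>2 * L \<le> ln t" using t t2 by (subst ln_ge_iff) auto
  then have lnt: "\<beta>2 \<le> ln t / L" using C.L_pos by (simp add: pos_le_divide_eq)
  \<comment> \<open>\<open>R\<close> must be so large that the loss \<open>3 * \<beta>2 / R\<close>
    is at most \<open>\<beta>2 - \<beta>\<close>.\<close>
  obtain R0 :: nat where R0: "3 * \<beta>2 < real R0 * (\<beta>2 - \<beta>)" using reals_Archimedean3[of "\<beta>2 - \<beta>"] \<beta>s by auto
  define R where "R = max 4 R0"
  have R4: "4 \<le> R" by (simp add: R_def)
  have "real R0 * (\<beta>2 - \<beta>) \<le> real R * (\<beta>2 - \<beta>)"
    by (rule mult_right_mono) (use \<beta>s in \<open>simp_all add: R_def\<close>)
  then have "3 * \<beta>2 \<le> (\<beta>2 - \<beta>) * real R" using R0 by (simp add: mult.commute)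
  then have "3 * \<beta>2 / R \<le> \<beta>2 - \<beta>" using R4 by (subst pos_divide_le_eq) auto
  then have "\<beta> \<le> (1 - 3 / R) * \<beta>2" by (simp add: left_diff_distrib)
  also have "\<dots> \<le> (1 - 3 / R) * (ln t / L)" by (rule mult_left_mono[OF lnt]) (simp add: R_def)
  finally have \<beta>t: "\<beta> \<le> (1 - 3 / R) * ln t / L" by simp
  obtain \<epsilon> where \<epsilon>: "\<epsilon> > 0" "\<forall>\<V>\<in>finite_open_covers Y. (\<forall>V\<in>\<V>. diameter V < \<epsilon>) \<longrightarrow>
      ennreal ((1 - 3 / R) * ln t / L) \<le> cover_entropy Y f (irregular_set {lo..hi} f \<inter> Y) \<V>"
    unfolding t_def by (rule C.cover_entropy_irregular_ge[OF w R4 t2[unfolded t_def] P(2) f Y(3,1)]) blast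
  have "\<exists>\<V>\<in>finite_open_covers Y. \<forall>V\<in>\<V>. diameter V < \<epsilon>"
  proof (rule ccontr)
    assume "\<not> ?thesis"
    then have "eventually (\<lambda>_. False) (small_covers Y)" unfolding eventually_small_covers using \<epsilon>(1) by blast
    then show False using small_covers_neq_bot[OF cpt] by (simp add: trivial_limit_def)
  qed
  then obtain \<V> where V: "\<V> \<in> finite_open_covers Y" "\<And>V. V \<in> \<V> \<Longrightarrow> diameter V < \<epsilon>" by blast
  have "ennreal \<beta> \<le> ennreal ((1 - 3 / R) * ln t / L)" using \<beta>t by (rule ennreal_leI)
  also have "\<dots> \<le> cover_entropy Y f (irregular_set {lo..hi} f \<inter> Y) \<V>" using \<epsilon>(2) V by blast
  also have "\<dots> \<le> Pesin_Pitskel_entropy Y f (irregular_set {lo..hi} f \<inter> Y)"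
    unfolding Pesin_Pitskel_entropy_eq_SUP[OF cpt Y(4)] by (rule SUP_upper[OF V(1)])
  finally show ?thesis .
qed

theorem theorem2p4:
  fixes f :: "real \<Rightarrow> real" and a b :: real
  assumes "a \<le> b"
    and "f \<in> {a..b} \<rightarrow> {a..b}"
    and "continuous_on {a..b} f \<or> piecewise_monotonic {a..b} f"
  shows "htop_set {a..b} f (irregular_set {a..b} f) = htop {a..b} f"
proof -
  let ?Y = "regular_domain {a..b} f" and ?I = "irregular_set {a..b} f"
  have f: "f ` {a..b} \<subseteq> {a..b}" using assms(2) by blast
  have adapted: "\<exists>\<B>. adapted_pieces f {a..b} k \<delta> \<B>" if "\<delta> > 0" for k \<delta>
    using assms(3) adapted_pieces_continuous[OF _ f that] adapted_pieces_monotonic[OF _ f that] by blast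
  have Y1: "?Y \<subseteq> {a..b}" by (auto simp: regular_domain_def)
  have Y2: "f ` ?Y \<subseteq> ?Y" by (rule regular_domain_invariant[OF f])
  have Y3: "countable ({a..b} - ?Y)" "?Y \<noteq> {}"
  proof -
    \<comment> \<open>On a one-point interval every map is continuous. For \<open>a < b\<close> the
      interval is uncountable, so that removing a countable set leaves \<open>?Y\<close>
      nonempty.\<close>
    consider "continuous_on {a..b} f" | "piecewise_monotonic {a..b} f" "a < b"
      using assms(1,3) by (cases "a = b") auto
    then have "countable ({a..b} - ?Y) \<and> ?Y \<noteq> {}"
    proof cases
      case 1
      then show ?thesis using assms(1) by (simp add: regular_domain_continuous)
    next
      case 2
      have c: "countable ({a..b} - ?Y)" by (rule countable_irregular_domain[OF 2(1) f])
      moreover have "?Y \<noteq> {}"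
      proof
        assume "?Y = {}"
        then show False using c uncountable_closed_interval[of a b] 2(2) by simp
      qed
      ultimately show ?thesis by blast
    qed
    then show "countable ({a..b} - ?Y)" "?Y \<noteq> {}" by blast+
  qed
  have cpt: "compact (closure ?Y)"
    using bounded_subset[OF bounded_closed_interval Y1] by (simp add: compact_closure)
  have "Pesin_Pitskel_entropy ?Y f (?I \<inter> ?Y) = Pesin_Pitskel_entropy ?Y f ?Y"
  proof (rule antisym)
    show "Pesin_Pitskel_entropy ?Y f (?I \<inter> ?Y) \<le> Pesin_Pitskel_entropy ?Y f ?Y"
      by (rule Pesin_Pitskel_entropy_mono[OF cpt Y3(2)]) auto
    have "cover_entropy ?Y f ?Y \<U> \<le> Pesin_Pitskel_entropy ?Y f (?I \<inter> ?Y)"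
      if U: "\<U> \<in> finite_open_covers ?Y" for \<U>
    proof (rule ccontr)
      assume "\<not> ?thesis"
      then have "Pesin_Pitskel_entropy ?Y f (?I \<inter> ?Y) < cover_entropy ?Y f ?Y \<U>" by (simp only: not_le)
      \<comment> \<open>Two values are inserted because entropy above \<alpha> only yields each
        \<beta> below \<alpha>. Both are finite even if the cover has infinite entropy.\<close>
      from dense[OF this] obtain u where u: "Pesin_Pitskel_entropy ?Y f (?I \<inter> ?Y) < u"
        "u < cover_entropy ?Y f ?Y \<U>" by blast
      from dense[OF u(2)] obtain v where v: "u < v" "v < cover_entropy ?Y f ?Y \<U>" by blast
      have "u \<noteq> \<top>" "v \<noteq> \<top>" using less_le_trans[OF v(1) top_greatest] less_le_trans[OF v(2) top_greatest] by simp_all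
      then obtain \<alpha> \<beta> where \<beta>: "0 \<le> \<beta>" "u = ennreal \<beta>" and \<alpha>: "0 \<le> \<alpha>" "v = ennreal \<alpha>"
        by (metis ennreal_cases)
      have less: "\<beta> < \<alpha>" using v(1) unfolding \<beta>(2) \<alpha>(2) by (simp only: ennreal_less_iff[OF \<beta>(1)])
      have "ennreal \<beta> \<le> Pesin_Pitskel_entropy ?Y f (?I \<inter> ?Y)"
        by (rule entropy_irregular_ge[OF f adapted Y1 Y2 Y3 U v(2)[unfolded \<alpha>(2)] \<beta>(1) less])
      from leD[OF this] u(1) show False unfolding \<beta>(2) by blast
    qed
    then show "Pesin_Pitskel_entropy ?Y f ?Y \<le> Pesin_Pitskel_entropy ?Y f (?I \<inter> ?Y)"
      unfolding Pesin_Pitskel_entropy_eq_SUP[OF cpt Y3(2), of f ?Y] by (rule SUP_least)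
  qed
  then show ?thesis by (simp add: htop_set_def htop_def)
qed

end
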